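(* Let $n\ge 2$, $m=\lfloor n/2\rfloor$, let $D$ be an open $SL(n,\mathbb{R})$-orbit in the manifold $Z$ of complete flags in $\mathbb{C}^n$, and let $C_0$ be its base cycle. The number of Schubert varieties $S_w$ with $\dim S_w+\dim C_0=\dim Z$ and $S_w\cap C_0\ne\emptyset$ is the double factorial $$(n-1)(n-3)\cdots(n-2m+1).$$
   Context: Let $G=SL(n,\mathbb{C})$, $G_0=SL(n,\mathbb{R})$, $K_0=SO(n,\mathbb{R})$, $B\subset G$ the upper triangular Borel subgroup, $Z=G/B$. The base cycle $C_0$ of an open $G_0$-orbit $D\subset Z$ is the unique $K_0$-orbit in $D$ which is a complex submanifold. For $w\in\Sigma_n$ let $V_w$ be the complete flag with $k$-th subspace $\langle e_{w(1)},\dots,e_{w(k)}\rangle$; the Schubert variety $S_w$ is the closure of $B.V_w$ in $Z$. *)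

theory Defs
  imports "HOL-Analysis.Analysis"
begin

section \<open>Complete flags\<close>

text \<open>
  Coordinates of \<open>\<complex>\<^sup>n\<close> are indexed by a finite linearly ordered type \<open>'n\<close> with \<open>n = CARD('n)\<close>
  elements, playing the role of \<open>{1, \<dots>, n}\<close>. The same type indexes the nonzero members of a
  flag: if \<open>i\<close> is the \<open>k\<close>-th element of \<open>'n\<close>, i.e. \<open>k = card {..i}\<close>, then \<open>F i\<close> is the
  \<open>k\<close>-dimensional member of \<open>F\<close>. The prefix \<open>vec\<close> denotes linear algebra over \<open>\<complex>\<close>, while the
  unprefixed \<open>subspace\<close>, \<open>span\<close>, \<open>dim\<close> would be over \<open>\<real>\<close>.
\<close>

type_synonym 'n flag = "'n \<Rightarrow> (complex^'n) set"

definition flags :: "('n::{finite,wellorder}) flag set" where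
  "flags = {F. (\<forall>i. vec.subspace (F i) \<and> vec.dim (F i) = card {..i}) \<and>
               (\<forall>i j. i \<le> j \<longrightarrow> F i \<subseteq> F j)}"

definition coord_flag :: "('n \<Rightarrow> 'n) \<Rightarrow> ('n::{finite,wellorder}) flag" where
  "coord_flag w = (\<lambda>k. vec.span {axis (w j) 1 | j. j \<le> k})"

definition flag_act :: "complex^'n^'n \<Rightarrow> ('n::finite) flag \<Rightarrow> 'n flag" where
  "flag_act g F = (\<lambda>i. (*v) g ` F i)"

definition orbit :: "(complex^'n^'n) set \<Rightarrow> ('n::finite) flag \<Rightarrow> 'n flag set" where
  "orbit H F = (\<lambda>g. flag_act g F) ` H"


section \<open>The groups\<close>

definition SL_complex :: "(complex^'n^'n) set" where
  "SL_complex = {g. det g = 1}"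

definition SL_real :: "(complex^'n^'n) set" where
  "SL_real = map_matrix complex_of_real ` {A. det A = 1}"

definition SO_real :: "(complex^'n^'n) set" where
  "SO_real = map_matrix complex_of_real ` {A. rotation_matrix A}"

definition borel_upper :: "(complex^('n::{finite,wellorder})^('n::_)) set" where
  "borel_upper = {g \<in> SL_complex. \<forall>i j. j < i \<longrightarrow> g $ i $ j = 0}"


section \<open>The complex manifold of complete flags\<close>

text \<open>
  \<open>borel_upper\<close> is the stabilizer of \<open>coord_flag id\<close>, so the orbit map of \<open>coord_flag id\<close>
  identifies \<open>flags\<close> with \<open>G/B\<close>; the topology is the quotient topology.
\<close>

definition flag_topology :: "('n::{finite,wellorder}) flag topology" where
  "flag_topology = topology (\<lambda>U. U \<subseteq> flags \<and>
     openin (top_of_set SL_complex) {g \<in> SL_complex. flag_act g (coord_flag id) \<in> U})"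

lemma openin_flag_topology:
  fixes U :: "('n::{finite,wellorder}) flag set"
  shows "openin flag_topology U \<longleftrightarrow> U \<subseteq> flags \<and>
     openin (top_of_set SL_complex) {g \<in> SL_complex. flag_act g (coord_flag id) \<in> U}"
proof -
  have "istopology (\<lambda>U::'n flag set. U \<subseteq> flags \<and>
     openin (top_of_set SL_complex) {g \<in> SL_complex. flag_act g (coord_flag id) \<in> U})"
    unfolding istopology_def
  proof (rule conjI; safe)
    fix S T :: "'n flag set"
    assume "openin (top_of_set SL_complex) {g \<in> SL_complex. flag_act g (coord_flag id) \<in> S}"
      "openin (top_of_set SL_complex) {g \<in> SL_complex. flag_act g (coord_flag id) \<in> T}"
    from openin_Int[OF this]
    show "openin (top_of_set SL_complex) {g \<in> SL_complex. flag_act g (coord_flag id) \<in> S \<inter> T}"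
      by (rule back_subst) blast
  next
    fix K :: "'n flag set set"
    assume "\<forall>S\<in>K. S \<subseteq> flags \<and>
      openin (top_of_set SL_complex) {g \<in> SL_complex. flag_act g (coord_flag id) \<in> S}"
    then have "openin (top_of_set SL_complex)
        (\<Union>S\<in>K. {g \<in> SL_complex. flag_act g (coord_flag id) \<in> S})"
      by blast
    then show "openin (top_of_set SL_complex)
        {g \<in> SL_complex. flag_act g (coord_flag id) \<in> \<Union> K}"
      by (rule back_subst) blast
  qed auto
  then show ?thesis
    by (simp add: flag_topology_def topology_inverse')
qed

text \<open>
  The model space of the charts: strictly lower triangular matrices, stored as vectors indexed by
  pairs so that \<open>vec\<close> applies to them; its complex dimension is \<open>n(n-1)/2\<close>.
\<close>

definition strictly_lower :: "(complex^('n::{finite,wellorder} \<times> 'n)) set" where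
  "strictly_lower = {x. \<forall>i j. i \<le> j \<longrightarrow> x $ (i, j) = 0}"

text \<open>
  The standard chart at \<open>g B\<close>, written as a parametrization: \<open>x \<mapsto> g (1 + x) B\<close>, which maps
  \<open>strictly_lower\<close> biholomorphically onto an open neighbourhood of \<open>g B\<close> (a translate of the
  big cell). These charts form the usual holomorphic atlas of \<open>G/B\<close>.
\<close>

definition flag_chart ::
    "complex^('n::{finite,wellorder})^('n::_) \<Rightarrow> complex^('n \<times> 'n) \<Rightarrow> 'n flag" where
  "flag_chart g x = flag_act (g ** (mat 1 + (\<chi> i j. x $ (i, j)))) (coord_flag id)"

text \<open>
  Holomorphy on a relatively open subset \<open>W\<close> of a complex subspace: differentiability within
  \<open>W\<close> with a complex linear derivative. Off the subspace the derivative is unconstrained, and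
  the existential picks a complex linear extension.
\<close>

definition vec_holomorphic_on :: "(complex^'m \<Rightarrow> complex^'k) \<Rightarrow> (complex^'m) set \<Rightarrow> bool" where
  "vec_holomorphic_on f W \<longleftrightarrow>
     (\<forall>x\<in>W. \<exists>f'. (f has_derivative f') (at x within W) \<and> Vector_Spaces.linear (*s) (*s) f')"

definition biholomorphic ::
    "(complex^'m \<Rightarrow> complex^'k) \<Rightarrow> (complex^'m) set \<Rightarrow> (complex^'k) set \<Rightarrow> bool" where
  "biholomorphic \<psi> W W' \<longleftrightarrow>
     bij_betw \<psi> W W' \<and> vec_holomorphic_on \<psi> W \<and> vec_holomorphic_on (inv_into W \<psi>) W'"

text \<open>
  (Locally closed, embedded) complex submanifolds of complex dimension \<open>d\<close>: every point has a
  holomorphic coordinate system \<open>\<psi>\<close>, compatible with the standard charts, in which \<open>M\<close> is a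
  \<open>d\<close>-dimensional complex linear subspace.
\<close>

definition complex_submanifold :: "nat \<Rightarrow> ('n::{finite,wellorder}) flag set \<Rightarrow> bool" where
  "complex_submanifold d M \<longleftrightarrow> M \<subseteq> flags \<and>
     (\<forall>p\<in>M. \<exists>g\<in>SL_complex. \<exists>W W' L.
      \<exists>\<psi> :: complex^('n \<times> 'n) \<Rightarrow> complex^('n \<times> 'n).
        flag_act g (coord_flag id) = p \<and>
        openin (top_of_set strictly_lower) W \<and> 0 \<in> W \<and>
        openin (top_of_set strictly_lower) W' \<and> biholomorphic \<psi> W W' \<and>
        vec.subspace L \<and> L \<subseteq> strictly_lower \<and> vec.dim L = d \<and>
        {x \<in> W. flag_chart g x \<in> M} = {x \<in> W. \<psi> x \<in> L})"

text \<open>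
  Dimension of a nonempty, possibly singular, subset of the flag manifold, as in complex analytic
  geometry: the largest dimension of a nonempty complex submanifold contained in it. For analytic
  sets this is the maximal dimension at regular points, and for a submanifold its own dimension.
\<close>

definition complex_dim :: "('n::{finite,wellorder}) flag set \<Rightarrow> nat" where
  "complex_dim A = Max {d. \<exists>M. M \<noteq> {} \<and> M \<subseteq> A \<and> complex_submanifold d M}"


section \<open>Open orbits, base cycles, Schubert varieties\<close>

definition open_real_orbit :: "('n::{finite,wellorder}) flag set \<Rightarrow> bool" where
  "open_real_orbit D \<longleftrightarrow> (\<exists>F\<in>flags. D = orbit SL_real F) \<and> openin flag_topology D"

text \<open>
  By a theorem of Wolf, every open orbit \<open>D\<close> has exactly one base cycle; existence and uniqueness
  are not part of the predicate.
\<close>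

definition is_base_cycle ::
    "('n::{finite,wellorder}) flag set \<Rightarrow> 'n flag set \<Rightarrow> bool" where
  "is_base_cycle D C \<longleftrightarrow>
     (\<exists>F\<in>D. C = orbit SO_real F) \<and> C \<subseteq> D \<and> (\<exists>d. complex_submanifold d C)"

definition schubert_variety :: "('n \<Rightarrow> 'n) \<Rightarrow> ('n::{finite,wellorder}) flag set" where
  "schubert_variety w = flag_topology closure_of (orbit borel_upper (coord_flag w))"

end

theory Submission
  imports Defs
begin

text \<open>
  Differentiating curves in the base cycle \<open>C0\<close> shows that its tangent spaces are complex only if its
  flags are isotropic, \<open>F\<^sub>i\<close> being orthogonal to \<open>F\<^sub>n\<^sub>-\<^sub>i\<close> for the standard symmetric form; conversely
  the orthogonal group acts transitively on isotropic flags. This gives the codimension of \<open>C0\<close>, the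
  number \<open>\<kappa>\<close> of pairs \<open>j < i \<le> n + 1 - j\<close>.

  The form is nondegenerate on the coordinate subspaces fixed by the Borel group. Hence an isotropic
  flag in the Schubert cell of \<open>v\<close> forces a ballot condition on the word \<open>v\<^sup>-\<^sup>1\<close>: in every prefix, at
  most as many letters are \<open>\<le> t\<close> as are \<open>\<ge> n + 1 - t\<close>. As long as such a word does not arise by
  repeatedly inserting \<open>n + 1 - c, c\<close> as adjacent letters, a transposition shortens it within the
  ballot words; the words that do arise in this way all have length \<open>\<kappa>\<close>. So the ballot words have
  length at least \<open>\<kappa>\<close>, with equality for exactly the inserted words, and since lengths decrease strictly
  in the closure order, a Schubert variety of dimension \<open>\<kappa>\<close> meets \<open>C0\<close> only in its open cell. For the
  inserted words explicit isotropic flags lie in that cell. A word of length \<open>n - 2k\<close> has \<open>n - 2k + 1\<close>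
  places to insert the next pair, whence the product.
\<close>

section \<open>Permutations and the ballot condition\<close>

text \<open>\<open>complex_dim\<close> is a maximum over all submanifolds of a set, and
  \<open>is_base_cycle\<close> only asserts that some SO(n)-orbit is a complex submanifold. Both are
  therefore accessed through \<open>flag_tangent\<close>, which is built from differentiable curves
  of frames alone. The complex structure enters as closure of these tangent spaces under
  multiplication by \<i>: with the velocity of a rotation, a real skew matrix X, the velocity \<i>X
  is tangent as well. Along a curve with that velocity the symmetric Gram matrix of the frames is
  constant to first order, while the Hermitian one in general is not. Both depend on the same upper
  triangular factor b, since frames over the orbit have the form k U b with k real orthogonal.
  Comparing their leading entries forces isotropy. The number \<kappa> comes from the linearized
  isotropy equations: they couple each entry below the diagonal with its mirror image in the
  antidiagonal, which leaves one independent condition for each mirror pair.\<close>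

definition pos :: "'n::{finite,wellorder} \<Rightarrow> nat" where
  "pos i = card {..i}"

lemma pos_less_iff [simp]:
  fixes i j :: "'n::{finite,wellorder}"
  shows "pos i < pos j \<longleftrightarrow> i < j"
proof -
  have *: "pos i < pos j" if "i < j" for i j :: 'n
    unfolding pos_def using that by (intro psubset_card_mono) auto
  show ?thesis
    using *[of i j] *[of j i] by (cases i j rule: linorder_cases) auto
qed

lemma pos_eq_iff [simp]: "pos i = pos j \<longleftrightarrow> i = j"
  using pos_less_iff[of i j] pos_less_iff[of j i] by (metis linorder_neq_iff)

lemma pos_le_iff [simp]: "pos i \<le> pos j \<longleftrightarrow> i \<le> j"
  using pos_less_iff[of j i] by (simp add: linorder_not_less[symmetric] del: pos_less_iff)

lemma bij_betw_pos: "bij_betw pos (UNIV :: 'n::{finite,wellorder} set) {1..CARD('n)}"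
proof -
  have "pos i \<in> {1..CARD('n)}" for i :: 'n
    unfolding pos_def by (auto simp: Suc_le_eq card_gt_0_iff intro: card_mono)
  then have "range (pos :: 'n \<Rightarrow> nat) \<subseteq> {1..CARD('n)}"
    by blast
  moreover have "inj (pos :: 'n \<Rightarrow> nat)"
    by (simp add: inj_on_def)
  ultimately show ?thesis
    by (simp add: bij_betw_def card_subset_eq card_image)
qed

lemma pos_le_card: "pos (i::'n::{finite,wellorder}) \<le> CARD('n)"
  and pos_gt_0: "0 < pos (i::'n)"
  using bij_betwE[OF bij_betw_pos, rule_format, of i] by auto

text \<open>The longest permutation k -> n + 1 - k, transported along \<open>pos\<close> because the
  index type has no arithmetic of its own.\<close>

definition opp :: "'n::{finite,wellorder} \<Rightarrow> 'n" where
  "opp i = inv_into UNIV pos (CARD('n) + 1 - pos i)"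

lemma pos_opp: "pos (opp i) = CARD('n) + 1 - pos (i::'n::{finite,wellorder})"
proof -
  have "CARD('n) + 1 - pos i \<in> pos ` (UNIV :: 'n set)"
    unfolding bij_betw_imp_surj_on[OF bij_betw_pos]
    using pos_le_card[of i] pos_gt_0[of i] by auto
  then show ?thesis
    unfolding opp_def by (rule f_inv_into_f)
qed

lemma opp_opp [simp]: "opp (opp i) = i"
  using pos_le_card[of i] by (subst pos_eq_iff[symmetric]) (simp add: pos_opp del: pos_eq_iff)

lemma opp_less_iff [simp]: "opp i < opp j \<longleftrightarrow> j < i"
  using pos_le_card[of i] pos_le_card[of j]
  by (subst (1 2) pos_less_iff[symmetric]) (auto simp: pos_opp simp del: pos_less_iff)

lemma opp_le_iff [simp]: "opp i \<le> opp j \<longleftrightarrow> j \<le> i"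
  by (simp add: linorder_not_less[symmetric])

lemma opp_eq_iff [simp]: "opp i = opp j \<longleftrightarrow> i = j"
  by (metis opp_opp)

lemma opp_less_commute: "opp i < j \<longleftrightarrow> opp j < i"
  by (metis opp_opp opp_less_iff)

lemma less_opp_commute: "i < opp j \<longleftrightarrow> j < opp i"
  by (metis opp_opp opp_less_iff)

lemma inj_opp: "inj_on opp A"
  by (simp add: inj_on_def)

section \<open>Inversions and the rank form of the Bruhat order\<close>

definition inversions :: "('n::{finite,wellorder} \<Rightarrow> 'n) \<Rightarrow> ('n \<times> 'n) set" where
  "inversions v = {(a, b). a < b \<and> v b < v a}"

text \<open>Move an inversion by the transposition if its two places stay in order, and keep it
  otherwise. This injects the inversions of the new permutation into those of \<open>v\<close> and
  misses \<open>(k, j)\<close>.\<close>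

lemma card_inversions_transpose:
  assumes "k < j" "v j < v k"
  shows "card (inversions (v \<circ> Transposition.transpose k j)) < card (inversions v)"
proof -
  define \<tau> where "\<tau> = Transposition.transpose k j"
  define \<phi> where "\<phi> = (\<lambda>(a, b). if \<tau> a < \<tau> b then (\<tau> a, \<tau> b) else (a, b))"
  have \<tau>\<tau>: "\<tau> (\<tau> x) = x" for x
    by (simp add: \<tau>_def)
  have inj: "inj_on \<phi> (inversions (v \<circ> \<tau>))"
  proof (rule inj_onI, clarify)
    fix a b c d
    assume "(a, b) \<in> inversions (v \<circ> \<tau>)" "(c, d) \<in> inversions (v \<circ> \<tau>)"
      and "\<phi> (a, b) = \<phi> (c, d)"
    then show "a = c \<and> b = d"
      by (auto simp: \<phi>_def inversions_def \<tau>\<tau> split: if_splits) (metis \<tau>\<tau> less_asym)+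
  qed
  have "\<phi> ` inversions (v \<circ> \<tau>) \<subseteq> inversions v - {(k, j)}"
  proof (rule image_subsetI, unfold split_paired_all)
    fix a b assume ab: "(a, b) \<in> inversions (v \<circ> \<tau>)"
    show "\<phi> (a, b) \<in> inversions v - {(k, j)}"
    proof (cases "\<tau> a < \<tau> b")
      case True
      have "(\<tau> a, \<tau> b) \<noteq> (k, j)"
      proof
        assume "(\<tau> a, \<tau> b) = (k, j)"
        then have "a = \<tau> k" "b = \<tau> j"
          using \<tau>\<tau> by auto
        then show False
          using ab assms by (auto simp: inversions_def \<tau>_def)
      qed
      with True ab show ?thesis
        by (auto simp: \<phi>_def inversions_def)
    next
      case False
      then show ?thesis
        using ab assms by (auto simp: \<phi>_def inversions_def \<tau>_def Transposition.transpose_def split: if_splits)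
    qed
  qed
  then have "card (inversions (v \<circ> \<tau>)) \<le> card (inversions v - {(k, j)})"
    using inj by (metis card_image card_mono finite)
  also have "\<dots> < card (inversions v)"
    using assms by (intro psubset_card_mono) (auto simp: inversions_def)
  finally show ?thesis
    by (simp add: \<tau>_def)
qed

text \<open>The rank matrix of a permutation. On the Schubert cell of \<open>v\<close> its entries
  are the dimensions of the intersections of flag members with coordinate subspaces, see
  \<open>flag_rank_schubert_cell\<close>.\<close>

definition rank_count :: "('n::{finite,wellorder} \<Rightarrow> 'n) \<Rightarrow> 'n \<Rightarrow> 'n \<Rightarrow> nat" where
  "rank_count v k l = card {i. i \<le> k \<and> v i \<le> l}"

text \<open>A bound \<open>< x\<close> is a bound \<open>\<le> l\<close> for the predecessor
  \<open>l\<close> of \<open>x\<close>; for the least \<open>x\<close> there is nothing to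
  count.\<close>

lemma rank_count_less_mono:
  assumes "\<And>k l. rank_count w k l \<le> rank_count v k l"
  shows "card {i. i \<le> k \<and> w i < x} \<le> card {i. i \<le> k \<and> v i < x}"
proof (cases "{..<x} = {}")
  case True
  then have "{i. i \<le> k \<and> w i < x} = {}"
    by auto
  then show ?thesis by (simp only: card.empty)
next
  case False
  define l where "l = Max {..<x}"
  have "l < x"
    using Max_in[of "{..<x}"] False by (auto simp: l_def)
  then have "y < x \<longleftrightarrow> y \<le> l" for y
    using Max_ge[of "{..<x}" y] by (auto simp: l_def)
  then show ?thesis
    using assms[of k l] by (simp add: rank_count_def)
qed

text \<open>
  This is the rank form of the Bruhat order. At the first position \<open>k\<close> where \<open>v\<close> and \<open>w\<close> differ, the
  value at \<open>k\<close> drops from \<open>w\<close> to \<open>v\<close>, and exchanging it with the next value of \<open>w\<close> in the interval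
  \<open>{v k..<w k}\<close> removes inversions of \<open>w\<close> while keeping its ranks below those of \<open>v\<close>.
\<close>

lemma rank_count_mono_imp:
  assumes "inj v" "inj w" "\<And>k l. rank_count w k l \<le> rank_count v k l"
  shows "v = w \<or> card (inversions v) < card (inversions w)"
  using assms(2,3)
proof (induction "card (inversions w)" arbitrary: w rule: less_induct)
  case less
  show ?case
  proof (cases "v = w")
    case False
    define k where "k = (LEAST k. v k \<noteq> w k)"
    have ex: "\<exists>k. v k \<noteq> w k"
      using False by (simp add: fun_eq_iff)
    have vwk: "v k \<noteq> w k"
      unfolding k_def by (rule LeastI_ex[OF ex])
    have agree: "v i = w i" if "i < k" for i
      using that not_less_Least unfolding k_def by blast
    have "v k < w k"
    proof (rule ccontr)
      assume "\<not> v k < w k"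
      with vwk have "w k < v k" by simp
      then have "{i. i \<le> k \<and> v i \<le> w k} \<subset> {i. i \<le> k \<and> w i \<le> w k}"
        using agree by (auto simp: le_less)
      then have "rank_count v k (w k) < rank_count w k (w k)"
        unfolding rank_count_def by (intro psubset_card_mono) auto
      then show False
        using less.prems(2)[of k "w k"] by simp
    qed
    have "surj w"
      using finite_UNIV_inj_surj[OF _ less.prems(1)] by simp
    then obtain j0 where j0: "w j0 = v k"
      by (metis surjE)
    have "k < j0"
      using j0 vwk agree[of j0] assms(1) by (metis injD linorder_neqE)
    define j where "j = (LEAST j. k < j \<and> v k \<le> w j \<and> w j < w k)"
    have j: "k < j \<and> v k \<le> w j \<and> w j < w k"
      unfolding j_def using \<open>k < j0\<close> j0 \<open>v k < w k\<close> 
      by (intro LeastI[of "\<lambda>j. k < j \<and> v k \<le> w j \<and> w j < w k" j0]) simp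
    have below_j: "\<not> (v k \<le> w i \<and> w i < w k)" if "k < i" "i < j" for i
      using not_less_Least[of i "\<lambda>j. k < j \<and> v k \<le> w j \<and> w j < w k"] that
      unfolding j_def by blast
    define w' where "w' = w \<circ> Transposition.transpose k j"
    have fewer: "card (inversions w') < card (inversions w)"
      unfolding w'_def using j by (intro card_inversions_transpose) auto
    have "rank_count w' i l \<le> rank_count v i l" for i l
    proof -
      consider "i < k" | "j \<le> i" | "k \<le> i" "i < j" by fastforce
      then show ?thesis
      proof cases
        case 1
        then have "{a. a \<le> i \<and> w' a \<le> l} = {a. a \<le> i \<and> w a \<le> l}"
          using j by (auto simp: w'_def Transposition.transpose_def)
        then show ?thesis
          using less.prems(2)[of i l] by (simp add: rank_count_def)
      next
        case 2
        have "{a. a \<le> i \<and> w' a \<le> l} = Transposition.transpose k j ` {a. a \<le> i \<and> w a \<le> l}"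
        proof (intro equalityI subsetI)
          fix x assume "x \<in> {a. a \<le> i \<and> w' a \<le> l}"
          then have "Transposition.transpose k j x \<in> {a. a \<le> i \<and> w a \<le> l}"
            using j 2 by (auto simp: w'_def Transposition.transpose_def)
          then show "x \<in> Transposition.transpose k j ` {a. a \<le> i \<and> w a \<le> l}"
            by (metis image_eqI transpose_involutory)
        next
          fix x assume "x \<in> Transposition.transpose k j ` {a. a \<le> i \<and> w a \<le> l}"
          then show "x \<in> {a. a \<le> i \<and> w' a \<le> l}"
            using j 2 by (auto simp: w'_def) (auto simp: Transposition.transpose_def)
        qed
        then have "rank_count w' i l = rank_count w i l"
          by (simp add: rank_count_def card_image inj_on_transpose)
        then show ?thesis
          using less.prems(2)[of i l] by simp
      next
        case 3
        show ?thesis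
        proof (cases "w j \<le> l \<and> l < w k")
          case False
          then have "{a. a \<le> i \<and> w' a \<le> l} \<subseteq> {a. a \<le> i \<and> w a \<le> l}"
            using 3 by (auto simp: w'_def Transposition.transpose_def split: if_splits)
          then have "rank_count w' i l \<le> rank_count w i l"
            unfolding rank_count_def by (intro card_mono) auto
          then show ?thesis
            using less.prems(2)[of i l] by simp
        next
          case True
          \<comment> \<open>Only in this window can the exchange raise a rank of \<open>w\<close>,
            and then by the single place \<open>k\<close>. A place up to \<open>i\<close> with
            \<open>w\<close>-value in \<open>{v k..l}\<close> lies before \<open>k\<close>, since
            \<open>j\<close> is the first later place with value in \<open>{v k..<w k}\<close>.
            There \<open>v\<close> and \<open>w\<close> agree, so \<open>v\<close> counts these
            places too, and in addition it counts \<open>k\<close>.\<close>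
          define B where "B = {a. a < k \<and> v k \<le> v a \<and> v a \<le> l}"
          have "{a. a \<le> i \<and> w' a \<le> l} \<subseteq> insert k {a. a \<le> i \<and> w a \<le> l}"
            using 3 by (auto simp: w'_def Transposition.transpose_def split: if_splits)
          also have "{a. a \<le> i \<and> w a \<le> l} \<subseteq> {a. a \<le> i \<and> w a < v k} \<union> B"
          proof
            fix a assume a: "a \<in> {a. a \<le> i \<and> w a \<le> l}"
            show "a \<in> {a. a \<le> i \<and> w a < v k} \<union> B"
            proof (cases a k rule: linorder_cases)
              case less
              with a agree show ?thesis by (auto simp: B_def)
            next
              case greater
              have "a < j" "w a < w k"
                using a 3 True by auto
              with a below_j[OF greater] show ?thesis by auto
            qed (use a True in auto)
          qed
          finally have "rank_count w' i l \<le> card (insert k ({a. a \<le> i \<and> w a < v k} \<union> B))"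
            unfolding rank_count_def by (intro card_mono) auto
          also have "\<dots> \<le> Suc (card {a. a \<le> i \<and> w a < v k} + card B)"
            by (intro order_trans[OF card_insert_le_m1]) (auto simp: card_insert_if intro: card_Un_le le_SucI)
          also have "\<dots> \<le> Suc (card {a. a \<le> i \<and> v a < v k} + card B)"
            using rank_count_less_mono[of w v i "v k"] less.prems(2) by simp
          also have "\<dots> = card (insert k ({a. a \<le> i \<and> v a < v k} \<union> B))"
            by (subst card_insert_disjoint, (auto simp: B_def)[2], subst card_Un_disjoint) (auto simp: B_def)
          also have "\<dots> \<le> rank_count v i l"
            unfolding rank_count_def using 3 True j by (intro card_mono) (auto simp: B_def)
          finally show ?thesis .
        qed
      qed
    qed
    moreover have "inj w'"
      unfolding w'_def using less.prems(1) by (simp add: inj_compose)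
    ultimately have "v = w' \<or> card (inversions v) < card (inversions w')"
      using less.hyps[OF fewer] by blast
    then show ?thesis
      using fewer by auto
  qed simp
qed

text \<open>
  Read the inverse of \<open>v\<close> as a word, so that \<open>v j\<close> is the place of the letter \<open>j\<close>. Then \<open>generous\<close>
  is a ballot condition on all prefixes, and \<open>special\<close> describes the words obtained by inserting,
  from the innermost pair outwards, the letters \<open>opp c, c\<close> next to each other.
\<close>

definition generous :: "('n::{finite,wellorder} \<Rightarrow> 'n) \<Rightarrow> bool" where
  "generous v \<longleftrightarrow> (\<forall>l t. t < opp t \<longrightarrow>
     card {j. j \<le> t \<and> v j \<le> l} \<le> card {j. opp t \<le> j \<and> v j \<le> l})"

definition special_at :: "('n::{finite,wellorder} \<Rightarrow> 'n) \<Rightarrow> 'n \<Rightarrow> bool" where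
  "special_at v c \<longleftrightarrow> v (opp c) < v c \<and>
     (\<forall>x. c < x \<and> x < opp c \<longrightarrow> \<not> (v (opp c) < v x \<and> v x < v c))"

definition special :: "('n::{finite,wellorder} \<Rightarrow> 'n) \<Rightarrow> bool" where
  "special v \<longleftrightarrow> (\<forall>c. c < opp c \<longrightarrow> special_at v c)"

definition half_pairs :: "('n::{finite,wellorder} \<times> 'n) set" where
  "half_pairs = {(j, i). j < i \<and> i \<le> opp j}"

text \<open>For \<open>c < x \<le> opp c\<close> exactly one of \<open>(c, x)\<close> and
  \<open>(x, opp c)\<close> is an inversion, because \<open>v x\<close> does not lie strictly
  between \<open>v (opp c)\<close> and \<open>v c\<close>. The map \<open>f\<close> picks that one.
  Conversely an inversion \<open>(a, b)\<close> comes from \<open>(a, b)\<close> if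
  \<open>b \<le> opp a\<close>, and from \<open>(opp b, a)\<close> otherwise.\<close>

lemma card_inversions_special:
  fixes v :: "'n::{finite,wellorder} \<Rightarrow> 'n"
  assumes "inj v" "special v"
  shows "card (inversions v) = card (half_pairs :: ('n \<times> 'n) set)"
proof -
  define f where "f = (\<lambda>(c, x). if v x < v c then (c, x) else (x, opp c))"
  have sp: "special_at v c" if "c < opp c" for c
    using assms(2) that by (simp add: special_def)
  have inj: "inj_on f half_pairs"
    by (rule inj_onI) (auto simp: f_def half_pairs_def split: if_splits)
  have f_in: "f (c, x) \<in> inversions v" if "(c, x) \<in> half_pairs" for c x
  proof -
    have cx: "c < x" "x \<le> opp c"
      using that by (auto simp: half_pairs_def)
    then have "special_at v c"
      using sp by auto
    then show ?thesis
      using cx assms(1) by (auto simp: f_def inversions_def special_at_def le_less dest: injD)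
  qed
  have onto: "(a, b) \<in> f ` half_pairs" if ab: "(a, b) \<in> inversions v" for a b
  proof (cases "b \<le> opp a")
    case True
    then show ?thesis
      using ab by (intro image_eqI[of _ _ "(a, b)"]) (auto simp: f_def inversions_def half_pairs_def)
  next
    case False
    then have "opp b < a"
      by (simp add: opp_less_commute)
    moreover have "a < b" "v b < v a"
      using ab by (auto simp: inversions_def)
    moreover from calculation have "special_at v (opp b)"
      by (intro sp) auto
    ultimately show ?thesis
      by (intro image_eqI[of _ _ "(opp b, a)"]) (auto simp: f_def half_pairs_def special_at_def)
  qed
  have "f ` half_pairs = inversions v"
  proof (rule equalityI)
    show "f ` half_pairs \<subseteq> inversions v"
      by (rule image_subsetI) (metis f_in surj_pair)
    show "inversions v \<subseteq> f ` half_pairs"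
      by (rule subsetI) (metis onto surj_pair)
  qed
  then show ?thesis
    using card_image[OF inj] by simp
qed

text \<open>
  For the outermost pair \<open>i, opp i\<close> violating \<open>special\<close>, exchange \<open>opp i\<close> with the largest letter \<open>z\<close>
  of the inner pairs that stands between \<open>opp i\<close> and \<open>i\<close>. A prefix in which the ballot condition for
  \<open>t\<close> could fail afterwards has \<open>z < opp t\<close>, so no high letters but those of outer pairs are left
  to compensate the low letter \<open>i\<close> that is still to come.
\<close>

lemma generous_descent:
  fixes v :: "'n::{finite,wellorder} \<Rightarrow> 'n"
  assumes "inj v" "generous v" "\<not> special v"
  obtains k j where "k < j" "v j < v k" "generous (v \<circ> Transposition.transpose k j)"
proof -
  define i where "i = (LEAST c. c < opp c \<and> \<not> special_at v c)"
  have i: "i < opp i" "\<not> special_at v i"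
    using LeastI_ex[of "\<lambda>c. c < opp c \<and> \<not> special_at v c"] assms(3)
    by (auto simp: i_def special_def)
  have outer: "c < opp i \<and> i < opp c \<and> opp i < opp c" "special_at v c" if "c < i" for c
  proof -
    show c: "c < opp i \<and> i < opp c \<and> opp i < opp c"
      using that i(1) by (auto simp: less_opp_commute[of i c])
    have "c < opp c"
      using c that by auto
    then show "special_at v c"
      using not_less_Least[of c "\<lambda>c. c < opp c \<and> \<not> special_at v c"] that
      unfolding i_def by blast
  qed
  \<comment> \<open>The pair of \<open>c\<close> is special and encloses the letter
    \<open>i\<close>, whose place therefore cannot separate \<open>opp c\<close> from
    \<open>c\<close>.\<close>
  have outer_le: "v c \<le> v i" if "c < i" "v (opp c) \<le> v i" for c
  proof -
    have "opp c \<noteq> i" using outer(1)[OF that(1)] by auto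
    then have "v (opp c) < v i"
      using that(2) assms(1) by (metis injD le_less)
    then show ?thesis
      using outer[OF that(1)] that(1) by (auto simp: special_at_def)
  qed
  have outer_less: "v (opp c) < v c" if "c < i" for c
    using outer(2)[OF that] by (simp add: special_at_def)
  \<comment> \<open>Otherwise the prefix ending with the letter \<open>i\<close> violates the ballot
    condition for \<open>t = i\<close>: each of its high letters belongs to an outer pair whose low
    letter has also occurred, and \<open>i\<close> itself stays unmatched.\<close>
  have opp_i: "v (opp i) < v i"
  proof (rule ccontr)
    assume "\<not> v (opp i) < v i"
    then have gt: "v i < v (opp i)"
      using assms(1) i(1) by (metis injD linorder_neqE order_less_irrefl)
    have "{j. opp i \<le> j \<and> v j \<le> v i} \<subseteq> opp ` {c. c < i \<and> v c \<le> v i}"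
    proof
      fix j assume j: "j \<in> {j. opp i \<le> j \<and> v j \<le> v i}"
      with gt have "opp i < j"
        by (auto simp: le_less)
      then have "opp j < i"
        by (simp add: opp_less_commute)
      with j outer_le[of "opp j"] show "j \<in> opp ` {c. c < i \<and> v c \<le> v i}"
        by (intro image_eqI[of _ _ "opp j"]) auto
    qed
    from card_mono[OF _ this]
    have "card {j. opp i \<le> j \<and> v j \<le> v i} \<le> card {c. c < i \<and> v c \<le> v i}"
      by (simp add: card_image inj_opp)
    also have "\<dots> < card {j. j \<le> i \<and> v j \<le> v i}"
      by (intro psubset_card_mono) auto
    also have "\<dots> \<le> card {j. opp i \<le> j \<and> v j \<le> v i}"
      using assms(2) i(1) by (simp add: generous_def)
    finally show False by simp
  qed
  define X where "X = {x. i < x \<and> x < opp i \<and> v (opp i) < v x \<and> v x < v i}"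
  define z where "z = Max X"
  have "X \<noteq> {}"
    using i opp_i by (auto simp: special_at_def X_def)
  then have "z \<in> X"
    unfolding z_def by (intro Max_in) auto
  then have z: "i < z" "z < opp i" "v (opp i) < v z" "v z < v i"
    by (auto simp: X_def)
  have z_max: "x \<le> z" if "x \<in> X" for x
    unfolding z_def using that by (intro Max_ge) auto
  define v' where "v' = v \<circ> Transposition.transpose z (opp i)"
  have "generous v'"
    unfolding generous_def
  proof (intro allI impI)
    fix l t :: 'n assume t: "t < opp t"
    have gen: "card {j. j \<le> t \<and> v j \<le> l} \<le> card {j. opp t \<le> j \<and> v j \<le> l}" for l
      using assms(2) t by (simp add: generous_def)
    show "card {j. j \<le> t \<and> v' j \<le> l} \<le> card {j. opp t \<le> j \<and> v' j \<le> l}"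
    proof (cases "v (opp i) \<le> l \<and> l < v z")
      case False
      then have "v' j \<le> l \<longleftrightarrow> v j \<le> l" for j
        using z by (auto simp: v'_def Transposition.transpose_def)
      then show ?thesis
        using gen by simp
    next
      case True
      have v'_le: "v' j \<le> l \<longleftrightarrow> j = z \<or> (j \<noteq> opp i \<and> v j \<le> l)" for j
        using True z by (auto simp: v'_def Transposition.transpose_def)
      consider "t < i" | "i \<le> t" "opp t \<le> z" | "i \<le> t" "z < opp t" by fastforce
      then show ?thesis
      proof cases
        case 1
        have "opp i < opp t" using 1 by simp
        then have "z < opp t" "t < z" "t < opp i"
          using z 1 i(1) by (metis less_trans)+
        then have "{j. j \<le> t \<and> v' j \<le> l} = {j. j \<le> t \<and> v j \<le> l}"
          "{j. opp t \<le> j \<and> v' j \<le> l} = {j. opp t \<le> j \<and> v j \<le> l}"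
          using \<open>z < opp t\<close> \<open>t < z\<close> \<open>t < opp i\<close> \<open>opp i < opp t\<close>
          unfolding v'_le by auto
        then show ?thesis using gen by simp
      next
        case 2
        have "opp t \<le> opp i" using 2 by simp
        have "{j. j \<le> t \<and> v' j \<le> l} = {j. j \<le> t \<and> v j \<le> l}"
          using 2 z t \<open>opp t \<le> opp i\<close> unfolding v'_le by auto
        moreover have "{j. opp t \<le> j \<and> v' j \<le> l} = insert z ({j. opp t \<le> j \<and> v j \<le> l} - {opp i})"
          using 2 z unfolding v'_le by auto
        moreover have "card (insert z ({j. opp t \<le> j \<and> v j \<le> l} - {opp i})) =
            Suc (card ({j. opp t \<le> j \<and> v j \<le> l} - {opp i}))"
          using True by (intro card_insert_disjoint) auto
        moreover have "\<dots> = card {j. opp t \<le> j \<and> v j \<le> l}"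
          using True \<open>opp t \<le> opp i\<close> by (intro card_Suc_Diff1) auto
        ultimately show ?thesis using gen by simp
      next
        case 3
        have ti: "opp t \<le> opp i" using 3 by simp
        \<comment> \<open>\<open>A\<close> collects the low letters of outer pairs that occur after
          place \<open>l\<close> but not after \<open>i\<close>, and \<open>Z\<close> is the letter
          \<open>z\<close> if it counts as low. Prolonging the prefix from \<open>l\<close> to
          \<open>v i\<close> adds \<open>A\<close>, \<open>Z\<close> and \<open>i\<close> on the low
          side, but on the high side only partners of \<open>A\<close>, by maximality of
          \<open>z\<close>. The ballot condition at \<open>v i\<close> thus leaves enough slack at
          \<open>l\<close> for the loss of \<open>opp i\<close> and the early arrival of
          \<open>z\<close>.\<close>
        define A where "A = {c. c < i \<and> l < v c \<and> v c \<le> v i}"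
        define Z where "Z = (if z \<le> t then {z} else {})"
        have li: "l < v i" using True z(4) by (metis less_trans)
        have ti': "t < opp i" using t ti by (rule less_le_trans)
        have L: "{j. j \<le> t \<and> v' j \<le> l} = {j. j \<le> t \<and> v j \<le> l} \<union> Z"
          using ti' unfolding v'_le Z_def by auto
        have R: "{j. opp t \<le> j \<and> v' j \<le> l} = {j. opp t \<le> j \<and> v j \<le> l} - {opp i}"
          using 3 unfolding v'_le by auto
        have "{j. opp t \<le> j \<and> v j \<le> v i} \<subseteq> {j. opp t \<le> j \<and> v j \<le> l} \<union> opp ` A"
        proof
          fix j assume "j \<in> {j. opp t \<le> j \<and> v j \<le> v i}"
          then have j: "opp t \<le> j" "v j \<le> v i" by auto
          show "j \<in> {j. opp t \<le> j \<and> v j \<le> l} \<union> opp ` A"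
          proof (cases "v j \<le> l")
            case False
            have "j \<noteq> i" using j 3 t by auto
            then have "v j < v i" using j assms(1) by (metis injD le_less)
            have "\<not> j \<le> z" "i < j" using j 3 t by auto
            moreover have "v (opp i) < v j" "j \<noteq> opp i" using False True by auto
            ultimately have "opp i < j"
              using z_max[of j] \<open>v j < v i\<close> by (auto simp: X_def linorder_neq_iff)
            then have "opp j < i" by (simp add: opp_less_commute)
            then have "opp j \<in> A"
              using outer_le[of "opp j"] outer_less[of "opp j"] j False by (auto simp: A_def)
            then show ?thesis
              by (metis UnI2 image_eqI opp_opp)
          qed (use j in auto)
        qed
        from card_mono[OF _ this]
        have "card {j. opp t \<le> j \<and> v j \<le> v i} \<le> card ({j. opp t \<le> j \<and> v j \<le> l} \<union> opp ` A)"
          by simp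
        also have "\<dots> \<le> card {j. opp t \<le> j \<and> v j \<le> l} + card (opp ` A)"
          by (rule card_Un_le)
        finally have "card {j. opp t \<le> j \<and> v j \<le> v i} \<le> card {j. opp t \<le> j \<and> v j \<le> l} + card A"
          by (simp add: card_image inj_opp)
        moreover have "card ({j. j \<le> t \<and> v j \<le> l} \<union> (A \<union> (Z \<union> {i}))) \<le> card {j. j \<le> t \<and> v j \<le> v i}"
          using 3 z li by (intro card_mono) (auto simp: A_def Z_def split: if_splits)
        moreover have "card ({j. j \<le> t \<and> v j \<le> l} \<union> (A \<union> (Z \<union> {i}))) =
            card {j. j \<le> t \<and> v j \<le> l} + (card A + (card Z + 1))"
          using 3 z li True
          by (subst card_Un_disjoint, (auto simp: A_def Z_def split: if_splits)[3],
              subst card_Un_disjoint, (auto simp: A_def Z_def split: if_splits)[3],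
              subst card_Un_disjoint) (auto simp: A_def Z_def split: if_splits)
        ultimately have "card {j. j \<le> t \<and> v j \<le> l} + card Z + 1 \<le> card {j. opp t \<le> j \<and> v j \<le> l}"
          using gen[of "v i"] by linarith
        moreover have "card {j. opp t \<le> j \<and> v' j \<le> l} = card {j. opp t \<le> j \<and> v j \<le> l} - 1"
          unfolding R using ti True by (subst card_Diff_singleton) auto
        moreover have "card {j. j \<le> t \<and> v' j \<le> l} \<le> card {j. j \<le> t \<and> v j \<le> l} + card Z"
          unfolding L by (rule card_Un_le)
        ultimately show ?thesis by linarith
      qed
    qed
  qed
  then show ?thesis
    using that[of z "opp i"] z by (simp add: v'_def)
qed

lemma generous_inversions:
  fixes v :: "'n::{finite,wellorder} \<Rightarrow> 'n"
  assumes "inj v" "generous v"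
  shows "special v \<or> card (half_pairs :: ('n \<times> 'n) set) < card (inversions v)"
  using assms
proof (induction "card (inversions v)" arbitrary: v rule: less_induct)
  case less
  show ?case
  proof (cases "special v")
    case False
    then obtain k j where kj: "k < j" "v j < v k" "generous (v \<circ> Transposition.transpose k j)"
      using generous_descent less.prems by blast
    define v' where "v' = v \<circ> Transposition.transpose k j"
    have fewer: "card (inversions v') < card (inversions v)"
      unfolding v'_def using kj by (intro card_inversions_transpose)
    have inj: "inj v'"
      unfolding v'_def using less.prems(1) by (simp add: inj_compose)
    then show ?thesis
      using less.hyps[OF fewer inj] kj(3) card_inversions_special[OF inj] fewer
      by (auto simp: v'_def)
  qed simp
qed

section \<open>Counting the words built by inserting pairs\<close>

definition middle :: "nat \<Rightarrow> 'n::{finite,wellorder} set" where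
  "middle k = {x. k < pos x \<and> pos x \<le> CARD('n) - k}"

text \<open>The filter hides the letters of outer pairs, which are inserted later and may separate
  \<open>opp c\<close> from \<open>c\<close>.\<close>

definition adjacent_at :: "'n::{finite,wellorder} list \<Rightarrow> 'n \<Rightarrow> bool" where
  "adjacent_at ys c \<longleftrightarrow>
     (\<exists>xs zs. filter (\<lambda>x. c \<le> x \<and> x \<le> opp c) ys = xs @ opp c # c # zs)"

text \<open>The words before the \<open>k\<close> outermost pairs are inserted: \<open>k = 0\<close>
  gives the complete words, and \<open>k = n div 2\<close> leaves at most the letter fixed by
  \<open>opp\<close>.\<close>

definition special_words :: "nat \<Rightarrow> 'n::{finite,wellorder} list set" where
  "special_words k = {ys. distinct ys \<and> set ys = middle k \<and>
     (\<forall>c\<in>middle k. c < opp c \<longrightarrow> adjacent_at ys c)}"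

lemma card_middle: "card (middle k :: 'n::{finite,wellorder} set) = CARD('n) - 2 * k"
proof -
  have "pos ` (middle k :: 'n set) = {k<..CARD('n) - k}"
  proof -
    have "x \<in> pos ` (middle k :: 'n set)" if x: "k < x" "x \<le> CARD('n) - k" for x
    proof -
      have "x \<in> pos ` (UNIV :: 'n set)"
        using x unfolding bij_betw_imp_surj_on[OF bij_betw_pos] by auto
      then show ?thesis
        using x by (auto simp: middle_def)
    qed
    then show ?thesis
      by (auto simp: middle_def)
  qed
  moreover have "card (pos ` (middle k :: 'n set)) = card (middle k :: 'n set)"
    by (intro card_image) (simp add: inj_on_def)
  ultimately show ?thesis by simp
qed

lemma middle_eq_interval:
  fixes c :: "'n::{finite,wellorder}"
  assumes "pos c = Suc k"
  shows "middle k = {c..opp c}" "middle (Suc k) = {c<..<opp c}"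
proof -
  have "k < pos x \<longleftrightarrow> c \<le> x" "Suc k < pos x \<longleftrightarrow> c < x" for x
    unfolding assms[symmetric] pos_le_iff[symmetric] pos_less_iff[symmetric] by (auto simp: assms)
  moreover have "pos x \<le> CARD('n) - k \<longleftrightarrow> x \<le> opp c"
    "pos x \<le> CARD('n) - Suc k \<longleftrightarrow> x < opp c" for x
    unfolding pos_le_iff[symmetric] pos_less_iff[symmetric] pos_opp
    using pos_le_card[of c] pos_gt_0[of x] by (auto simp: assms simp del: pos_le_iff pos_less_iff)
  ultimately show "middle k = {c..opp c}" "middle (Suc k) = {c<..<opp c}"
    by (auto simp: middle_def)
qed

text \<open>The letter \<open>h\<close> is new, so its position in the long word recovers both the
  short word and the gap. A word of length \<open>card A\<close> has \<open>card A + 1\<close>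
  gaps.\<close>

lemma card_insert_pair:
  assumes W: "\<And>ys. ys \<in> W \<Longrightarrow> distinct ys \<and> set ys = A" and h: "h \<notin> A" "h \<noteq> l"
  shows "card {xs @ h # l # zs | xs zs. xs @ zs \<in> W} = (card A + 1) * card W"
proof -
  define f where "f = (\<lambda>(ys, i). take i ys @ h # l # drop i ys)"
  have len: "length ys = card A" if "ys \<in> W" for ys
    using W[OF that] distinct_card by fastforce
  have "inj_on f (W \<times> {..card A})"
  proof (rule inj_onI, clarsimp)
    fix ys i zs j
    assume *: "ys \<in> W" "i \<le> card A" "zs \<in> W" "j \<le> card A" "f (ys, i) = f (zs, j)"
    have "h \<notin> set ys"
      using W *(1) h by auto
    then have "take i ys = take j zs" "l # drop i ys = l # drop j zs"
      using *(5) h append_Cons_eq_iff[of h "take i ys" "l # drop i ys" "take j zs" "l # drop j zs"]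
        in_set_takeD[of h i ys] in_set_dropD[of h i ys]
      by (auto simp: f_def)
    moreover from this have "length (take i ys) = length (take j zs)"
      by simp
    then have "i = j"
      using len[OF *(1)] len[OF *(3)] *(2,4) by simp
    ultimately show "ys = zs \<and> i = j"
      by (metis append_take_drop_id list.inject)
  qed
  moreover have "f ` (W \<times> {..card A}) = {xs @ h # l # zs | xs zs. xs @ zs \<in> W}"
  proof (intro equalityI subsetI)
    fix x assume "x \<in> f ` (W \<times> {..card A})"
    then obtain ys i where "ys \<in> W" "x = take i ys @ h # l # drop i ys"
      by (auto simp: f_def)
    then show "x \<in> {xs @ h # l # zs | xs zs. xs @ zs \<in> W}"
      by (intro CollectI exI[of _ "take i ys"] exI[of _ "drop i ys"]) simp
  next
    fix x assume "x \<in> {xs @ h # l # zs | xs zs. xs @ zs \<in> W}"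
    then obtain xs zs where x: "x = xs @ h # l # zs" "xs @ zs \<in> W"
      by auto
    then show "x \<in> f ` (W \<times> {..card A})"
      using len[OF x(2)] by (intro image_eqI[of _ _ "(xs @ zs, length xs)"]) (auto simp: f_def)
  qed
  ultimately show ?thesis
    using card_image[of f "W \<times> {..card A}"] by (simp add: card_cartesian_product mult.commute)
qed

lemma filter_insert_outer:
  fixes c c' :: "'n::{finite,wellorder}"
  assumes "c < c'"
  shows "filter (\<lambda>x. c' \<le> x \<and> x \<le> opp c') (xs @ opp c # c # zs) =
    filter (\<lambda>x. c' \<le> x \<and> x \<le> opp c') (xs @ zs)"
proof -
  have "opp c' < opp c" using assms by simp
  then show ?thesis using assms by auto
qed

text \<open>For the outermost letter \<open>c\<close> of \<open>middle k\<close> the filter in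
  \<open>adjacent_at\<close> removes nothing, so \<open>opp c, c\<close> are neighbours in the word
  itself. The conditions for the inner letters do not see this pair.\<close>

lemma special_words_step:
  fixes c :: "'n::{finite,wellorder}"
  assumes c: "pos c = Suc k" "c < opp c"
  shows "special_words k = {xs @ opp c # c # zs | xs zs. xs @ zs \<in> special_words (Suc k)}"
proof (intro equalityI subsetI)
  note middle = middle_eq_interval[OF c(1)]
  fix ys :: "'n list" assume "ys \<in> special_words k"
  then have ys: "distinct ys" "set ys = {c..opp c}"
    "\<And>c'. c \<le> c' \<Longrightarrow> c' \<le> opp c \<Longrightarrow> c' < opp c' \<Longrightarrow> adjacent_at ys c'"
    by (auto simp: special_words_def middle)
  have "filter (\<lambda>x. c \<le> x \<and> x \<le> opp c) ys = ys"
    using ys(2) by (intro filter_True) auto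
  with ys(3)[of c] c(2) less_imp_le[OF c(2)] obtain xs zs where eq: "ys = xs @ opp c # c # zs"
    by (auto simp: adjacent_at_def)
  have "set (xs @ zs) = {c..opp c} - {c, opp c}"
    using ys(1,2) unfolding eq by auto
  also have "\<dots> = {c<..<opp c}" by auto
  finally have "set (xs @ zs) = {c<..<opp c}" .
  moreover have "adjacent_at (xs @ zs) c'" if "c < c'" "c' < opp c" "c' < opp c'" for c'
    using ys(3)[OF less_imp_le less_imp_le, OF that]
    unfolding adjacent_at_def eq filter_insert_outer[OF that(1)] .
  ultimately have "xs @ zs \<in> special_words (Suc k)"
    using ys(1) by (auto simp: special_words_def middle eq)
  then show "ys \<in> {xs @ opp c # c # zs | xs zs. xs @ zs \<in> special_words (Suc k)}"
    using eq by blast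
next
  note middle = middle_eq_interval[OF c(1)]
  fix ys :: "'n list" assume "ys \<in> {xs @ opp c # c # zs | xs zs. xs @ zs \<in> special_words (Suc k)}"
  then obtain xs zs where eq: "ys = xs @ opp c # c # zs"
    and *: "distinct (xs @ zs)" "set (xs @ zs) = {c<..<opp c}"
      "\<And>c'. c < c' \<Longrightarrow> c' < opp c \<Longrightarrow> c' < opp c' \<Longrightarrow> adjacent_at (xs @ zs) c'"
    by (auto simp: special_words_def middle)
  have "c \<notin> set (xs @ zs)" "opp c \<notin> set (xs @ zs)"
    unfolding *(2) by auto
  then have "distinct ys"
    using *(1) c(2) unfolding eq by auto
  moreover have set: "set ys = {c..opp c}"
  proof -
    have "set ys = insert c (insert (opp c) (set (xs @ zs)))"
      unfolding eq by (simp add: insert_commute)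
    also have "\<dots> = {c..opp c}"
      unfolding *(2)
    proof (rule set_eqI)
      fix x
      show "x \<in> insert c (insert (opp c) {c<..<opp c}) \<longleftrightarrow> x \<in> {c..opp c}"
        using c(2) by (cases "x = c"; cases "x = opp c") (simp_all add: less_le)
    qed
    finally show ?thesis .
  qed
  moreover have "adjacent_at ys c'" if "c \<le> c'" "c' \<le> opp c" "c' < opp c'" for c'
  proof (cases "c' = c")
    case True
    have "filter (\<lambda>x. c \<le> x \<and> x \<le> opp c) ys = ys"
      using set by (intro filter_True) auto
    then show ?thesis
      unfolding adjacent_at_def True eq by blast
  next
    case False
    then have "c < c'" using that by simp
    moreover have "c' < opp c"
      using that(3) \<open>c < c'\<close> by (metis less_trans opp_less_iff)
    ultimately show ?thesis
      using *(3)[of c'] that(3) unfolding adjacent_at_def eq filter_insert_outer[OF \<open>c < c'\<close>] by simp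
  qed
  ultimately show "ys \<in> special_words k"
    by (auto simp: special_words_def middle)
qed

lemma card_special_words_base:
  "card (special_words (CARD('n) div 2) :: 'n::{finite,wellorder} list set) = 1"
proof -
  define A where "A = (middle (CARD('n) div 2) :: 'n set)"
  have card_A: "card A \<le> 1"
    by (auto simp: A_def card_middle)
  have "opp c \<in> A" if "c \<in> A" for c
    using that pos_le_card[of c] by (auto simp: A_def middle_def pos_opp)
  then have "\<not> c < opp c" if "c \<in> A" for c
    using that card_A by (metis One_nat_def card_le_Suc0_iff_eq finite less_irrefl)
  then have eq: "special_words (CARD('n) div 2) = {ys. distinct ys \<and> set ys = A}"
    by (auto simp: special_words_def A_def)
  consider "A = {}" | x where "A = {x}"
    using card_A by (metis One_nat_def card_0_eq card_1_singletonE finite le_Suc_eq le_zero_eq)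
  then show ?thesis
  proof cases
    case 1
    then have "{ys. distinct ys \<and> set ys = A} = {[]}" by auto
    then show ?thesis unfolding eq by simp
  next
    case 2
    have "ys = [x]" if "distinct ys" "set ys = {x}" for ys
      using that distinct_card[of ys] by (cases ys) (auto simp: subset_singleton_iff)
    then have "{ys. distinct ys \<and> set ys = A} = {[x]}"
      unfolding 2 by auto
    then show ?thesis unfolding eq by simp
  qed
qed

text \<open>Downward induction, from the innermost pair outwards: the words in
  \<open>special_words (Suc k)\<close> have length \<open>n - 2 * Suc k\<close>, hence one more gap
  than that.\<close>

lemma card_special_words:
  assumes "k \<le> CARD('n) div 2"
  shows "card (special_words k :: 'n::{finite,wellorder} list set) =
    (\<Prod>j = Suc k..CARD('n) div 2. CARD('n) - 2 * j + 1)"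
  using assms
proof (induction rule: inc_induct)
  case base
  then show ?case by (simp add: card_special_words_base)
next
  case (step k)
  have "Suc k \<in> pos ` (UNIV :: 'n set)"
    unfolding bij_betw_imp_surj_on[OF bij_betw_pos] using step.hyps by auto
  then obtain c :: 'n where c: "pos c = Suc k"
    by auto
  have "c < opp c"
    unfolding pos_less_iff[symmetric] pos_opp c using step.hyps by auto
  have "card (special_words k :: 'n list set) =
      (card (middle (Suc k) :: 'n set) + 1) * card (special_words (Suc k) :: 'n list set)"
    unfolding special_words_step[OF c \<open>c < opp c\<close>]
    using \<open>c < opp c\<close>
    by (intro card_insert_pair) (auto simp: special_words_def middle_eq_interval[OF c])
  also have "\<dots> = (\<Prod>j = Suc k..CARD('n) div 2. CARD('n) - 2 * j + 1)"
    unfolding step.IH card_middle using step.hyps by (simp add: prod.atLeast_Suc_atMost[of "Suc k"])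
  finally show ?case .
qed

text \<open>The list \<open>ys\<close> orders the letters by their places, so letters standing
  between \<open>opp c\<close> and \<open>c\<close> after filtering are those whose
  \<open>w\<close>-value lies strictly between \<open>w (opp c)\<close> and
  \<open>w c\<close>.\<close>

lemma adjacent_at_iff_special_at:
  fixes c :: "'n::{finite,wellorder}"
  assumes sorted: "sorted_wrt (\<lambda>a b. w a < w b) ys" and set: "set ys = UNIV" and c: "c < opp c"
  shows "adjacent_at ys c \<longleftrightarrow> special_at w c"
proof -
  define F where "F = filter (\<lambda>x. c \<le> x \<and> x \<le> opp c) ys"
  have F_sorted: "sorted_wrt (\<lambda>a b. w a < w b) F"
    unfolding F_def using sorted by (rule sorted_wrt_filter)
  have F_set: "set F = {c..opp c}"
    unfolding F_def using set by auto
  show ?thesis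
  proof
    assume "adjacent_at ys c"
    then obtain xs zs where F: "F = xs @ opp c # c # zs"
      by (auto simp: adjacent_at_def F_def)
    have *: "w (opp c) < w c" "\<And>x. x \<in> set xs \<Longrightarrow> w x < w (opp c)" "\<And>x. x \<in> set zs \<Longrightarrow> w c < w x"
      using F_sorted unfolding F by (auto simp: sorted_wrt_append)
    have "\<not> (w (opp c) < w x \<and> w x < w c)" if "c < x" "x < opp c" for x
    proof -
      have "x \<in> set F" using that F_set by auto
      then show ?thesis
        using that *(2)[of x] *(3)[of x] unfolding F by auto
    qed
    then show "special_at w c"
      using *(1) by (auto simp: special_at_def)
  next
    assume sp: "special_at w c"
    have "opp c \<in> set F" "c \<in> set F"
      using F_set c by auto
    then obtain xs rest where F: "F = xs @ opp c # rest"
      by (meson split_list)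
    have *: "\<And>x. x \<in> set xs \<Longrightarrow> w x < w (opp c)" "\<And>x. x \<in> set rest \<Longrightarrow> w (opp c) < w x"
      "sorted_wrt (\<lambda>a b. w a < w b) rest"
      using F_sorted unfolding F by (auto simp: sorted_wrt_append)
    have "c \<notin> set xs"
      using *(1)[of c] sp by (auto simp: special_at_def)
    then have c_rest: "c \<in> set rest"
      using \<open>c \<in> set F\<close> c unfolding F by auto
    then obtain u zs where rest: "rest = u # zs"
      by (cases rest) auto
    have "u = c"
    proof (rule ccontr)
      assume "u \<noteq> c"
      then have "w u < w c"
        using c_rest *(3) unfolding rest by auto
      moreover have "w (opp c) < w u"
        using *(2) unfolding rest by auto
      moreover have "u \<in> set F"
        unfolding F rest by simp
      then have "c < u" "u < opp c"
        using F_set \<open>u \<noteq> c\<close> \<open>w (opp c) < w u\<close> by (auto simp: order_less_le)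
      ultimately show False
        using sp by (auto simp: special_at_def)
    qed
    then show "adjacent_at ys c"
      using F unfolding rest adjacent_at_def F_def by blast
  qed
qed

lemma card_special:
  "card {w. w permutes (UNIV :: 'n::{finite,wellorder} set) \<and> special w} =
     (\<Prod>k = 1..CARD('n) div 2. CARD('n) - 2 * k + 1)"
proof -
  define L where "L = sorted_list_of_set (UNIV :: 'n set)"
  \<comment> \<open>The word of the inverse permutation: its letter at place \<open>x\<close> is
    \<open>inv w x\<close>, so that \<open>w\<close> assigns to each letter its place.\<close>
  define g :: "('n \<Rightarrow> 'n) \<Rightarrow> 'n list" where "g = (\<lambda>w. map (inv w) L)"
  have L: "set L = UNIV" "sorted_wrt (<) L" "distinct L"
    by (simp_all add: L_def)
  have middle0: "middle 0 = (UNIV :: 'n set)"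
    using pos_le_card pos_gt_0 by (auto simp: middle_def)
  have g_mem: "g w \<in> special_words 0 \<longleftrightarrow> special w" if w: "w permutes UNIV" for w :: "'n \<Rightarrow> 'n"
  proof -
    have inj: "inj (inv w)" and surj: "surj (inv w)"
      using permutes_inv[OF w] by (auto simp: permutes_inj permutes_surj)
    have "sorted_wrt (\<lambda>a b. w a < w b) (g w)"
      using L(2) by (simp add: g_def sorted_wrt_map permutes_inverses(1)[OF w])
    moreover have "set (g w) = UNIV"
      using surj by (simp add: g_def L)
    moreover have "distinct (g w)"
      using inj L(3) by (simp add: g_def distinct_map inj_on_def)
    ultimately show ?thesis
      using adjacent_at_iff_special_at[of w "g w"]
      by (auto simp: special_words_def middle0 special_def)
  qed
  have "bij_betw g {w. w permutes UNIV \<and> special w} (special_words 0)"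
    unfolding bij_betw_def
  proof
    show "inj_on g {w. w permutes UNIV \<and> special w}"
    proof (rule inj_onI, clarify)
      fix w w' :: "'n \<Rightarrow> 'n" assume w: "w permutes UNIV" "w' permutes UNIV" and "g w = g w'"
      then have "inv w x = inv w' x" for x
        using L(1) by (simp add: g_def)
      then have "inv w = inv w'" by auto
      then show "w = w'"
        by (metis permutes_inv_inv w)
    qed
    show "g ` {w. w permutes UNIV \<and> special w} = special_words 0"
    proof (intro equalityI subsetI)
      fix ys assume "ys \<in> g ` {w. w permutes UNIV \<and> special w}"
      then show "ys \<in> special_words 0"
        using g_mem by auto
    next
      fix ys :: "'n list" assume ys: "ys \<in> special_words 0"
      then have set_ys: "distinct ys" "set ys = UNIV"
        by (auto simp: special_words_def middle0)
      have len: "length L = length ys"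
        using distinct_card[OF set_ys(1)] distinct_card[OF L(3)] set_ys L by simp
      \<comment> \<open>The permutation that sends each place to the letter of \<open>ys\<close>
        standing there; its inverse is the preimage of \<open>ys\<close> under
        \<open>g\<close>.\<close>
      define u where "u = (\<lambda>x. the (map_of (zip L ys) x))"
      have map_u: "map u L = ys"
        unfolding u_def using len L(3) by (intro nth_equalityI) (auto simp: map_of_zip_nth)
      have "surj u"
        using map_u set_ys(2) L(1) by (metis list.set_map)
      then have u: "u permutes UNIV"
        using finite_UNIV_surj_inj[of u] by (intro bij_imp_permutes) (auto simp: bij_def \<open>surj u\<close>)
      have "g (inv u) = ys"
        using map_u by (simp add: g_def permutes_inv_inv[OF u])
      then show "ys \<in> g ` {w. w permutes UNIV \<and> special w}"
        using g_mem[OF permutes_inv[OF u]] permutes_inv[OF u] ys by blast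
    qed
  qed
  then show ?thesis
    using bij_betw_same_card card_special_words[of 0, where 'n = 'n] by fastforce
qed

section \<open>Frames of flags and Schubert cells\<close>

definition coord_space :: "'n::{finite,wellorder} \<Rightarrow> (complex^('n::_)) set" where
  "coord_space k = {x. \<forall>i. k < i \<longrightarrow> x $ i = 0}"

definition upper :: "complex^('n::{finite,wellorder})^('n::_) \<Rightarrow> bool" where
  "upper c \<longleftrightarrow> (\<forall>i j. j < i \<longrightarrow> c $ i $ j = 0)"

definition frame_flag :: "complex^('n::{finite,wellorder})^('n::_) \<Rightarrow> 'n flag" where
  "frame_flag g = flag_act g (coord_flag id)"

definition perm_mat :: "('n \<Rightarrow> 'n) \<Rightarrow> complex^('n::{finite,wellorder})^('n::_)" where
  "perm_mat w = (\<chi> i j. if i = w j then 1 else 0)"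

lemma span_axis: "vec.span ((\<lambda>i. axis i (1::complex)) ` A) = {x. \<forall>i. i \<notin> A \<longrightarrow> x $ i = 0}"
proof (rule vec.span_unique)
  show "(\<lambda>i. axis i 1) ` A \<subseteq> {x. \<forall>i. i \<notin> A \<longrightarrow> x $ i = 0}"
    by (auto simp: axis_def)
  show "vec.subspace {x. \<forall>i. i \<notin> A \<longrightarrow> x $ i = 0}"
    by (simp add: vec.subspace_def)
  fix T :: "(complex^('a::_)) set" assume T: "(\<lambda>i. axis i 1) ` A \<subseteq> T" "vec.subspace T"
  show "{x. \<forall>i. i \<notin> A \<longrightarrow> x $ i = 0} \<subseteq> T"
  proof
    fix x :: "complex^('a::_)" assume x: "x \<in> {x. \<forall>i. i \<notin> A \<longrightarrow> x $ i = 0}"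
    have "(x $ i) *s axis i 1 \<in> T" for i
      using x T by (cases "i \<in> A") (auto intro: vec.subspace_scale vec.subspace_0)
    then have "(\<Sum>i\<in>UNIV. (x $ i) *s axis i 1) \<in> T"
      using T(2) by (intro vec.subspace_sum) auto
    then show "x \<in> T"
      by (simp only: basis_expansion)
  qed
qed

lemma coord_flag_eq: "coord_flag w k = {x. \<forall>i. i \<notin> w ` {..k} \<longrightarrow> x $ i = 0}"
proof -
  have "{axis (w j) 1 |j. j \<le> k} = (\<lambda>i. axis i (1::complex)) ` w ` {..k}"
    by auto
  then show ?thesis
    unfolding coord_flag_def by (simp only: span_axis)
qed

lemma coord_flag_id: "coord_flag id k = coord_space k"
  by (auto simp: coord_flag_eq coord_space_def not_le)

lemma frame_flag_eq: "frame_flag g k = (*v) g ` coord_space k"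
  by (simp add: frame_flag_def flag_act_def coord_flag_id)

lemma frame_flag_mult: "frame_flag (g ** h) = flag_act g (frame_flag h)"
  by (auto simp: frame_flag_def flag_act_def image_image matrix_vector_mul_assoc fun_eq_iff)

lemma subspace_coord_space: "vec.subspace (coord_space k)"
  by (simp add: coord_space_def vec.subspace_def)

lemma dim_coord_space: "vec.dim (coord_space k) = card {..k}"
proof -
  have "coord_space k = {x. \<forall>i. i \<notin> {..k} \<longrightarrow> x $ i = 0}"
    by (auto simp: coord_space_def)
  then show ?thesis
    by (simp only: dim_substandard_cart)
qed

lemma coord_space_mono: "i \<le> j \<Longrightarrow> coord_space i \<subseteq> coord_space j"
  by (auto simp: coord_space_def)

lemma axis_in_coord_space: "axis j c \<in> coord_space k \<longleftrightarrow> c = 0 \<or> j \<le> k"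
  by (auto simp: coord_space_def axis_def)

lemma invertible_inj: "invertible (g :: complex^'n^'n) \<Longrightarrow> inj_on ((*v) g) A"
  using matrix_left_invertible_injective[of g] invertible_left_inverse[of g]
  by (auto intro: inj_on_subset)

lemma invertibleE:
  fixes g :: "complex^'n^'n"
  assumes "invertible g"
  obtains h where "g ** h = mat 1" "h ** g = mat 1" "invertible h"
  using assms unfolding invertible_def by metis

lemma dim_image_invertible:
  fixes g :: "complex^'n^'n"
  assumes "invertible g"
  shows "vec.dim ((*v) g ` S) = vec.dim S"
  using invertible_inj[OF assms] by (intro vec.dim_image_eq) auto

lemma matrix_mult_component: "(A ** B) $ i $ j = (\<Sum>k\<in>UNIV. A $ i $ k * B $ k $ j)"
  by (simp add: matrix_matrix_mult_def)

lemma upper_mult: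
  fixes a b :: "complex^('n::{finite,wellorder})^('n::_)"
  assumes "upper a" "upper b"
  shows "upper (a ** b)"
  unfolding upper_def matrix_mult_component
proof (intro allI impI sum.neutral ballI)
  fix i j k :: 'n assume "j < i"
  then have "k < i \<or> j < k" by (cases "j < k") (auto intro: le_less_trans simp: not_less)
  then show "a $ i $ k * b $ k $ j = 0"
    using assms by (auto simp: upper_def)
qed

lemma upper_mat: "upper (mat c)"
  by (auto simp: upper_def mat_def)

lemma upper_image_subset:
  fixes c :: "complex^('n::{finite,wellorder})^('n::_)"
  assumes "upper c"
  shows "(*v) c ` coord_space k \<subseteq> coord_space k"
proof clarify
  fix x :: "complex^('n::_)" assume x: "x \<in> coord_space k"
  show "c *v x \<in> coord_space k"
    unfolding coord_space_def matrix_vector_mult_def mem_Collect_eq vec_lambda_beta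
  proof (intro allI impI sum.neutral ballI)
    fix i j :: 'n assume "k < i"
    then have "j < i \<or> k < j" by (cases "k < j") (auto intro: le_less_trans simp: not_less)
    then show "c $ i $ j * x $ j = 0"
      using assms x by (auto simp: upper_def coord_space_def)
  qed
qed

lemma upper_image:
  fixes c :: "complex^('n::{finite,wellorder})^('n::_)"
  assumes "upper c" "invertible c"
  shows "(*v) c ` coord_space k = coord_space k"
proof (rule vec.subspace_dim_equal)
  show "vec.subspace ((*v) c ` coord_space k)"
    by (intro vec.linear_subspace_image subspace_coord_space) simp
qed (use assms in \<open>simp_all add: subspace_coord_space upper_image_subset dim_image_invertible\<close>)

lemma upperI:
  fixes c :: "complex^('n::{finite,wellorder})^('n::_)"
  assumes "\<And>k. (*v) c ` coord_space k \<subseteq> coord_space k"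
  shows "upper c"
  unfolding upper_def
proof (intro allI impI)
  fix i j :: 'n assume "j < i"
  have "c *v axis j 1 \<in> coord_space j"
    using assms[of j] by (auto simp: axis_in_coord_space)
  then show "c $ i $ j = 0"
    using \<open>j < i\<close>
    by (simp add: coord_space_def matrix_vector_mult_def axis_def if_distrib cong: if_cong)
qed

lemma upper_inverse:
  fixes c d :: "complex^('n::{finite,wellorder})^('n::_)"
  assumes "upper c" "invertible c" "d ** c = mat 1"
  shows "upper d"
proof (rule upperI)
  fix k :: 'n
  have "(*v) d ` coord_space k = (*v) d ` (*v) c ` coord_space k"
    by (simp only: upper_image[OF assms(1,2)])
  also have "\<dots> = coord_space k"
    by (simp add: image_image matrix_vector_mul_assoc assms(3))
  finally show "(*v) d ` coord_space k \<subseteq> coord_space k" by simp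
qed

text \<open>If two frames span the same flag, the inverse of one times the other maps every
  \<open>coord_space k\<close> to itself, which forces it to be upper triangular.\<close>

lemma frame_flag_eq_iff:
  fixes g h :: "complex^('n::{finite,wellorder})^('n::_)"
  assumes "invertible g" "invertible h"
  shows "frame_flag g = frame_flag h \<longleftrightarrow> (\<exists>c. upper c \<and> invertible c \<and> h = g ** c)"
proof
  assume eq: "frame_flag g = frame_flag h"
  obtain g' where g': "g ** g' = mat 1" "g' ** g = mat 1" "invertible g'"
    using invertibleE[OF assms(1)] .
  have "upper (g' ** h)"
  proof (rule upperI)
    fix k :: 'n
    have "(*v) (g' ** h) ` coord_space k = (*v) g' ` frame_flag h k"
      by (simp add: frame_flag_eq image_image matrix_vector_mul_assoc)
    also have "\<dots> = coord_space k"
      unfolding eq[symmetric] by (simp add: frame_flag_eq image_image matrix_vector_mul_assoc g')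
    finally show "(*v) (g' ** h) ` coord_space k \<subseteq> coord_space k" by simp
  qed
  moreover have "invertible (g' ** h)" "h = g ** (g' ** h)"
    using g' assms by (auto simp: invertible_mult matrix_mul_assoc)
  ultimately show "\<exists>c. upper c \<and> invertible c \<and> h = g ** c"
    by blast
next
  assume "\<exists>c. upper c \<and> invertible c \<and> h = g ** c"
  then obtain c where c: "upper c" "invertible c" "h = g ** c" by blast
  have "frame_flag h k = frame_flag g k" for k
    unfolding c(3) frame_flag_mult using upper_image[OF c(1,2)]
    by (simp add: flag_act_def frame_flag_eq)
  then show "frame_flag g = frame_flag h" by auto
qed

lemma frame_flag_in_flags:
  fixes g :: "complex^('n::{finite,wellorder})^('n::_)"
  assumes "invertible g"
  shows "frame_flag g \<in> flags"
  unfolding flags_def frame_flag_eq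
  using assms coord_space_mono
  by (auto simp: dim_image_invertible dim_coord_space intro!: vec.linear_subspace_image subspace_coord_space)

text \<open>The preceding member of the flag; \<open>insert 0\<close> supplies the zero space below
  the first member, where the union is empty.\<close>

definition flag_below :: "('n::{finite,wellorder}) flag \<Rightarrow> 'n \<Rightarrow> (complex^('n::_)) set" where
  "flag_below F k = insert 0 (\<Union>j\<in>{..<k}. F j)"

lemma flag_below:
  fixes F :: "('n::{finite,wellorder}) flag"
  assumes "F \<in> flags"
  shows "vec.subspace (flag_below F k)" "flag_below F k \<subseteq> F k"
    "vec.dim (flag_below F k) < vec.dim (F k)"
proof -
  have F: "vec.subspace (F i)" "vec.dim (F i) = card {..i}" "i \<le> j \<Longrightarrow> F i \<subseteq> F j" for i j
    using assms by (auto simp: flags_def)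
  show "flag_below F k \<subseteq> F k"
    using F(3)[OF less_imp_le] vec.subspace_0[OF F(1)] unfolding flag_below_def by blast
  have "vec.subspace (flag_below F k) \<and> vec.dim (flag_below F k) < vec.dim (F k)"
  proof (cases "{..<k} = {}")
    case True
    then have "flag_below F k = {0}"
      unfolding flag_below_def True by simp
    then show ?thesis
      using F(2)[of k] by (auto simp: card_gt_0_iff)
  next
    case False
    define l where "l = Max {..<k}"
    have l: "l < k" "\<And>j. j < k \<Longrightarrow> j \<le> l"
      using Max_in[of "{..<k}"] False by (auto simp: l_def)
    have "flag_below F k = F l"
      using l F(3)[of _ l] vec.subspace_0[OF F(1)[of l]] by (fastforce simp: flag_below_def)
    moreover have "card {..l} < card {..k}"
      using l by (intro psubset_card_mono) auto
    ultimately show ?thesis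
      using F(1,2) by simp
  qed
  then show "vec.subspace (flag_below F k)" "vec.dim (flag_below F k) < vec.dim (F k)"
    by auto
qed

text \<open>In a linear relation between the chosen vectors, the one with the largest index would
  lie in the member below it. So the frame is invertible, and its initial columns span the flag by
  dimension.\<close>

lemma frame_of_flag:
  fixes F :: "('n::{finite,wellorder}) flag"
  assumes "F \<in> flags" "\<And>i. u i \<in> F i" "\<And>i. u i \<notin> flag_below F i"
  defines "U \<equiv> (\<chi> a i. u i $ a)"
  shows "invertible U" "frame_flag U = F"
proof -
  have F: "vec.subspace (F i)" "vec.dim (F i) = card {..i}" "i \<le> j \<Longrightarrow> F i \<subseteq> F j" for i j
    using assms(1) by (auto simp: flags_def)
  have col: "column i U = u i" for i
    by (simp add: column_def U_def vec_eq_iff)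
  have U_mult: "U *v x = (\<Sum>i\<in>UNIV. x $ i *s u i)" for x
    by (simp add: matrix_mult_sum col)
  have ker: "x = 0" if "U *v x = 0" for x
  proof (rule ccontr)
    assume "x \<noteq> 0"
    define k where "k = Max {i. x $ i \<noteq> 0}"
    have "{i. x $ i \<noteq> 0} \<noteq> {}"
      using \<open>x \<noteq> 0\<close> by (auto simp: vec_eq_iff)
    then have k: "x $ k \<noteq> 0" "\<And>i. x $ i \<noteq> 0 \<Longrightarrow> i \<le> k"
      using Max_in[of "{i. x $ i \<noteq> 0}"] by (auto simp: k_def)
    have "0 = (\<Sum>i\<in>UNIV. x $ i *s u i)"
      using that U_mult by simp
    also have "\<dots> = x $ k *s u k + (\<Sum>i\<in>UNIV - {k}. x $ i *s u i)"
      by (rule sum.remove) auto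
    finally have "x $ k *s u k = - (\<Sum>i\<in>UNIV - {k}. x $ i *s u i)"
      by (simp add: add_eq_0_iff)
    moreover have "(\<Sum>i\<in>UNIV - {k}. x $ i *s u i) \<in> flag_below F k"
    proof (intro vec.subspace_sum flag_below(1)[OF assms(1)])
      fix i assume i: "i \<in> UNIV - {k}"
      show "x $ i *s u i \<in> flag_below F k"
      proof (cases "x $ i = 0")
        case False
        then have "i < k" using k(2)[of i] i by auto
        then have "u i \<in> flag_below F k"
          using assms(2) by (auto simp: flag_below_def)
        then show ?thesis
          by (intro vec.subspace_scale flag_below(1)[OF assms(1)])
      qed (simp add: flag_below_def)
    qed
    ultimately have "x $ k *s u k \<in> flag_below F k"
      using vec.subspace_neg[OF flag_below(1)[OF assms(1)]] by simp
    then have "(1 / x $ k) *s (x $ k *s u k) \<in> flag_below F k"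
      by (rule vec.subspace_scale[OF flag_below(1)[OF assms(1)]])
    moreover have "(1 / x $ k) *s (x $ k *s u k) = u k"
      using k(1) by (simp add: vec_eq_iff)
    ultimately show False
      using assms(3) by metis
  qed
  then show inv: "invertible U"
    using ker by (simp add: invertible_left_inverse matrix_left_invertible_ker)
  have "frame_flag U k = F k" for k
    unfolding frame_flag_eq
  proof (rule vec.subspace_dim_equal)
    show "vec.subspace ((*v) U ` coord_space k)"
      by (intro vec.linear_subspace_image subspace_coord_space) simp
    show "vec.subspace (F k)" by (rule F)
    show "(*v) U ` coord_space k \<subseteq> F k"
    proof clarify
      fix x :: "complex^('n::_)" assume x: "x \<in> coord_space k"
      show "U *v x \<in> F k"
        unfolding U_mult
      proof (intro vec.subspace_sum F)
        fix i
        show "x $ i *s u i \<in> F k"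
        proof (cases "i \<le> k")
          case True
          then show ?thesis
            using F(3)[of i k] assms(2)[of i] by (intro vec.subspace_scale F) auto
        next
          case False
          then have "x $ i = 0" using x by (auto simp: coord_space_def)
          then show ?thesis using vec.subspace_0[OF F(1)] by simp
        qed
      qed
    qed
    show "vec.dim (F k) \<le> vec.dim ((*v) U ` coord_space k)"
      by (simp add: dim_image_invertible[OF inv] dim_coord_space F)
  qed
  then show "frame_flag U = F" by auto
qed

section \<open>Permutation matrices and the Bruhat decomposition of a flag\<close>

lemma perm_mat_mult_component: "(A ** perm_mat w) $ i $ j = A $ i $ w j"
  by (simp add: matrix_mult_component perm_mat_def if_distrib cong: if_cong)

lemma perm_mat_mult_perm_mat: "perm_mat v ** perm_mat w = perm_mat (v \<circ> w)"
  by (simp add: vec_eq_iff perm_mat_mult_component) (simp add: perm_mat_def)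

lemma perm_mat_id: "perm_mat id = mat 1"
  by (simp add: perm_mat_def mat_def vec_eq_iff)

lemma perm_mat_inverse:
  assumes "w permutes UNIV"
  shows "perm_mat (inv w) ** perm_mat w = mat 1" "perm_mat w ** perm_mat (inv w) = mat 1"
  using permutes_inv_o[OF assms] by (simp_all add: perm_mat_mult_perm_mat perm_mat_id)

lemma invertible_perm_mat: "w permutes UNIV \<Longrightarrow> invertible (perm_mat w)"
  using perm_mat_inverse unfolding invertible_def by blast

lemma perm_mat_mult_vec_component:
  fixes w :: "'n::{finite,wellorder} \<Rightarrow> 'n"
  assumes "w permutes UNIV"
  shows "(perm_mat w *v x) $ i = x $ inv w i"
proof -
  have "i = w j \<longleftrightarrow> j = inv w i" for j
    using permutes_inv_eq[OF assms] by metis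
  then have "(perm_mat w *v x) $ i = (\<Sum>j\<in>UNIV. if j = inv w i then x $ j else 0)"
    unfolding matrix_vector_mult_def perm_mat_def vec_lambda_beta by (intro sum.cong) auto
  then show ?thesis by simp
qed

lemma perm_mat_conjugate:
  fixes w :: "'n::{finite,wellorder} \<Rightarrow> 'n"
  assumes w: "w permutes UNIV"
  shows "(perm_mat (inv w) ** A ** perm_mat w) $ i $ j = A $ w i $ w j"
proof -
  have "i = inv w k \<longleftrightarrow> k = w i" for k
    using permutes_inv_eq[OF w] by metis
  then have "(perm_mat (inv w) ** A) $ i $ j = (\<Sum>k\<in>UNIV. if k = w i then A $ k $ j else 0)" for j
    unfolding matrix_mult_component perm_mat_def vec_lambda_beta by (intro sum.cong) auto
  then show ?thesis
    by (simp add: perm_mat_mult_component)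
qed

lemma frame_flag_perm_mat:
  fixes w :: "'n::{finite,wellorder} \<Rightarrow> 'n"
  assumes "w permutes UNIV"
  shows "frame_flag (perm_mat w) = coord_flag w"
proof
  fix k
  show "frame_flag (perm_mat w) k = coord_flag w k"
    unfolding frame_flag_eq
  proof (intro equalityI subsetI)
    fix y assume "y \<in> (*v) (perm_mat w) ` coord_space k"
    then obtain x where x: "\<And>i. k < i \<Longrightarrow> x $ i = 0" "y = perm_mat w *v x"
      by (auto simp: coord_space_def)
    have "y $ i = 0" if "i \<notin> w ` {..k}" for i
    proof -
      have "\<not> inv w i \<le> k"
        using that permutes_inverses(1)[OF assms, of i] by (metis atMost_iff image_eqI)
      then show ?thesis
        using x by (simp add: perm_mat_mult_vec_component[OF assms])
    qed
    then show "y \<in> coord_flag w k"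
      by (simp add: coord_flag_eq)
  next
    fix y assume y: "y \<in> coord_flag w k"
    define x where "x = perm_mat (inv w) *v y"
    have x: "x $ i = y $ w i" for i
      unfolding x_def
      by (simp add: perm_mat_mult_vec_component[OF permutes_inv[OF assms]] permutes_inv_inv[OF assms])
    have "x \<in> coord_space k"
      using y permutes_inj[OF assms] by (auto simp: coord_space_def coord_flag_eq x inj_image_mem_iff)
    moreover have "y = perm_mat w *v x"
      unfolding x_def by (simp add: matrix_vector_mul_assoc perm_mat_inverse[OF assms])
    ultimately show "y \<in> (*v) (perm_mat w) ` coord_space k"
      by blast
  qed
qed

lemma scale_to_det_1:
  fixes g :: "complex^('n::{finite,wellorder})^('n::_)"
  assumes "invertible g"
  obtains c where "c \<noteq> 0" "det (mat c ** g) = 1"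
proof -
  define z where "z = det g"
  have z: "z \<noteq> 0"
    using assms by (simp add: z_def invertible_det_nz)
  define c where "c = exp (- Ln z / of_nat CARD('n))"
  have "c ^ CARD('n) = inverse z"
  proof -
    have "c ^ CARD('n) = exp (of_nat CARD('n) * (- Ln z / of_nat CARD('n)))"
      by (simp only: c_def exp_of_nat_mult)
    also have "\<dots> = exp (- Ln z)" by simp
    also have "\<dots> = inverse z"
      using z by (simp add: exp_minus)
    finally show ?thesis .
  qed
  then have "det (mat c ** g) = 1"
    using z by (simp add: det_mul det_diagonal mat_def z_def)
  moreover have "c \<noteq> 0"
    by (simp add: c_def)
  ultimately show ?thesis
    using that by blast
qed

lemma mat_mult_component: "(mat c ** A) $ i $ j = c * (A $ i $ j)"
  by (simp add: matrix_mult_component mat_def if_distrib if_distribR cong: if_cong)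

lemma mult_mat_component: "(A ** mat c) $ i $ j = A $ i $ j * c"
  by (simp add: matrix_mult_component mat_def if_distrib if_distribR cong: if_cong)

lemma mat_mult_commute: "mat (c::complex) ** A = A ** mat c"
  by (simp add: vec_eq_iff mat_mult_component mult_mat_component mult.commute)

lemma invertible_mat: "c \<noteq> 0 \<Longrightarrow> invertible (mat c :: complex^'n^'n)"
  by (simp add: invertible_det_nz det_diagonal mat_def)

lemma frame_flag_scale:
  assumes "invertible g" "c \<noteq> 0"
  shows "frame_flag (mat c ** g) = frame_flag g"
proof -
  have "invertible (mat c ** g)"
    using assms by (intro invertible_mult invertible_mat)
  then show ?thesis
    using assms frame_flag_eq_iff[of g "mat c ** g"] mat_mult_commute[of c g]
      upper_mat invertible_mat by metis
qed

lemma SL_complex_iff: "g \<in> SL_complex \<Longrightarrow> invertible (g :: complex^'n^'n)"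
  by (simp add: SL_complex_def invertible_det_nz)

text \<open>Choose in each \<open>F k\<close>, outside the preceding member, a vector whose last
  nonzero coordinate comes as early as possible. Two of these coordinates cannot agree, since
  subtracting a multiple of the earlier vector would improve the later one. They therefore form a
  permutation \<open>v\<close>, and undoing it makes the frame upper triangular.\<close>

lemma flag_has_frame:
  fixes F :: "('n::{finite,wellorder}) flag"
  assumes "F \<in> flags"
  obtains b v where "upper b" "invertible b" "v permutes UNIV" "F = frame_flag (b ** perm_mat v)"
proof -
  have F: "vec.subspace (F i)" "i \<le> j \<Longrightarrow> F i \<subseteq> F j" for i j
    using assms by (auto simp: flags_def)
  define top where "top = (\<lambda>x::complex^('n::_). Max {i. x $ i \<noteq> 0})"
  have top: "x $ top x \<noteq> 0" "\<And>i. top x < i \<Longrightarrow> x $ i = 0" if "x \<noteq> 0" for x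
  proof -
    have ne: "{i. x $ i \<noteq> 0} \<noteq> {}"
      using that by (auto simp: vec_eq_iff)
    show "x $ top x \<noteq> 0"
      using Max_in[OF _ ne] by (auto simp: top_def)
    show "x $ i = 0" if "top x < i" for i
      using that Max_ge[of "{i. x $ i \<noteq> 0}" i] by (auto simp: top_def not_le[symmetric])
  qed
  have "\<exists>u. u \<in> F k \<and> u \<notin> flag_below F k \<and> (\<forall>y. y \<in> F k \<and> y \<notin> flag_below F k \<longrightarrow> top u \<le> top y)" for k
  proof -
    have "\<exists>u. u \<in> F k \<and> u \<notin> flag_below F k"
    proof (rule ccontr)
      assume "\<nexists>u. u \<in> F k \<and> u \<notin> flag_below F k"
      then have "F k = flag_below F k"
        using flag_below(2)[OF assms] by blast
      then show False
        using flag_below(3)[OF assms, of k] by simp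
    qed
    then have ne: "top ` (F k - flag_below F k) \<noteq> {}" by auto
    define t where "t = Min (top ` (F k - flag_below F k))"
    have "t \<in> top ` (F k - flag_below F k)"
      unfolding t_def using ne by (intro Min_in) auto
    moreover have "t \<le> top y" if "y \<in> F k" "y \<notin> flag_below F k" for y
      unfolding t_def using that by (intro Min_le) auto
    ultimately show ?thesis by blast
  qed
  then obtain u where u: "\<And>k. u k \<in> F k" "\<And>k. u k \<notin> flag_below F k"
    "\<And>k y. y \<in> F k \<Longrightarrow> y \<notin> flag_below F k \<Longrightarrow> top (u k) \<le> top y"
    by metis
  define v where "v = (\<lambda>k. top (u k))"
  have u0: "u k \<noteq> 0" for k
    using u(2)[of k] by (auto simp: flag_below_def)
  have v_neq: "v j \<noteq> v k" if "j < k" for j k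
  proof
    assume eq: "v j = v k"
    define t where "t = v k"
    define c where "c = u k $ t / u j $ t"
    define y where "y = u k - c *s u j"
    have nz: "u j $ t \<noteq> 0"
      using top(1)[OF u0[of j]] eq by (simp add: t_def v_def)
    have "u j \<in> flag_below F k"
      using u(1)[of j] that by (auto simp: flag_below_def)
    then have cu: "c *s u j \<in> flag_below F k"
      by (intro vec.subspace_scale flag_below(1)[OF assms])
    have "y \<in> F k"
      unfolding y_def using cu flag_below(2)[OF assms, of k] u(1) by (intro vec.subspace_diff F) auto
    moreover have "y \<notin> flag_below F k"
    proof
      assume "y \<in> flag_below F k"
      then have "y + c *s u j \<in> flag_below F k"
        using cu by (intro vec.subspace_add flag_below(1)[OF assms])
      then show False
        using u(2) by (simp add: y_def)
    qed
    ultimately have "t \<le> top y"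
      using u(3) by (simp add: t_def v_def)
    moreover have y0: "y \<noteq> 0"
      using \<open>y \<notin> flag_below F k\<close> by (auto simp: flag_below_def)
    moreover have "y $ i = 0" if "t \<le> i" for i
    proof (cases "i = t")
      case True
      then show ?thesis using nz by (simp add: y_def c_def)
    next
      case False
      then have "t < i" using that by simp
      then have "u k $ i = 0" "u j $ i = 0"
        using top(2)[OF u0[of k], of i] top(2)[OF u0[of j], of i] eq by (auto simp: t_def v_def)
      then show ?thesis by (simp add: y_def)
    qed
    ultimately show False
      using top(1)[OF y0] by blast
  qed
  have "inj v"
    by (rule injI) (metis v_neq linorder_neqE)
  then have v: "v permutes UNIV"
    using finite_UNIV_inj_surj[of v] by (intro bij_imp_permutes) (auto simp: bij_def)
  define U :: "complex^('n::_)^('n::_)" where "U = (\<chi> a i. u i $ a)"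
  have U: "invertible U" "frame_flag U = F"
    using frame_of_flag[OF assms u(1,2)] by (simp_all add: U_def)
  define b where "b = U ** perm_mat (inv v)"
  have "upper b"
    unfolding upper_def b_def perm_mat_mult_component
  proof (intro allI impI)
    fix i j :: 'n assume "j < i"
    then have "top (u (inv v j)) < i"
      using permutes_inverses(1)[OF v, of j] by (simp add: v_def)
    then show "U $ i $ inv v j = 0"
      using top(2)[OF u0] by (simp add: U_def)
  qed
  moreover have "invertible b"
    unfolding b_def by (intro invertible_mult U invertible_perm_mat permutes_inv v)
  moreover have "b ** perm_mat v = U"
    by (simp add: b_def perm_mat_inverse[OF v] matrix_mul_assoc[symmetric])
  ultimately show ?thesis
    using that v U(2) by metis
qed

lemma flag_has_SL_frame:
  fixes F :: "('n::{finite,wellorder}) flag"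
  assumes "F \<in> flags"
  obtains g where "g \<in> SL_complex" "F = frame_flag g"
proof -
  obtain b v where "upper b" "invertible b" "v permutes UNIV" and F: "F = frame_flag (b ** perm_mat v)"
    using flag_has_frame[OF assms] .
  then have inv: "invertible (b ** perm_mat v)"
    by (intro invertible_mult invertible_perm_mat)
  then obtain c where "c \<noteq> 0" "det (mat c ** (b ** perm_mat v)) = 1"
    using scale_to_det_1 by blast
  then show ?thesis
    using that[of "mat c ** (b ** perm_mat v)"] F frame_flag_scale[OF inv] by (simp add: SL_complex_def)
qed

definition schubert_cell :: "('n::{finite,wellorder} \<Rightarrow> 'n) \<Rightarrow> 'n flag set" where
  "schubert_cell w = orbit borel_upper (coord_flag w)"

lemma schubert_cell_iff:
  assumes "w permutes UNIV"
  shows "F \<in> schubert_cell w \<longleftrightarrow> (\<exists>b. upper b \<and> invertible b \<and> F = frame_flag (b ** perm_mat w))"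
proof
  assume "F \<in> schubert_cell w"
  then obtain b where b: "b \<in> borel_upper" "F = flag_act b (coord_flag w)"
    by (auto simp: schubert_cell_def orbit_def)
  then have "upper b" "invertible b"
    by (auto simp: borel_upper_def upper_def SL_complex_iff)
  moreover have "F = frame_flag (b ** perm_mat w)"
    by (simp add: b(2) frame_flag_mult frame_flag_perm_mat[OF assms])
  ultimately show "\<exists>b. upper b \<and> invertible b \<and> F = frame_flag (b ** perm_mat w)"
    by blast
next
  assume "\<exists>b. upper b \<and> invertible b \<and> F = frame_flag (b ** perm_mat w)"
  then obtain b where b: "upper b" "invertible b" "F = frame_flag (b ** perm_mat w)"
    by blast
  obtain c where c: "c \<noteq> 0" "det (mat c ** b) = 1"
    using scale_to_det_1[OF b(2)] .
  have "F = frame_flag (mat c ** (b ** perm_mat w))"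
    using frame_flag_scale[of "b ** perm_mat w" c] b c
    by (simp add: invertible_mult invertible_perm_mat[OF assms])
  also have "\<dots> = flag_act (mat c ** b) (coord_flag w)"
    by (simp add: matrix_mul_assoc frame_flag_mult frame_flag_perm_mat[OF assms])
  finally have "F = flag_act (mat c ** b) (coord_flag w)" .
  moreover have "mat c ** b \<in> borel_upper"
    using c(2) upper_mult[OF upper_mat b(1)] by (simp add: borel_upper_def SL_complex_def upper_def)
  ultimately show "F \<in> schubert_cell w"
    by (auto simp: schubert_cell_def orbit_def)
qed

definition flag_rank :: "('n::{finite,wellorder}) flag \<Rightarrow> 'n \<Rightarrow> 'n \<Rightarrow> nat" where
  "flag_rank F k l = vec.dim (F k \<inter> coord_space l)"

text \<open>The upper triangular factor preserves every \<open>coord_space l\<close>, so the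
  dimension can be computed for \<open>coord_flag w\<close>, where it is a count of
  coordinates.\<close>

lemma flag_rank_schubert_cell:
  fixes F :: "('n::{finite,wellorder}) flag"
  assumes "w permutes UNIV" "F \<in> schubert_cell w"
  shows "flag_rank F k l = rank_count w k l"
proof -
  obtain b where b: "upper b" "invertible b" "F = frame_flag (b ** perm_mat w)"
    using assms by (auto simp: schubert_cell_iff)
  have F: "F k = (*v) b ` coord_flag w k"
    using b(3) by (simp add: frame_flag_mult frame_flag_perm_mat[OF assms(1)] flag_act_def)
  have "F k \<inter> coord_space l = (*v) b ` (coord_flag w k \<inter> coord_space l)"
    unfolding F image_Int[OF invertible_inj[OF b(2)]] upper_image[OF b(1,2)] by simp
  then have "flag_rank F k l = vec.dim (coord_flag w k \<inter> coord_space l)"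
    unfolding flag_rank_def by (simp add: dim_image_invertible[OF b(2)])
  also have "coord_flag w k \<inter> coord_space l = {x. \<forall>i. i \<notin> w ` {i. i \<le> k \<and> w i \<le> l} \<longrightarrow> x $ i = 0}"
  proof -
    have "i \<notin> w ` {i. i \<le> k \<and> w i \<le> l} \<longleftrightarrow> i \<notin> w ` {..k} \<or> l < i" for i
      by (auto simp: not_le[symmetric])
    then show ?thesis
      by (auto simp: coord_flag_eq coord_space_def)
  qed
  also have "vec.dim \<dots> = rank_count w k l"
    unfolding dim_substandard_cart rank_count_def
    using permutes_inj_on[OF assms(1)] by (intro card_image)
  finally show ?thesis .
qed

lemma schubert_cell_cover:
  fixes F :: "('n::{finite,wellorder}) flag"
  assumes "F \<in> flags"
  obtains v where "v permutes UNIV" "F \<in> schubert_cell v"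
  using flag_has_frame[OF assms] schubert_cell_iff by metis

lemma schubert_cell_subset_flags:
  assumes "w permutes UNIV"
  shows "schubert_cell w \<subseteq> flags"
  using assms by (auto simp: schubert_cell_iff intro!: frame_flag_in_flags invertible_mult invertible_perm_mat)

section \<open>LU factors near the identity\<close>

definition low_part :: "complex^('n::{finite,wellorder})^('n::_) \<Rightarrow> complex^('n::_)^('n::_)" where
  "low_part Z = (\<chi> i j. if j < i then Z $ i $ j else 0)"

definition up_part :: "complex^('n::{finite,wellorder})^('n::_) \<Rightarrow> complex^('n::_)^('n::_)" where
  "up_part Z = (\<chi> i j. if i \<le> j then Z $ i $ j else 0)"

definition mat_of_vec :: "complex^('n::finite \<times> 'n) \<Rightarrow> complex^'n^'n" where
  "mat_of_vec x = (\<chi> i j. x $ (i, j))"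

definition vec_of_mat :: "complex^'n^'n \<Rightarrow> complex^('n::finite \<times> 'n)" where
  "vec_of_mat A = (\<chi> p. A $ fst p $ snd p)"

lemma mat_of_vec_of_mat [simp]: "mat_of_vec (vec_of_mat A) = A"
  and vec_of_mat_of_vec [simp]: "vec_of_mat (mat_of_vec x) = x"
  by (simp_all add: mat_of_vec_def vec_of_mat_def vec_eq_iff)

lemma vec_of_mat_component: "vec_of_mat A $ (i, j) = A $ i $ j"
  by (simp add: vec_of_mat_def)

lemma bounded_linear_low_part: "bounded_linear low_part"
  and bounded_linear_up_part: "bounded_linear up_part"
  and bounded_linear_mat_of_vec: "bounded_linear mat_of_vec"
  and bounded_linear_vec_of_mat: "bounded_linear vec_of_mat"
  unfolding linear_conv_bounded_linear[symmetric]
  by (auto intro!: linearI simp: vec_eq_iff low_part_def up_part_def mat_of_vec_def vec_of_mat_def)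

lemma bounded_bilinear_matrix_mult:
  "bounded_bilinear ((**) :: complex^'n^'m \<Rightarrow> complex^'p^'n \<Rightarrow> complex^'p^'m)"
  unfolding bilinear_conv_bounded_bilinear[symmetric] bilinear_def
  by (auto intro!: linearI
      simp: vec_eq_iff matrix_mult_component sum.distrib algebra_simps scaleR_sum_right)

lemma matrix_add_mult: "((A :: complex^'n^'m) + B) ** C = A ** C + B ** (C :: complex^'p^'n)"
  by (simp add: vec_eq_iff matrix_mult_component sum.distrib algebra_simps)

lemma matrix_mult_add: "(A :: complex^'n^'m) ** (B + C) = A ** B + A ** (C :: complex^'p^'n)"
  by (simp add: vec_eq_iff matrix_mult_component sum.distrib algebra_simps)

lemma low_part_add_up_part: "low_part Z + up_part Z = Z"
  by (auto simp: vec_eq_iff low_part_def up_part_def not_less)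

lemma upper_up_part: "upper (up_part Z)"
  by (auto simp: upper_def up_part_def)

lemma upper_add: "upper a \<Longrightarrow> upper b \<Longrightarrow> upper (a + b)"
  by (simp add: upper_def)

lemma invertible_unit_low: "invertible (mat 1 + low_part Z)"
proof -
  have "det (mat 1 + low_part Z) = (\<Prod>i\<in>UNIV. (mat 1 + low_part Z) $ i $ i)"
    by (rule det_lowerdiagonal) (auto simp: low_part_def mat_def)
  also have "\<dots> = 1"
    by (simp add: low_part_def mat_def)
  finally show ?thesis
    by (simp add: invertible_det_nz)
qed

lemma det_upper:
  fixes c :: "complex^('n::{finite,wellorder})^('n::_)"
  assumes "upper c"
  shows "det c = (\<Prod>i\<in>UNIV. c $ i $ i)"
  using assms by (intro det_upperdiagonal) (auto simp: upper_def)

lemma invertible_upper_iff: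
  assumes "upper c"
  shows "invertible c \<longleftrightarrow> (\<forall>i. c $ i $ i \<noteq> 0)"
  by (simp add: invertible_det_nz det_upper[OF assms])

text \<open>These are the recursions of Gaussian elimination: with nonzero pivots, row
  \<open>p\<close> of \<open>C\<close> and then column \<open>p\<close> of \<open>X\<close> follow
  from the product and from the earlier rows and columns. Uniqueness and the zero pattern below are
  inductions along them.\<close>

lemma LU_entries:
  fixes C X :: "complex^('n::{finite,wellorder})^('n::_)"
  assumes "upper C"
  defines "A \<equiv> (mat 1 + low_part X) ** C"
  shows "A $ p $ j = C $ p $ j + (\<Sum>k\<in>{..<p}. X $ p $ k * C $ k $ j)"
    and "p < i \<Longrightarrow> A $ i $ p = X $ i $ p * C $ p $ p + (\<Sum>k\<in>{..<p}. X $ i $ k * C $ k $ p)"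
proof -
  have *: "A $ i $ j = C $ i $ j + (\<Sum>k\<in>{..<i}. X $ i $ k * C $ k $ j)" for i j
  proof -
    have "(low_part X ** C) $ i $ j = (\<Sum>k\<in>{..<i}. X $ i $ k * C $ k $ j)"
      unfolding matrix_mult_component low_part_def
      by (intro sum.mono_neutral_cong_right) auto
    then show ?thesis
      by (simp add: A_def matrix_add_mult)
  qed
  show "A $ p $ j = C $ p $ j + (\<Sum>k\<in>{..<p}. X $ p $ k * C $ k $ j)"
    by (rule *)
  assume "p < i"
  have "(\<Sum>k\<in>{..<i}. X $ i $ k * C $ k $ p) = (\<Sum>k\<in>insert p {..<p}. X $ i $ k * C $ k $ p)"
  proof (rule sum.mono_neutral_right)
    show "insert p {..<p} \<subseteq> {..<i}"
      using \<open>p < i\<close> by (auto intro: less_trans)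
    show "\<forall>k\<in>{..<i} - insert p {..<p}. X $ i $ k * C $ k $ p = 0"
      using assms(1) by (auto simp: upper_def not_less le_less)
  qed simp
  then show "A $ i $ p = X $ i $ p * C $ p $ p + (\<Sum>k\<in>{..<p}. X $ i $ k * C $ k $ p)"
    using *[of i p] assms(1) \<open>p < i\<close> by (simp add: upper_def)
qed

lemma LU_unique:
  fixes C C' X X' :: "complex^('n::{finite,wellorder})^('n::_)"
  assumes "upper C" "upper C'" "\<And>i. C $ i $ i \<noteq> 0"
    and eq: "(mat 1 + low_part X) ** C = (mat 1 + low_part X') ** C'"
  shows "C = C'" "low_part X = low_part X'"
proof -
  have *: "(\<forall>j. C $ p $ j = C' $ p $ j) \<and> (\<forall>i. p < i \<longrightarrow> X $ i $ p = X' $ i $ p)" for p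
  proof (induction p rule: less_induct)
    case (less p)
    have row: "C $ p $ j = C' $ p $ j" for j
    proof -
      have "(\<Sum>k\<in>{..<p}. X $ p $ k * C $ k $ j) = (\<Sum>k\<in>{..<p}. X' $ p $ k * C' $ k $ j)"
        using less by (intro sum.cong) auto
      then show ?thesis
        using LU_entries(1)[OF assms(1), of X p j] LU_entries(1)[OF assms(2), of X' p j] eq by simp
    qed
    have "X $ i $ p = X' $ i $ p" if "p < i" for i
    proof -
      have "(\<Sum>k\<in>{..<p}. X $ i $ k * C $ k $ p) = (\<Sum>k\<in>{..<p}. X' $ i $ k * C' $ k $ p)"
        using less that by (intro sum.cong) (auto intro: less_trans)
      then have "X $ i $ p * C $ p $ p = X' $ i $ p * C' $ p $ p"
        using LU_entries(2)[OF assms(1) that, of X] LU_entries(2)[OF assms(2) that, of X'] eq by simp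
      then show ?thesis
        using row[of p] assms(3)[of p] by simp
    qed
    with row show ?case by blast
  qed
  from * show "C = C'"
    by (simp add: vec_eq_iff)
  from * show "low_part X = low_part X'"
    by (simp add: vec_eq_iff low_part_def)
qed

text \<open>Matrices with this zero pattern form an algebra, so the elimination never leaves it.\<close>

lemma LU_pattern:
  fixes C X :: "complex^('n::{finite,wellorder})^('n::_)" and w :: "'n \<Rightarrow> 'n"
  assumes "upper C" "\<And>i. C $ i $ i \<noteq> 0"
    and A: "\<And>i j. w j < w i \<Longrightarrow> ((mat 1 + low_part X) ** C) $ i $ j = 0"
    and "j < i" "w j < w i"
  shows "X $ i $ j = 0"
proof -
  have *: "(\<forall>j. w j < w p \<longrightarrow> C $ p $ j = 0) \<and> (\<forall>i. p < i \<longrightarrow> w p < w i \<longrightarrow> X $ i $ p = 0)" for p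
  proof (induction p rule: less_induct)
    case (less p)
    have zero: "X $ i $ k * C $ k $ j = 0" if "k < p" "p \<le> i" "w j < w i" for i j k
    proof (cases "w k < w i")
      case True
      then show ?thesis using less that by (auto intro: less_le_trans)
    next
      case False
      then have "w j < w k" using that by order
      then show ?thesis using less that by auto
    qed
    have "C $ p $ j = 0" if "w j < w p" for j
    proof -
      have "(\<Sum>k\<in>{..<p}. X $ p $ k * C $ k $ j) = 0"
        using zero that by (intro sum.neutral) auto
      then show ?thesis
        using LU_entries(1)[OF assms(1), of X p j] A[OF that] by simp
    qed
    moreover have "X $ i $ p = 0" if "p < i" "w p < w i" for i
    proof -
      have "(\<Sum>k\<in>{..<p}. X $ i $ k * C $ k $ p) = 0"
        using zero that by (intro sum.neutral) auto
      then show ?thesis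
        using LU_entries(2)[OF assms(1) that(1), of X] A[OF that(2)] assms(2)[of p] by simp
    qed
    ultimately show ?case by blast
  qed
  then show ?thesis
    using assms(4,5) by blast
qed

text \<open>Both factors are stored in one matrix, so this is a map of the matrix space to itself
  whose derivative at \<open>0\<close> is the identity.\<close>

definition LU_map :: "complex^('n::{finite,wellorder})^('n::_) \<Rightarrow> complex^('n::_)^('n::_)" where
  "LU_map Z = (mat 1 + low_part Z) ** (mat 1 + up_part Z)"

lemma LU_map_eq: "LU_map Z = mat 1 + Z + low_part Z ** up_part Z"
proof -
  have "LU_map Z = mat 1 + (low_part Z + up_part Z) + low_part Z ** up_part Z"
    by (simp add: LU_map_def matrix_add_mult matrix_mult_add)
  then show ?thesis
    by (simp only: low_part_add_up_part)
qed

lemma low_part_0 [simp]: "low_part 0 = 0" and up_part_0 [simp]: "up_part 0 = 0"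
  by (simp_all add: low_part_def up_part_def vec_eq_iff)

text \<open>On the open set \<open>S\<close>, where the upper factor is invertible,
  \<open>LU_map\<close> is injective by \<open>LU_unique\<close>. The inverse function theorem
  differentiates its inverse at \<open>mat 1\<close>, and the open mapping theorem shows that the
  image contains a full neighbourhood.\<close>

lemma local_LU:
  obtains f :: "complex^('n::{finite,wellorder})^('n::_) \<Rightarrow> complex^('n::_)^('n::_)"
  where "(f has_derivative (\<lambda>Z. Z)) (at (mat 1))" "f (mat 1) = 0"
    "\<forall>\<^sub>F A in nhds (mat 1). LU_map (f A) = A \<and> invertible (mat 1 + up_part (f A))"
proof -
  define S :: "(complex^('n::_)^('n::_)) set" where "S = {Z. (\<Prod>i\<in>UNIV. 1 + Z $ i $ i) \<noteq> 0}"
  have S_iff: "Z \<in> S \<longleftrightarrow> invertible (mat 1 + up_part Z)" for Z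
  proof -
    have "upper (mat 1 + up_part Z)"
      by (intro upper_add upper_mat upper_up_part)
    then show ?thesis
      by (simp add: S_def invertible_upper_iff) (simp add: mat_def up_part_def)
  qed
  have "open S"
    unfolding S_def by (intro open_Collect_neq continuous_intros)
  have "0 \<in> S"
    by (simp add: S_def)
  have der: "(LU_map has_derivative (\<lambda>Z. Z)) (at 0)"
  proof -
    have "((\<lambda>Z. mat 1 + Z + low_part Z ** up_part Z) has_derivative
        (\<lambda>h. 0 + h + (low_part 0 ** up_part h + low_part h ** up_part 0))) (at 0)"
      by (intro has_derivative_add has_derivative_const has_derivative_ident
          bounded_bilinear.FDERIV[OF bounded_bilinear_matrix_mult]
          bounded_linear_imp_has_derivative bounded_linear_low_part bounded_linear_up_part)
    then show ?thesis
      by (simp add: LU_map_eq[abs_def])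
  qed
  have cont: "continuous_on S LU_map"
    unfolding LU_map_eq[abs_def]
    by (intro continuous_intros bounded_bilinear.continuous_on[OF bounded_bilinear_matrix_mult]
        linear_continuous_on bounded_linear_low_part bounded_linear_up_part)
  have inj: "inj_on LU_map S"
  proof (rule inj_onI)
    fix Z Z' assume Z: "Z \<in> S" "Z' \<in> S" "LU_map Z = LU_map Z'"
    have up: "upper (mat 1 + up_part Z)" for Z :: "complex^('n::_)^('n::_)"
      by (intro upper_add upper_mat upper_up_part)
    have "(mat 1 + up_part Z) $ i $ i \<noteq> 0" for i
      using Z(1) invertible_upper_iff[OF up] unfolding S_iff by blast
    from LU_unique[OF up up this Z(3)[unfolded LU_map_def]]
    have "low_part Z + up_part Z = low_part Z' + up_part Z'" by simp
    then show "Z = Z'"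
      by (simp only: low_part_add_up_part)
  qed
  define f where "f = inv_into S LU_map"
  have LU0: "LU_map 0 = (mat 1 :: complex^('n::_)^('n::_))"
    by (simp add: LU_map_eq)
  have f_left: "f (LU_map Z) = Z" if "Z \<in> S" for Z
    unfolding f_def using inj that by (rule inv_into_f_f)
  have "(f has_derivative (\<lambda>Z. Z)) (at (mat 1))"
    using has_derivative_inverse_strong[OF \<open>open S\<close> \<open>0 \<in> S\<close> cont f_left der, of "\<lambda>Z. Z"] LU0
    by (simp add: comp_def id_def)
  moreover have "f (mat 1) = 0"
    using f_left[OF \<open>0 \<in> S\<close>] LU0 by simp
  moreover have "mat 1 \<in> interior (LU_map ` S)"
    using sussmann_open_mapping[OF \<open>open S\<close> cont \<open>0 \<in> S\<close> der, of "\<lambda>Z. Z" S] LU0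
      \<open>open S\<close> \<open>0 \<in> S\<close> by (simp add: comp_def id_def interior_open bounded_linear_ident)
  then have "\<forall>\<^sub>F A in nhds (mat 1). A \<in> LU_map ` S"
    using eventually_nhds_in_open[OF open_interior] interior_subset
    by (metis (no_types, lifting) eventually_mono subsetD)
  then have "\<forall>\<^sub>F A in nhds (mat 1). LU_map (f A) = A \<and> invertible (mat 1 + up_part (f A))"
  proof (rule eventually_mono)
    fix A assume "A \<in> LU_map ` S"
    then show "LU_map (f A) = A \<and> invertible (mat 1 + up_part (f A))"
      unfolding f_def S_iff[symmetric] using inv_into_into f_inv_into_f by metis
  qed
  ultimately show ?thesis
    using that by blast
qed

section \<open>Tangent spaces of submanifolds\<close>

lemma scaleR_eq_smult: "scaleR r y = complex_of_real r *s (y :: complex^'m)"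
  unfolding vec_eq_iff vector_scaleR_component vector_smult_component
  by (simp add: scaleR_conv_of_real)

text \<open>The difference quotients at \<open>0\<close> lie in \<open>S\<close>, and a
  finite-dimensional subspace is closed.\<close>

lemma tangent_in_subspace:
  fixes S :: "(complex^'m) set" and x :: "real \<Rightarrow> complex^'m"
  assumes S: "vec.subspace S" and x: "(x has_vector_derivative v) (at 0)"
    and ev: "\<forall>\<^sub>F s in nhds 0. x s \<in> S"
  shows "v \<in> S"
proof -
  have "subspace S"
    unfolding subspace_def scaleR_eq_smult
    using S by (auto intro: vec.subspace_0 vec.subspace_add vec.subspace_scale)
  then have "closed S"
    by (rule closed_subspace)
  have lim: "((\<lambda>h. (x h - x 0) /\<^sub>R h) \<longlongrightarrow> v) (at 0)"
  proof -
    have "((\<lambda>h. norm (x (0 + h) - x 0 - h *\<^sub>R v) / norm h) \<longlongrightarrow> 0) (at 0)"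
      using x unfolding has_vector_derivative_def has_derivative_at by blast
    moreover have "norm (x (0 + h) - x 0 - h *\<^sub>R v) / norm h = norm ((x h - x 0) /\<^sub>R h - v)" if "h \<noteq> 0" for h
    proof -
      have "(x h - x 0) /\<^sub>R h - v = (x h - x 0 - h *\<^sub>R v) /\<^sub>R h"
        using that by (simp add: scaleR_diff_right)
      then show ?thesis by (simp add: divide_inverse mult.commute)
    qed
    then have "\<forall>\<^sub>F h in at 0. norm (x (0 + h) - x 0 - h *\<^sub>R v) / norm h = norm ((x h - x 0) /\<^sub>R h - v)"
      by (auto simp: eventually_at_filter)
    ultimately have "((\<lambda>h. norm ((x h - x 0) /\<^sub>R h - v)) \<longlongrightarrow> 0) (at 0)"
      by (rule Lim_transform_eventually)
    then have "((\<lambda>h. (x h - x 0) /\<^sub>R h - v) \<longlongrightarrow> 0) (at 0)"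
      by (rule tendsto_norm_zero_cancel)
    then show ?thesis
      by (rule LIM_zero_cancel)
  qed
  have "x 0 \<in> S"
    using ev by (rule eventually_nhds_x_imp_x)
  have "\<forall>\<^sub>F h in at 0. (x h - x 0) /\<^sub>R h \<in> S"
    using ev unfolding eventually_at_filter
  proof eventually_elim
    case (elim h)
    then show ?case
      using \<open>x 0 \<in> S\<close> S unfolding scaleR_eq_smult by (auto intro: vec.subspace_diff vec.subspace_scale)
  qed
  then show ?thesis
    using Lim_in_closed_set[OF \<open>closed S\<close> _ _ lim] by simp
qed

lemma has_vector_derivative_eventually:
  assumes "(f has_vector_derivative D) (at x)" "\<forall>\<^sub>F s in nhds x. f s = g s"
  shows "(g has_vector_derivative D) (at x)"
proof -
  obtain A where "open A" "x \<in> A" "\<forall>s\<in>A. f s = g s"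
    using assms(2) unfolding eventually_nhds by blast
  then show ?thesis
    using has_vector_derivative_transform_within_open[OF assms(1)] by metis
qed

text \<open>Holomorphy is a condition within a relatively open set, so the chain rule is needed
  along curves that stay in this set near \<open>0\<close>.\<close>

lemma curve_chain:
  fixes x :: "real \<Rightarrow> 'a::real_normed_vector"
  assumes f: "(f has_derivative f') (at (x 0) within W)"
    and x: "(x has_vector_derivative v) (at 0)" and ev: "\<forall>\<^sub>F s in nhds 0. x s \<in> W"
  shows "((\<lambda>s. f (x s)) has_vector_derivative f' v) (at 0)"
proof -
  obtain A where A: "open A" "0 \<in> A" "x ` A \<subseteq> W"
    using ev unfolding eventually_nhds by blast
  have "(x has_derivative (\<lambda>t. t *\<^sub>R v)) (at 0 within A)"
    using x has_vector_derivative_def has_derivative_at_withinI by blast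
  moreover have "(f has_derivative f') (at (x 0) within x ` A)"
    using f A(3) by (rule has_derivative_subset)
  ultimately have "(f \<circ> x has_derivative f' \<circ> (\<lambda>t. t *\<^sub>R v)) (at 0 within A)"
    by (rule diff_chain_within)
  then have "(f \<circ> x has_derivative f' \<circ> (\<lambda>t. t *\<^sub>R v)) (at 0)"
    using at_within_open[OF A(2,1)] by simp
  then show ?thesis
    using has_derivative_linear[OF f]
    by (simp add: has_vector_derivative_def comp_def linear_cmul)
qed

lemma eventually_in_relopen:
  fixes x :: "real \<Rightarrow> complex^'m"
  assumes "openin (top_of_set S) W" "x 0 \<in> W" "(x has_vector_derivative v) (at 0)"
    and "\<forall>\<^sub>F s in nhds 0. x s \<in> S"
  shows "\<forall>\<^sub>F s in nhds 0. x s \<in> W"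
proof -
  obtain Q where Q: "open Q" "W = S \<inter> Q"
    using assms(1) by (auto simp: openin_open)
  have "(x \<longlongrightarrow> x 0) (at 0)"
    using has_vector_derivative_continuous[OF assms(3)] by (simp add: continuous_at isCont_def)
  then have "filterlim x (nhds (x 0)) (nhds 0)"
    using tendsto_at_iff_tendsto_nhds by blast
  then have "\<forall>\<^sub>F s in nhds 0. x s \<in> Q"
    using topological_tendstoD[of x "x 0" "nhds 0" Q] Q assms(2) by blast
  then show ?thesis
    using assms(4) unfolding Q(2) by eventually_elim simp
qed

text \<open>The space \<open>T\<close> is the preimage of \<open>L\<close> in \<open>S\<close> under
  the derivative of \<psi> at \<open>0\<close>. This derivative is only meaningful on
  \<open>S\<close>; there the derivative of the inverse map is its left inverse, as one sees along
  straight lines, and it maps \<open>S\<close> onto itself by dimension. The last two properties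
  describe \<open>T\<close> by curves and are all that is used later.\<close>

lemma biholomorphic_tangent:
  fixes S L W W' :: "(complex^'m) set" and \<psi> :: "complex^'m \<Rightarrow> complex^'m"
  assumes S: "vec.subspace S" and W: "openin (top_of_set S) W" "0 \<in> W"
    and W': "openin (top_of_set S) W'" and bih: "biholomorphic \<psi> W W'"
    and L: "vec.subspace L" "L \<subseteq> S" "\<psi> 0 \<in> L"
  obtains T where "vec.subspace T" "T \<subseteq> S" "vec.dim T = vec.dim L"
    "\<And>x v. x (0::real) = 0 \<Longrightarrow> (x has_vector_derivative v) (at 0) \<Longrightarrow> \<forall>\<^sub>F s in nhds 0. x s \<in> S \<Longrightarrow>
        \<forall>\<^sub>F s in nhds 0. x s \<in> W \<longrightarrow> \<psi> (x s) \<in> L \<Longrightarrow> v \<in> T"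
    "\<And>v. v \<in> T \<Longrightarrow> \<exists>x. x (0::real) = 0 \<and> (x has_vector_derivative v) (at 0) \<and>
        (\<forall>\<^sub>F s in nhds 0. x s \<in> W \<and> \<psi> (x s) \<in> L)"
proof -
  define \<phi> where "\<phi> = inv_into W \<psi>"
  have bij: "bij_betw \<psi> W W'"
    using bih by (simp add: biholomorphic_def)
  obtain f' where f': "(\<psi> has_derivative f') (at 0 within W)" "Vector_Spaces.linear (*s) (*s) f'"
    using bih W(2) unfolding biholomorphic_def vec_holomorphic_on_def by blast
  have "\<psi> 0 \<in> W'"
    using bij W(2) bij_betwE by blast
  then obtain \<phi>' where \<phi>': "(\<phi> has_derivative \<phi>') (at (\<psi> 0) within W')"
    using bih unfolding biholomorphic_def vec_holomorphic_on_def \<phi>_def by blast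
  have \<phi>_mem: "\<phi> y \<in> W" "\<psi> (\<phi> y) = y" if "y \<in> W'" for y
    using bij that unfolding \<phi>_def bij_betw_def
    by (auto intro: inv_into_into f_inv_into_f)
  have \<phi>_left: "\<phi> (\<psi> y) = y" if "y \<in> W" for y
    using bij that unfolding \<phi>_def by (rule bij_betw_inv_into_left)
  have W'S: "W' \<subseteq> S"
    using openin_imp_subset[OF W'] .
  have line: "((\<lambda>s. p + s *\<^sub>R v) has_vector_derivative v) (at 0)" for p v :: "complex^'m"
    by (auto intro!: derivative_eq_intros simp: has_vector_derivative_def)
  have f'S: "f' v \<in> S" and \<phi>'f': "\<phi>' (f' v) = v" if "v \<in> S" for v
  proof -
    have d: "((\<lambda>s. s *\<^sub>R v) has_vector_derivative v) (at 0)"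
      using line[of 0 v] by simp
    have "s *\<^sub>R v \<in> S" for s
      unfolding scaleR_eq_smult using S that by (rule vec.subspace_scale)
    then have ev: "\<forall>\<^sub>F s in nhds 0. s *\<^sub>R v \<in> W"
      using W(2) by (intro eventually_in_relopen[OF W(1) _ d]) auto
    have c: "((\<lambda>s. \<psi> (s *\<^sub>R v)) has_vector_derivative f' v) (at 0)"
      using curve_chain[OF _ d ev, of \<psi> f'] f'(1) by simp
    have ev': "\<forall>\<^sub>F s in nhds 0. \<psi> (s *\<^sub>R v) \<in> W'"
      using ev bij_betwE[OF bij] by (auto elim: eventually_mono)
    then show "f' v \<in> S"
      using W'S by (intro tangent_in_subspace[OF S c]) (auto elim: eventually_mono)
    have "((\<lambda>s. \<phi> (\<psi> (s *\<^sub>R v))) has_vector_derivative \<phi>' (f' v)) (at 0)"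
      using curve_chain[OF _ c ev', of \<phi> \<phi>'] \<phi>' by simp
    moreover have "\<forall>\<^sub>F s in nhds 0. \<phi> (\<psi> (s *\<^sub>R v)) = s *\<^sub>R v"
      using ev \<phi>_left by (auto elim: eventually_mono)
    ultimately have "((\<lambda>s. s *\<^sub>R v) has_vector_derivative \<phi>' (f' v)) (at 0)"
      by (rule has_vector_derivative_eventually)
    then show "\<phi>' (f' v) = v"
      using d by (rule vector_derivative_unique_at)
  qed
  define T where "T = S \<inter> {v. f' v \<in> L}"
  have T: "vec.subspace T"
    unfolding T_def
    by (intro vec.subspace_inter S vec.linear_subspace_linear_preimage f' L)
  have inj: "inj_on f' S"
    by (rule inj_onI) (metis \<phi>'f')
  have "f' ` S = S"
  proof (rule vec.subspace_dim_equal)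
    show "vec.subspace (f' ` S)"
      by (intro vec.linear_subspace_image f' S)
    show "vec.dim S \<le> vec.dim (f' ` S)"
      using inj S f'(2) by (subst vec.dim_image_eq) (simp_all add: vec.span_eq_iff[THEN iffD2])
  qed (use S f'S in auto)
  then have "f' ` T = L"
  proof (intro equalityI subsetI)
    fix l assume "l \<in> L"
    then obtain v where "v \<in> S" "l = f' v"
      using L(2) \<open>f' ` S = S\<close> by (metis imageE subsetD)
    then show "l \<in> f' ` T"
      using \<open>l \<in> L\<close> by (simp add: T_def)
  qed (auto simp: T_def)
  moreover have "vec.dim (f' ` T) = vec.dim T"
    using inj T f'(2) inj_on_subset[of f' S T]
    by (intro vec.dim_image_eq) (auto simp: vec.span_eq_iff[THEN iffD2] T_def)
  ultimately have dim: "vec.dim T = vec.dim L" by simp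
  have into: "v \<in> T"
    if x: "x (0::real) = 0" "(x has_vector_derivative v) (at 0)" "\<forall>\<^sub>F s in nhds 0. x s \<in> S"
      "\<forall>\<^sub>F s in nhds 0. x s \<in> W \<longrightarrow> \<psi> (x s) \<in> L" for x v
  proof -
    have ev: "\<forall>\<^sub>F s in nhds 0. x s \<in> W"
      using x W by (intro eventually_in_relopen[OF W(1) _ x(2)]) auto
    have c: "((\<lambda>s. \<psi> (x s)) has_vector_derivative f' v) (at 0)"
      using curve_chain[OF _ x(2) ev, of \<psi> f'] f'(1) x(1) by simp
    have "\<forall>\<^sub>F s in nhds 0. \<psi> (x s) \<in> L"
      using ev x(4) by eventually_elim simp
    then show ?thesis
      using tangent_in_subspace[OF S x(2,3)] tangent_in_subspace[OF L(1) c] by (simp add: T_def)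
  qed
  have out: "\<exists>x. x (0::real) = 0 \<and> (x has_vector_derivative v) (at 0) \<and>
      (\<forall>\<^sub>F s in nhds 0. x s \<in> W \<and> \<psi> (x s) \<in> L)" if v: "v \<in> T" for v
  proof -
    \<comment> \<open>The required curve is the preimage under \<psi> of a straight line in
      \<open>L\<close> through \<open>\<psi> 0\<close>.\<close>
    define y where "y = (\<lambda>s::real. \<psi> 0 + s *\<^sub>R f' v)"
    have yL: "y s \<in> L" for s
      unfolding y_def scaleR_eq_smult using v L(1,3) by (intro vec.subspace_add vec.subspace_scale) (auto simp: T_def)
    have y: "(y has_vector_derivative f' v) (at 0)"
      unfolding y_def by (rule line)
    have ev: "\<forall>\<^sub>F s in nhds 0. y s \<in> W'"
    proof (rule eventually_in_relopen[OF W' _ y])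
      show "y 0 \<in> W'"
        using \<open>\<psi> 0 \<in> W'\<close> by (simp add: y_def)
      have "y s \<in> S" for s
        using yL L(2) by blast
      then show "\<forall>\<^sub>F s in nhds 0. y s \<in> S"
        by simp
    qed
    have "((\<lambda>s. \<phi> (y s)) has_vector_derivative \<phi>' (f' v)) (at 0)"
      using curve_chain[OF _ y ev, of \<phi> \<phi>'] \<phi>' by (simp add: y_def)
    moreover have "\<phi>' (f' v) = v"
      using v by (intro \<phi>'f') (simp add: T_def)
    moreover have "\<phi> (y 0) = 0"
      using \<phi>_left[OF W(2)] by (simp add: y_def)
    moreover have "\<forall>\<^sub>F s in nhds 0. \<phi> (y s) \<in> W \<and> \<psi> (\<phi> (y s)) \<in> L"
      using ev
    proof eventually_elim
      case (elim s)
      then show ?case using \<phi>_mem[OF elim] yL by simp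
    qed
    ultimately show ?thesis
      by (intro exI[of _ "\<lambda>s. \<phi> (y s)"]) simp
  qed
  show ?thesis
    by (rule that[OF T _ dim into out]) (auto simp: T_def)
qed

text \<open>
  The tangent space at the flag of the frame \<open>g\<close>, pulled back to matrices: velocities are
  written as \<open>g a\<close>, and changing the frame within the flag makes it contain all upper triangular \<open>a\<close>.
\<close>

definition flag_tangent ::
    "('n::{finite,wellorder}) flag set \<Rightarrow> complex^('n::_)^('n::_) \<Rightarrow> (complex^('n \<times> 'n)) set" where
  "flag_tangent M g = {a. \<exists>U. U (0::real) = g \<and> (U has_vector_derivative g ** mat_of_vec a) (at 0) \<and>
     (\<forall>\<^sub>F s in nhds 0. frame_flag (U s) \<in> M)}"

lemma flag_tangent_mono:
  assumes "\<forall>\<^sub>F h in nhds g. frame_flag h \<in> M \<longrightarrow> frame_flag h \<in> M'"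
  shows "flag_tangent M g \<subseteq> flag_tangent M' g"
proof
  fix a assume "a \<in> flag_tangent M g"
  then obtain U where U: "U (0::real) = g" "(U has_vector_derivative g ** mat_of_vec a) (at 0)"
    "\<forall>\<^sub>F s in nhds 0. frame_flag (U s) \<in> M"
    unfolding flag_tangent_def by blast
  have "(U \<longlongrightarrow> g) (at 0)"
    using has_vector_derivative_continuous[OF U(2)] U(1) by (simp add: isCont_def)
  then have "filterlim U (nhds g) (nhds 0)"
    using tendsto_at_iff_tendsto_nhds U(1) by blast
  then have "\<forall>\<^sub>F s in nhds 0. frame_flag (U s) \<in> M \<longrightarrow> frame_flag (U s) \<in> M'"
    using assms filterlim_iff by blast
  then have "\<forall>\<^sub>F s in nhds 0. frame_flag (U s) \<in> M'"
    using U(3) by eventually_elim simp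
  then show "a \<in> flag_tangent M' g"
    unfolding flag_tangent_def using U by blast
qed

section \<open>Curves of frames in chart coordinates\<close>

lemma matrix_mult_has_vector_derivative:
  fixes A :: "real \<Rightarrow> complex^'n^'m" and B :: "real \<Rightarrow> complex^'p^'n"
  assumes "(A has_vector_derivative A') (at x)" "(B has_vector_derivative B') (at x)"
  shows "((\<lambda>s. A s ** B s) has_vector_derivative (A x ** B' + A' ** B x)) (at x)"
  using bounded_bilinear.has_vector_derivative[OF bounded_bilinear_matrix_mult] assms .

lemma const_mult_has_vector_derivative:
  fixes c :: "complex^'n^'m" and B :: "real \<Rightarrow> complex^'p^'n"
  assumes "(B has_vector_derivative B') (at x)"
  shows "((\<lambda>s. c ** B s) has_vector_derivative (c ** B')) (at x)"
  using matrix_mult_has_vector_derivative[OF has_vector_derivative_const assms] by simp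

lemma mult_const_has_vector_derivative:
  fixes c :: "complex^'p^'n" and B :: "real \<Rightarrow> complex^'n^'m"
  assumes "(B has_vector_derivative B') (at x)"
  shows "((\<lambda>s. B s ** c) has_vector_derivative (B' ** c)) (at x)"
  using matrix_mult_has_vector_derivative[OF assms has_vector_derivative_const] by simp

lemma LU_curve:
  fixes A :: "real \<Rightarrow> complex^('n::{finite,wellorder})^('n::_)"
  assumes A: "A 0 = mat 1" "(A has_vector_derivative A') (at 0)"
  obtains Z where "Z 0 = 0" "(Z has_vector_derivative A') (at 0)"
    "\<forall>\<^sub>F s in nhds 0. A s = (mat 1 + low_part (Z s)) ** (mat 1 + up_part (Z s)) \<and>
        invertible (mat 1 + up_part (Z s))"
proof -
  obtain f :: "complex^('n::_)^('n::_) \<Rightarrow> complex^('n::_)^('n::_)"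
    where f: "(f has_derivative (\<lambda>Z. Z)) (at (mat 1))" "f (mat 1) = 0"
      "\<forall>\<^sub>F A in nhds (mat 1). LU_map (f A) = A \<and> invertible (mat 1 + up_part (f A))"
    using local_LU by blast
  have "((\<lambda>s. f (A s)) has_vector_derivative A') (at 0)"
    using curve_chain[OF _ A(2), of f "\<lambda>Z. Z" UNIV] f(1) A(1) by simp
  moreover have "(A \<longlongrightarrow> mat 1) (at 0)"
    using has_vector_derivative_continuous[OF A(2)] A(1) by (simp add: isCont_def)
  then have "filterlim A (nhds (mat 1)) (nhds 0)"
    using tendsto_at_iff_tendsto_nhds A(1) by metis
  then have "\<forall>\<^sub>F s in nhds 0. LU_map (f (A s)) = A s \<and> invertible (mat 1 + up_part (f (A s)))"
    using f(3) filterlim_iff by blast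
  then have "\<forall>\<^sub>F s in nhds 0. A s = (mat 1 + low_part (f (A s))) ** (mat 1 + up_part (f (A s))) \<and>
        invertible (mat 1 + up_part (f (A s)))"
    by eventually_elim (simp add: LU_map_def)
  ultimately show ?thesis
    using that[of "\<lambda>s. f (A s)"] A f(2) by simp
qed

lemma flag_chart_eq: "flag_chart g x = frame_flag (g ** (mat 1 + mat_of_vec x))"
  by (simp add: flag_chart_def frame_flag_def mat_of_vec_def)

text \<open>Move the curve to \<open>mat 1\<close> by the inverse of \<open>g\<close> and split it
  into LU factors. The upper factor does not affect the flags, so the lower one is the chart
  coordinate; as \<open>local_LU\<close> has the identity as derivative, its velocity is the lower
  part of \<open>A\<close>.\<close>

lemma chart_curve:
  fixes U :: "real \<Rightarrow> complex^('n::{finite,wellorder})^('n::_)"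
  assumes g: "invertible g" and U: "U 0 = g" "(U has_vector_derivative g ** A) (at 0)"
  obtains x where "x (0::real) = 0" "(x has_vector_derivative vec_of_mat (low_part A)) (at 0)"
    "\<And>s. x s \<in> strictly_lower" "\<forall>\<^sub>F s in nhds 0. frame_flag (U s) = flag_chart g (x s)"
proof -
  obtain h where h: "h ** g = mat 1" "g ** h = mat 1"
    using invertibleE[OF g] by metis
  have "((\<lambda>s. h ** U s) has_vector_derivative (h ** (g ** A))) (at 0)"
    using U(2) by (rule const_mult_has_vector_derivative)
  then have d: "((\<lambda>s. h ** U s) has_vector_derivative A) (at 0)"
    by (simp add: matrix_mul_assoc h)
  obtain Z where Z: "Z 0 = 0" "(Z has_vector_derivative A) (at 0)"
    "\<forall>\<^sub>F s in nhds 0. h ** U s = (mat 1 + low_part (Z s)) ** (mat 1 + up_part (Z s)) \<and>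
        invertible (mat 1 + up_part (Z s))"
    using LU_curve[OF _ d] U(1) h by auto
  define x where "x = (\<lambda>s. vec_of_mat (low_part (Z s)))"
  have "x 0 = 0"
    by (simp add: x_def Z(1)) (simp add: vec_of_mat_def vec_eq_iff)
  moreover have "(x has_vector_derivative vec_of_mat (low_part A)) (at 0)"
    unfolding x_def
    by (intro bounded_linear.has_vector_derivative[OF bounded_linear_vec_of_mat]
        bounded_linear.has_vector_derivative[OF bounded_linear_low_part] Z(2))
  moreover have "x s \<in> strictly_lower" for s
    by (auto simp: strictly_lower_def x_def vec_of_mat_def low_part_def)
  moreover have "\<forall>\<^sub>F s in nhds 0. frame_flag (U s) = flag_chart g (x s)"
    using Z(3)
  proof eventually_elim
    case (elim s)
    define c where "c = mat 1 + up_part (Z s)"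
    have c: "upper c" "invertible c"
      using elim by (simp_all add: c_def upper_add upper_mat upper_up_part)
    have "U s = g ** (h ** U s)"
      by (simp add: matrix_mul_assoc h)
    also have "\<dots> = (g ** (mat 1 + low_part (Z s))) ** c"
      using elim by (simp add: matrix_mul_assoc c_def)
    finally have Us: "U s = (g ** (mat 1 + low_part (Z s))) ** c" .
    have inv: "invertible (g ** (mat 1 + low_part (Z s)))"
      by (intro invertible_mult g invertible_unit_low)
    have "frame_flag (g ** (mat 1 + low_part (Z s))) = frame_flag (U s)"
      using frame_flag_eq_iff[OF inv, of "U s"] c Us inv invertible_mult by metis
    then show ?case
      by (simp add: flag_chart_eq x_def)
  qed
  ultimately show ?thesis
    using that by blast
qed

lemma eventually_invertible:
  fixes U :: "real \<Rightarrow> complex^'n^'n"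
  assumes "isCont U 0" "invertible (U 0)"
  shows "\<forall>\<^sub>F s in nhds 0. invertible (U s)"
proof -
  have "isCont (\<lambda>s. det (U s)) 0"
    unfolding det_def using assms(1) by (intro continuous_intros)
  then have "((\<lambda>s. det (U s)) \<longlongrightarrow> det (U 0)) (nhds 0)"
    unfolding isCont_def by (rule tendsto_at_iff_tendsto_nhds[THEN iffD1])
  then have "\<forall>\<^sub>F s in nhds 0. det (U s) \<noteq> 0"
    using tendsto_imp_eventually_ne assms(2) invertible_det_nz by blast
  then show ?thesis
    by (simp add: invertible_det_nz)
qed

lemma subspace_strictly_lower: "vec.subspace strictly_lower"
  by (simp add: strictly_lower_def vec.subspace_def)

text \<open>Multiplying on the right by \<open>mat 1 + s *\<^sub>R c\<close> changes the velocity by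
  \<open>U 0 ** c\<close> but not the flags.\<close>

lemma curve_times_upper:
  fixes U :: "real \<Rightarrow> complex^('n::{finite,wellorder})^('n::_)"
  assumes U: "(U has_vector_derivative U') (at 0)" "\<forall>\<^sub>F s in nhds 0. invertible (U s)"
    and c: "upper c"
  obtains V where "V 0 = U 0" "(V has_vector_derivative U' + U 0 ** c) (at 0)"
    "\<forall>\<^sub>F s in nhds 0. frame_flag (V s) = frame_flag (U s)"
proof -
  define C where "C = (\<lambda>s::real. mat 1 + s *\<^sub>R c)"
  have C: "(C has_vector_derivative c) (at 0)" "C 0 = mat 1"
    unfolding C_def by (auto intro!: derivative_eq_intros simp: has_vector_derivative_def)
  have upper_C: "upper (C s)" for s
    using c upper_mat[of 1] by (auto simp: upper_def C_def)
  have "\<forall>\<^sub>F s in nhds 0. invertible (C s)"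
    using has_vector_derivative_continuous[OF C(1)] C(2)
    by (intro eventually_invertible) (auto simp: invertible_mat)
  then have ev: "\<forall>\<^sub>F s in nhds 0. frame_flag (U s ** C s) = frame_flag (U s)"
    using U(2)
  proof eventually_elim
    case (elim s)
    then show ?case
      using frame_flag_eq_iff[of "U s" "U s ** C s"] upper_C[of s] invertible_mult by metis
  qed
  have "((\<lambda>s. U s ** C s) has_vector_derivative (U 0 ** c + U' ** C 0)) (at 0)"
    by (intro matrix_mult_has_vector_derivative U C)
  then show ?thesis
    using that[of "\<lambda>s. U s ** C s"] ev C(2) by (simp add: add.commute)
qed

text \<open>In the frame provided by the chart, \<open>flag_tangent\<close> is the direct sum of the
  tangent space \<open>T\<close> in chart coordinates and the space of all upper triangular
  matrices, which accounts for the pairs \<open>i \<le> j\<close>. It is a complex subspace because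
  \<open>T\<close> is one.\<close>

lemma submanifold_tangent:
  fixes M :: "('n::{finite,wellorder}) flag set"
  assumes "complex_submanifold d M" "p \<in> M"
  obtains g where "invertible g" "frame_flag g = p" "vec.subspace (flag_tangent M g)"
    "vec.dim (flag_tangent M g) = d + card {(i::'n, j). i \<le> j}"
proof -
  obtain g W W' L and \<psi> :: "complex^('n \<times> 'n) \<Rightarrow> complex^('n \<times> 'n)"
    where g: "g \<in> SL_complex" "flag_act g (coord_flag id) = p"
    and W: "openin (top_of_set strictly_lower) W" "0 \<in> W"
    and W': "openin (top_of_set strictly_lower) W'" and bih: "biholomorphic \<psi> W W'"
    and L: "vec.subspace L" "L \<subseteq> strictly_lower" "vec.dim L = d"
    and eq: "{x \<in> W. flag_chart g x \<in> M} = {x \<in> W. \<psi> x \<in> L}"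
    using assms unfolding complex_submanifold_def by blast
  have inv: "invertible g" and gp: "frame_flag g = p"
    using g SL_complex_iff by (auto simp: frame_flag_def)
  have eq': "flag_chart g x \<in> M \<longleftrightarrow> \<psi> x \<in> L" if "x \<in> W" for x
    using eq that by blast
  have mat0: "mat_of_vec 0 = 0"
    by (simp add: mat_of_vec_def vec_eq_iff)
  have "\<psi> 0 \<in> L"
    using eq'[OF W(2)] gp assms(2) by (simp add: flag_chart_eq mat0)
  obtain T where T: "vec.subspace T" "T \<subseteq> strictly_lower" "vec.dim T = vec.dim L"
    and T_in: "\<And>x v. x (0::real) = 0 \<Longrightarrow> (x has_vector_derivative v) (at 0) \<Longrightarrow>
        \<forall>\<^sub>F s in nhds 0. x s \<in> strictly_lower \<Longrightarrow>
        \<forall>\<^sub>F s in nhds 0. x s \<in> W \<longrightarrow> \<psi> (x s) \<in> L \<Longrightarrow> v \<in> T"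
    and T_out: "\<And>v. v \<in> T \<Longrightarrow> \<exists>x. x (0::real) = 0 \<and> (x has_vector_derivative v) (at 0) \<and>
        (\<forall>\<^sub>F s in nhds 0. x s \<in> W \<and> \<psi> (x s) \<in> L)"
    by (rule biholomorphic_tangent[OF subspace_strictly_lower W W' bih L(1,2) \<open>\<psi> 0 \<in> L\<close>]) blast
  define P where "P = {x :: complex^('n \<times> 'n). \<forall>p. p \<notin> {(i, j). i \<le> j} \<longrightarrow> x $ p = 0}"
  have P: "vec.subspace P" "vec.dim P = card {(i::'n, j). i \<le> j}"
    unfolding P_def dim_substandard_cart by (simp_all add: vec.subspace_def)
  have "flag_tangent M g = {x + y |x y. x \<in> T \<and> y \<in> P}"
  proof (intro equalityI subsetI)
    fix a assume "a \<in> flag_tangent M g"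
    then obtain U where U: "U (0::real) = g" "(U has_vector_derivative g ** mat_of_vec a) (at 0)"
      "\<forall>\<^sub>F s in nhds 0. frame_flag (U s) \<in> M"
      unfolding flag_tangent_def by blast
    define v where "v = vec_of_mat (low_part (mat_of_vec a))"
    obtain x where x: "x (0::real) = 0" "(x has_vector_derivative v) (at 0)"
      "\<And>s. x s \<in> strictly_lower" "\<forall>\<^sub>F s in nhds 0. frame_flag (U s) = flag_chart g (x s)"
      using chart_curve[OF inv U(1,2)] unfolding v_def by blast
    have "v \<in> T"
    proof (rule T_in[OF x(1,2)])
      show "\<forall>\<^sub>F s in nhds 0. x s \<in> W \<longrightarrow> \<psi> (x s) \<in> L"
        using U(3) x(4) by eventually_elim (simp add: eq'[symmetric])
    qed (simp add: x(3))
    moreover have "a - v \<in> P"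
      by (auto simp: P_def v_def vec_of_mat_def low_part_def mat_of_vec_def)
    ultimately show "a \<in> {x + y |x y. x \<in> T \<and> y \<in> P}"
      by (intro CollectI exI[of _ v] exI[of _ "a - v"]) simp
  next
    fix a assume "a \<in> {x + y |x y. x \<in> T \<and> y \<in> P}"
    then obtain v y where a: "a = v + y" and v: "v \<in> T" and y: "y \<in> P"
      by blast
    obtain x where x: "x (0::real) = 0" "(x has_vector_derivative v) (at 0)"
      "\<forall>\<^sub>F s in nhds 0. x s \<in> W \<and> \<psi> (x s) \<in> L"
      using T_out[OF v] by blast
    define U where "U = (\<lambda>s. g ** (mat 1 + mat_of_vec (x s)))"
    have "((\<lambda>s. mat 1 + mat_of_vec (x s)) has_vector_derivative (0 + mat_of_vec v)) (at 0)"
      by (intro has_vector_derivative_add has_vector_derivative_const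
          bounded_linear.has_vector_derivative[OF bounded_linear_mat_of_vec] x(2))
    from const_mult_has_vector_derivative[OF this, of g]
    have U': "(U has_vector_derivative g ** mat_of_vec v) (at 0)"
      by (simp add: U_def)
    have U0: "U 0 = g"
      by (simp add: U_def x(1) mat0)
    have "isCont U 0"
      using has_vector_derivative_continuous[OF U'] .
    then have ev: "\<forall>\<^sub>F s in nhds 0. invertible (U s)"
      using U0 inv by (intro eventually_invertible) auto
    have "upper (mat_of_vec y)"
      using y by (auto simp: upper_def mat_of_vec_def P_def)
    from curve_times_upper[OF U' ev this]
    obtain V where V: "V 0 = g" "(V has_vector_derivative g ** mat_of_vec v + g ** mat_of_vec y) (at 0)"
      "\<forall>\<^sub>F s in nhds 0. frame_flag (V s) = frame_flag (U s)"
      unfolding U0 by blast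
    have "g ** mat_of_vec v + g ** mat_of_vec y = g ** mat_of_vec a"
      by (simp add: a matrix_mult_add[symmetric] bounded_linear.linear[OF bounded_linear_mat_of_vec] linear_add)
    moreover have "\<forall>\<^sub>F s in nhds 0. frame_flag (V s) \<in> M"
      using V(3) x(3)
    proof eventually_elim
      case (elim s)
      then show ?case
        using eq'[of "x s"] by (simp add: U_def flag_chart_eq)
    qed
    ultimately show "a \<in> flag_tangent M g"
      unfolding flag_tangent_def using V by auto
  qed
  moreover have "T \<inter> P = {0}"
  proof -
    have "a = 0" if a: "a \<in> T" "a \<in> P" for a
    proof -
      have "a $ (i, j) = 0" for i j
        using a T(2) by (cases "i \<le> j") (auto simp: P_def strictly_lower_def)
      then show ?thesis by (simp add: vec_eq_iff)
    qed
    then show ?thesis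
      using vec.subspace_0 T(1) P(1) by blast
  qed
  moreover have "vec.dim {x + y |x y. x \<in> T \<and> y \<in> P} + vec.dim (T \<inter> P) = vec.dim T + vec.dim P"
    by (rule vec.dim_sums_Int[OF T(1) P(1)])
  ultimately have "vec.subspace (flag_tangent M g)"
    "vec.dim (flag_tangent M g) = d + card {(i::'n, j). i \<le> j}"
    using vec.subspace_sums[OF T(1) P(1)] T(3) L(3) P(2) by simp_all
  then show ?thesis
    using that inv gp by blast
qed

lemma linear_conjugation:
  fixes c c' :: "complex^'n^'n"
  shows "Vector_Spaces.linear (*s) (*s) (\<lambda>a. vec_of_mat (c ** mat_of_vec a ** c'))"
  by unfold_locales
     (simp_all add: vec_eq_iff vec_of_mat_def mat_of_vec_def matrix_mult_component
       sum.distrib sum_distrib_left sum_distrib_right algebra_simps)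

lemma flag_tangent_conjugate:
  fixes g c c' :: "complex^('n::{finite,wellorder})^('n::_)"
  assumes g: "invertible g" and c: "upper c" "c ** c' = mat 1"
    and a: "a \<in> flag_tangent M g"
  shows "vec_of_mat (c' ** mat_of_vec a ** c) \<in> flag_tangent M (g ** c)"
proof -
  obtain U where U: "U (0::real) = g" "(U has_vector_derivative g ** mat_of_vec a) (at 0)"
    "\<forall>\<^sub>F s in nhds 0. frame_flag (U s) \<in> M"
    using a unfolding flag_tangent_def by blast
  have inv_c: "invertible c"
    using c(2) invertible_right_inverse by blast
  have "((\<lambda>s. U s ** c) has_vector_derivative g ** mat_of_vec a ** c) (at 0)"
    using U(2) by (rule mult_const_has_vector_derivative)
  also have "g ** mat_of_vec a ** c = g ** c ** (c' ** mat_of_vec a ** c)"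
    by (metis c(2) matrix_mul_assoc matrix_mul_rid)
  finally have d: "((\<lambda>s. U s ** c) has_vector_derivative
      g ** c ** mat_of_vec (vec_of_mat (c' ** mat_of_vec a ** c))) (at 0)"
    by simp
  have "\<forall>\<^sub>F s in nhds 0. invertible (U s)"
    using has_vector_derivative_continuous[OF U(2)] U(1) g by (intro eventually_invertible) auto
  then have "\<forall>\<^sub>F s in nhds 0. frame_flag (U s ** c) \<in> M"
    using U(3)
  proof eventually_elim
    case (elim s)
    then show ?case
      using frame_flag_eq_iff[of "U s" "U s ** c"] c(1) inv_c invertible_mult by metis
  qed
  then show ?thesis
    unfolding flag_tangent_def using U(1) d by (intro CollectI exI[of _ "\<lambda>s. U s ** c"]) simp
qed

text \<open>The charts of a submanifold provide some frame at each flag, whereas later a given frame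
  must be used. Changing the frame by an upper triangular \<open>c\<close> conjugates the tangent
  space by \<open>c\<close>.\<close>

lemma submanifold_tangent_frame:
  fixes M :: "('n::{finite,wellorder}) flag set"
  assumes "complex_submanifold d M" "invertible h" "frame_flag h \<in> M"
  shows "vec.subspace (flag_tangent M h)"
    "vec.dim (flag_tangent M h) = d + card {(i::'n, j). i \<le> j}"
proof -
  obtain g where g: "invertible g" "frame_flag g = frame_flag h" "vec.subspace (flag_tangent M g)"
    "vec.dim (flag_tangent M g) = d + card {(i::'n, j). i \<le> j}"
    using submanifold_tangent[OF assms(1,3)] by blast
  obtain c where c: "upper c" "invertible c" "h = g ** c"
    using frame_flag_eq_iff[OF g(1) assms(2)] g(2) by blast
  obtain c' where c': "c ** c' = mat 1" "c' ** c = mat 1"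
    using invertibleE[OF c(2)] by metis
  have "upper c'"
    using upper_inverse[OF c(1,2) c'(2)] .
  define f where "f = (\<lambda>a. vec_of_mat (c' ** mat_of_vec a ** c))"
  have lin: "Vector_Spaces.linear (*s) (*s) f"
    unfolding f_def by (rule linear_conjugation)
  have ff: "f (vec_of_mat (c ** mat_of_vec a ** c')) = a" "vec_of_mat (c ** mat_of_vec (f a) ** c') = a" for a
  proof -
    have "c' ** (c ** A ** c') ** c = A" "c ** (c' ** A ** c) ** c' = A" for A
      by (metis c' matrix_mul_assoc matrix_mul_lid matrix_mul_rid)+
    then show "f (vec_of_mat (c ** mat_of_vec a ** c')) = a"
      "vec_of_mat (c ** mat_of_vec (f a) ** c') = a"
      by (simp_all add: f_def)
  qed
  have eq: "f ` flag_tangent M g = flag_tangent M h"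
  proof (intro equalityI subsetI)
    fix b assume "b \<in> f ` flag_tangent M g"
    then show "b \<in> flag_tangent M h"
      using flag_tangent_conjugate[OF g(1) c(1) c'(1)] by (auto simp: f_def c(3))
  next
    fix b assume b: "b \<in> flag_tangent M h"
    have "h ** c' = g"
      unfolding c(3) by (metis c'(1) matrix_mul_assoc matrix_mul_rid)
    then have "vec_of_mat (c ** mat_of_vec b ** c') \<in> flag_tangent M g"
      using flag_tangent_conjugate[OF assms(2) \<open>upper c'\<close> c'(2) b] by simp
    then show "b \<in> f ` flag_tangent M g"
      using ff(1) by (metis image_eqI)
  qed
  show "vec.subspace (flag_tangent M h)"
    unfolding eq[symmetric] by (intro vec.linear_subspace_image lin g(3))
  have "inj f"
    using ff(2) by (metis injI)
  then have "vec.dim (f ` flag_tangent M g) = vec.dim (flag_tangent M g)"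
    using lin by (intro vec.dim_image_eq) (auto intro: inj_on_subset)
  then show "vec.dim (flag_tangent M h) = d + card {(i::'n, j). i \<le> j}"
    unfolding eq using g(4) by simp
qed

section \<open>Schubert varieties\<close>

text \<open>
  If \<open>g\<close> is injective on a complement \<open>N\<close> of the part of \<open>coord_space k\<close> that it maps into
  \<open>coord_space l\<close>, modulo \<open>coord_space l\<close>, then so is every matrix near \<open>g\<close>.
\<close>

lemma flag_rank_semicontinuous_at:
  fixes g :: "complex^('n::{finite,wellorder})^('n::_)"
  assumes "invertible g"
  shows "\<forall>\<^sub>F h in nhds g. invertible h \<longrightarrow>
    flag_rank (frame_flag h) k l \<le> flag_rank (frame_flag g) k l"
proof -
  \<comment> \<open>A projection with kernel \<open>coord_space l\<close>, standing for the passage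
    to the quotient.\<close>
  define P :: "complex^('n::_) \<Rightarrow> complex^('n::_)" where "P = (\<lambda>x. \<chi> i. if l < i then x $ i else 0)"
  have P0: "P x = 0 \<longleftrightarrow> x \<in> coord_space l" for x
    by (auto simp: P_def coord_space_def vec_eq_iff)
  have P_lin: "Vector_Spaces.linear (*s) (*s) P"
    by unfold_locales (auto simp: P_def vec_eq_iff)
  define X where "X = (\<lambda>h. {x \<in> coord_space k. P (h *v x) = 0})"
  have rank: "flag_rank (frame_flag h) k l = vec.dim (X h)" if "invertible h" for h
  proof -
    have "frame_flag h k \<inter> coord_space l = (*v) h ` X h"
      by (auto simp: frame_flag_eq X_def P0)
    then show ?thesis
      by (simp add: flag_rank_def dim_image_invertible[OF that])
  qed
  have lin: "Vector_Spaces.linear (*s) (*s) (\<lambda>x. P (h *v x))" for h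
    using Vector_Spaces.linear_compose[OF matrix_vector_mul_linear_gen P_lin] by (simp add: comp_def)
  have X_sub: "vec.subspace (X h)" for h
  proof -
    have "X h = coord_space k \<inter> {x. P (h *v x) \<in> {0}}"
      by (auto simp: X_def)
    then show ?thesis
      by (simp only:) (intro vec.subspace_inter subspace_coord_space
          vec.linear_subspace_linear_preimage[OF lin] vec.subspace_single_0)
  qed
  define Y where "Y = (\<lambda>x. P (g *v x)) ` coord_space k"
  obtain r where r: "range r \<subseteq> coord_space k" "Vector_Spaces.linear (*s) (*s) r"
    "\<And>y. y \<in> Y \<Longrightarrow> P (g *v r y) = y"
    using vec.linear_exists_right_inverse_on[OF lin[of g] subspace_coord_space[of k]]
    unfolding Y_def by blast
  define N where "N = r ` Y"
  have Y_sub: "vec.subspace Y"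
    unfolding Y_def by (intro vec.linear_subspace_image lin subspace_coord_space)
  have N_sub: "vec.subspace N"
    unfolding N_def by (intro vec.linear_subspace_image r Y_sub)
  have N_k: "N \<subseteq> coord_space k"
    using r(1) by (auto simp: N_def)
  have "coord_space k \<subseteq> {x + y |x y. x \<in> N \<and> y \<in> X g}"
  proof
    fix x assume x: "x \<in> coord_space k"
    define y where "y = r (P (g *v x))"
    have y: "P (g *v x) \<in> Y" "y \<in> N" "y \<in> coord_space k"
      using x N_k by (auto simp: y_def N_def Y_def)
    then have "P (g *v y) = P (g *v x)"
      using r(3) by (simp add: y_def)
    then have "P (g *v (x - y)) = 0"
      using vec.linear_diff[OF lin[of g], of x y] by simp
    then have "x - y \<in> X g"
      using x y(3) vec.subspace_diff[OF subspace_coord_space] by (simp add: X_def)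
    then show "x \<in> {x + y |x y. x \<in> N \<and> y \<in> X g}"
      using y(2) by (intro CollectI exI[of _ y] exI[of _ "x - y"]) simp
  qed
  from vec.dim_subset[OF this]
  have le: "vec.dim (coord_space k) \<le> vec.dim N + vec.dim (X g)"
    using vec.dim_sums_Int[OF N_sub X_sub[of g]] by linarith
  interpret B: bounded_bilinear "\<lambda>(h :: complex^('n::_)^('n::_)) x. P (h *v x)"
    unfolding bilinear_conv_bounded_bilinear[symmetric] bilinear_def
    by (auto intro!: linearI simp: P_def vec_eq_iff matrix_vector_mult_def sum.distrib
        algebra_simps scaleR_sum_right)
  have inj: "x = 0" if "x \<in> N" "P (g *v x) = 0" for x
  proof -
    obtain y where "y \<in> Y" "x = r y"
      using \<open>x \<in> N\<close> by (auto simp: N_def)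
    then show ?thesis
      using r(3)[of y] that(2) vec.linear_0[OF r(2)] by simp
  qed
  have real_sub: "subspace N"
    unfolding subspace_def scaleR_eq_smult
    using N_sub by (auto intro: vec.subspace_0 vec.subspace_add vec.subspace_scale)
  \<comment> \<open>On a finite-dimensional space injectivity yields a lower bound \<open>e\<close>,
    and it survives every perturbation of \<open>g\<close> of norm less than
    \<open>e / K\<close>.\<close>
  have "\<exists>e>0. \<forall>x\<in>N. e * norm x \<le> norm (P (g *v x))"
    using closed_subspace[OF real_sub] real_sub B.bounded_linear_right inj
    by (intro injective_imp_isometric) auto
  then obtain e where e: "e > 0" "\<And>x. x \<in> N \<Longrightarrow> e * norm x \<le> norm (P (g *v x))"
    by blast
  obtain K where K: "K > 0"
    "\<And>(h :: complex^('n::_)^('n::_)) x. norm (P (h *v x)) \<le> norm h * norm x * K"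
    using B.pos_bounded by blast
  have disj: "X h \<inter> N = {0}" if h: "dist h g < e / K" for h
  proof -
    have "x = 0" if x: "x \<in> X h" "x \<in> N" for x
    proof (rule ccontr)
      assume "x \<noteq> 0"
      have "P (h *v x) = 0"
        using x by (simp add: X_def)
      then have "P ((g - h) *v x) = P (g *v x)"
        by (simp add: B.diff_left)
      then have "e * norm x \<le> norm (g - h) * norm x * K"
        using e(2)[OF x(2)] K(2)[of "g - h" x] by simp
      then have "e \<le> norm (g - h) * K"
        using \<open>x \<noteq> 0\<close> by (simp add: mult.commute mult.left_commute)
      also have "\<dots> < e"
        using h K(1) by (simp add: dist_norm norm_minus_commute field_simps)
      finally show False by simp
    qed
    then show ?thesis
      using vec.subspace_0[OF X_sub] vec.subspace_0[OF N_sub] by blast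
  qed
  have "vec.dim (X h) \<le> vec.dim (X g)" if h: "dist h g < e / K" for h
  proof -
    have "{x + y |x y. x \<in> X h \<and> y \<in> N} \<subseteq> coord_space k"
      using N_k vec.subspace_add[OF subspace_coord_space] by (fastforce simp: X_def)
    then have "vec.dim {x + y |x y. x \<in> X h \<and> y \<in> N} \<le> vec.dim (coord_space k)"
      by (rule vec.dim_subset)
    then show ?thesis
      using disj[OF h] le vec.dim_sums_Int[OF X_sub[of h] N_sub] by simp
  qed
  moreover have "\<forall>\<^sub>F h in nhds g. dist h g < e / K"
    using e(1) K(1) unfolding eventually_nhds_metric by (intro exI[of _ "e / K"]) simp
  ultimately show ?thesis
    using rank assms by (auto elim!: eventually_mono)
qed

lemma flag_rank_semicontinuous:
  fixes g :: "complex^('n::{finite,wellorder})^('n::_)"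
  assumes "invertible g"
  shows "\<forall>\<^sub>F h in nhds g. invertible h \<longrightarrow>
    (\<forall>k l. flag_rank (frame_flag h) k l \<le> flag_rank (frame_flag g) k l)"
proof -
  have "\<forall>\<^sub>F h in nhds g. \<forall>k l. invertible h \<longrightarrow>
      flag_rank (frame_flag h) k l \<le> flag_rank (frame_flag g) k l"
    by (intro eventually_all_finite flag_rank_semicontinuous_at assms)
  then show ?thesis
    by (auto elim!: eventually_mono)
qed

section \<open>Closures of Schubert cells\<close>

lemma topspace_flag_topology:
  "topspace (flag_topology :: ('n::{finite,wellorder}) flag topology) = flags"
proof
  show "topspace flag_topology \<subseteq> (flags :: 'n flag set)"
    using openin_flag_topology[THEN iffD1, OF openin_topspace] by blast
  have "{g \<in> SL_complex. flag_act g (coord_flag id) \<in> flags} =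
      (SL_complex :: (complex^('n::_)^('n::_)) set)"
    using frame_flag_in_flags SL_complex_iff by (auto simp: frame_flag_def)
  then have "openin flag_topology (flags :: 'n flag set)"
    by (simp add: openin_flag_topology)
  then show "(flags :: 'n flag set) \<subseteq> topspace flag_topology"
    by (rule openin_subset)
qed

lemma closedin_flag_rank:
  fixes r :: "'n::{finite,wellorder} \<Rightarrow> 'n \<Rightarrow> nat"
  shows "closedin flag_topology {F \<in> flags. \<forall>k l. r k l \<le> flag_rank F k l}"
proof -
  define T where "T = {F \<in> flags. \<exists>k l. flag_rank F k l < r k l}"
  have "openin (top_of_set SL_complex) {g \<in> SL_complex. flag_act g (coord_flag id) \<in> T}"
    unfolding openin_euclidean_subtopology_iff
  proof (intro conjI ballI)
    fix g :: "complex^('n::_)^('n::_)" assume "g \<in> {g \<in> SL_complex. flag_act g (coord_flag id) \<in> T}"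
    then have g: "g \<in> SL_complex" "frame_flag g \<in> T"
      by (auto simp: frame_flag_def)
    obtain e where e: "e > 0" "\<And>h. dist h g < e \<Longrightarrow> invertible h \<Longrightarrow>
        \<forall>k l. flag_rank (frame_flag h) k l \<le> flag_rank (frame_flag g) k l"
      using flag_rank_semicontinuous[OF SL_complex_iff[OF g(1)]] unfolding eventually_nhds_metric
      by metis
    have "h \<in> {g \<in> SL_complex. flag_act g (coord_flag id) \<in> T}" if "h \<in> SL_complex" "dist h g < e" for h
    proof -
      have "frame_flag h \<in> flags"
        using that(1) by (intro frame_flag_in_flags SL_complex_iff)
      moreover have "\<exists>k l. flag_rank (frame_flag h) k l < r k l"
        using e(2)[OF that(2) SL_complex_iff[OF that(1)]] g(2) le_less_trans unfolding T_def by blast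
      ultimately show ?thesis
        using that(1) by (simp add: T_def frame_flag_def)
    qed
    then show "\<exists>e>0. \<forall>h\<in>SL_complex. dist h g < e \<longrightarrow> h \<in> {g \<in> SL_complex. flag_act g (coord_flag id) \<in> T}"
      using e(1) by blast
  qed auto
  then have "openin flag_topology T"
    by (auto simp: openin_flag_topology T_def)
  moreover have "(\<exists>k l. flag_rank F k l < r k l) \<longleftrightarrow> \<not> (\<forall>k l. r k l \<le> flag_rank F k l)" for F
    by (simp add: not_le)
  then have "T = flags - {F \<in> flags. \<forall>k l. r k l \<le> flag_rank F k l}"
    unfolding T_def by blast
  ultimately show ?thesis
    by (auto simp: closedin_def topspace_flag_topology)
qed

text \<open>On the cell equality holds, and by semicontinuity the inequalities define a closed set,
  so they pass to the closure.\<close>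

lemma schubert_variety_rank:
  fixes w :: "'n::{finite,wellorder} \<Rightarrow> 'n"
  assumes w: "w permutes UNIV" and F: "F \<in> schubert_variety w"
  shows "F \<in> flags" "rank_count w k l \<le> flag_rank F k l"
proof -
  have "schubert_variety w \<subseteq> {F \<in> flags. \<forall>k l. rank_count w k l \<le> flag_rank F k l}"
    unfolding schubert_variety_def schubert_cell_def[symmetric]
    using flag_rank_schubert_cell[OF w] schubert_cell_subset_flags[OF w]
    by (intro closure_of_minimal closedin_flag_rank) auto
  then show "F \<in> flags" "rank_count w k l \<le> flag_rank F k l"
    using F by auto
qed

lemma schubert_cell_subset_variety:
  assumes "w permutes UNIV"
  shows "schubert_cell w \<subseteq> schubert_variety w"
  unfolding schubert_variety_def schubert_cell_def[symmetric]
  using schubert_cell_subset_flags[OF assms]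
  by (intro closure_of_subset) (simp add: topspace_flag_topology)

lemma schubert_variety_cell:
  assumes "w permutes UNIV" "v permutes UNIV" "F \<in> schubert_variety w" "F \<in> schubert_cell v"
  shows "v = w \<or> card (inversions v) < card (inversions w)"
  using assms
  by (intro rank_count_mono_imp permutes_inj)
     (auto simp: flag_rank_schubert_cell[symmetric] schubert_variety_rank(2))

text \<open>The flag lies in some cell, say of \<open>v\<close>. Then \<open>v\<close> and
  \<open>w\<close> have equal rank matrices, and two distinct permutations cannot each have fewer
  inversions than the other.\<close>

lemma schubert_cellI:
  fixes w :: "'n::{finite,wellorder} \<Rightarrow> 'n"
  assumes w: "w permutes UNIV" and F: "F \<in> flags" "\<And>k l. flag_rank F k l = rank_count w k l"
  shows "F \<in> schubert_cell w"
proof -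
  obtain v where v: "v permutes UNIV" "F \<in> schubert_cell v"
    using schubert_cell_cover[OF F(1)] .
  have eq: "rank_count v k l = rank_count w k l" for k l
    using flag_rank_schubert_cell[OF v] F(2) by simp
  have "v = w"
    using rank_count_mono_imp[of v w] rank_count_mono_imp[of w v]
      permutes_inj[OF v(1)] permutes_inj[OF w] eq by auto
  then show ?thesis using v by simp
qed

lemma coord_flag_in_schubert_cell:
  assumes "w permutes UNIV"
  shows "coord_flag w \<in> schubert_cell w"
  using assms upper_mat[of 1] invertible_mat[of 1] frame_flag_perm_mat[OF assms]
  by (auto simp: schubert_cell_iff intro!: exI[of _ "mat 1"])

lemma schubert_variety_inject:
  assumes "v permutes UNIV" "w permutes UNIV" "schubert_variety v = schubert_variety w"
  shows "v = w"
proof -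
  have "coord_flag v \<in> schubert_variety w" "coord_flag w \<in> schubert_variety v"
    using assms coord_flag_in_schubert_cell schubert_cell_subset_variety by blast+
  then show ?thesis
    using schubert_variety_cell[OF assms(2,1)] schubert_variety_cell[OF assms(1,2)]
      coord_flag_in_schubert_cell assms(1,2) by fastforce
qed

text \<open>Around a point of its own, a cell is linear in the standard chart. Conjugating by
  \<open>perm_mat w\<close> turns upper triangular matrices into those that vanish at
  \<open>(i, j)\<close> whenever \<open>w j < w i\<close>. If \<open>mat 1 + X\<close> times an
  upper triangular matrix has this pattern, so has \<open>X\<close> by \<open>LU_pattern\<close>.
  Conversely, a matrix \<open>X\<close> of this pattern gives an upper triangular matrix after
  conjugating \<open>mat 1 + X\<close> back.\<close>

lemma cell_chart:
  fixes w :: "'n::{finite,wellorder} \<Rightarrow> 'n"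
  assumes w: "w permutes UNIV" and b: "upper b" "invertible b" and x: "x \<in> strictly_lower"
  shows "flag_chart (b ** perm_mat w) x \<in> schubert_cell w \<longleftrightarrow>
     (\<forall>i j. j < i \<and> w j < w i \<longrightarrow> x $ (i, j) = 0)"
proof -
  define X where "X = mat_of_vec x"
  define P where "P = (perm_mat w :: complex^('n::_)^('n::_))"
  define P' where "P' = (perm_mat (inv w) :: complex^('n::_)^('n::_))"
  have PP: "P' ** P = mat 1" "P ** P' = mat 1"
    using perm_mat_inverse[OF w] by (simp_all add: P_def P'_def)
  have X: "low_part X = X"
    using x by (auto simp: low_part_def X_def mat_of_vec_def strictly_lower_def vec_eq_iff)
  have inv: "invertible (b ** P ** (mat 1 + X))"
    using invertible_unit_low[of X] b(2) w
    by (intro invertible_mult) (simp_all add: X P_def invertible_perm_mat)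
  have conj: "(P' ** A ** P) $ i $ j = A $ w i $ w j" for A i j
    unfolding P_def P'_def by (rule perm_mat_conjugate[OF w])
  have chart: "flag_chart (b ** perm_mat w) x = frame_flag (b ** P ** (mat 1 + X))"
    by (simp add: flag_chart_eq P_def X_def)
  show ?thesis
  proof
    assume "flag_chart (b ** perm_mat w) x \<in> schubert_cell w"
    then obtain a where a: "upper a" "invertible a" "frame_flag (b ** P ** (mat 1 + X)) = frame_flag (a ** P)"
      unfolding schubert_cell_iff[OF w] chart P_def by blast
    have "invertible (a ** P)"
      using a(2) w by (simp add: invertible_mult P_def invertible_perm_mat)
    then obtain c where c: "upper c" "invertible c" "a ** P = b ** P ** (mat 1 + X) ** c"
      using frame_flag_eq_iff[OF inv] a(3) by blast
    obtain b' where b': "b ** b' = mat 1" "b' ** b = mat 1"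
      using invertibleE[OF b(2)] by metis
    have "P' ** (b' ** a) ** P = P' ** b' ** (a ** P)"
      by (simp add: matrix_mul_assoc)
    also have "\<dots> = P' ** (b' ** b) ** P ** (mat 1 + X) ** c"
      unfolding c(3) by (simp add: matrix_mul_assoc)
    also have "\<dots> = (mat 1 + X) ** c"
      by (simp add: b' PP)
    finally have eq: "(mat 1 + low_part X) ** c = P' ** (b' ** a) ** P"
      by (simp add: X)
    have up: "upper (b' ** a)"
      by (intro upper_mult a upper_inverse[OF b b'(2)])
    show "\<forall>i j. j < i \<and> w j < w i \<longrightarrow> x $ (i, j) = 0"
    proof (intro allI impI)
      fix i j assume ij: "j < i \<and> w j < w i"
      have "X $ i $ j = 0"
      proof (rule LU_pattern[OF c(1)])
        show "c $ i $ i \<noteq> 0" for i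
          using c(1,2) invertible_upper_iff by blast
        show "((mat 1 + low_part X) ** c) $ i $ j = 0" if "w j < w i" for i j
          unfolding eq conj using up that by (simp add: upper_def)
      qed (use ij in auto)
      then show "x $ (i, j) = 0"
        by (simp add: X_def mat_of_vec_def)
    qed
  next
    assume x0: "\<forall>i j. j < i \<and> w j < w i \<longrightarrow> x $ (i, j) = 0"
    define a where "a = P ** (mat 1 + X) ** P'"
    have "a $ i $ j = (mat 1 + X) $ inv w i $ inv w j" for i j
    proof -
      have "P' ** a ** P = (P' ** P) ** (mat 1 + X) ** (P' ** P)"
        unfolding a_def by (simp add: matrix_mul_assoc)
      then show ?thesis
        using conj[of a "inv w i" "inv w j"] by (simp add: PP permutes_inverses[OF w])
    qed
    moreover have "X $ inv w i $ inv w j = 0" if "j < i" for i j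
    proof (cases "inv w j < inv w i")
      case True
      then show ?thesis
        using x0 that by (simp add: X_def mat_of_vec_def permutes_inverses[OF w])
    next
      case False
      then show ?thesis
        using x by (simp add: X_def mat_of_vec_def strictly_lower_def)
    qed
    moreover have "inv w i \<noteq> inv w j" if "j < i" for i j
      using that permutes_inverses(1)[OF w] by (metis less_irrefl)
    ultimately have "upper a"
      unfolding upper_def by (simp add: mat_def)
    have "invertible a"
      unfolding a_def P_def P'_def using invertible_unit_low[of X] w
      by (intro invertible_mult invertible_perm_mat permutes_inv) (simp_all add: X)
    have "a ** P = P ** (mat 1 + X)"
      by (simp add: a_def matrix_mul_assoc[symmetric] PP)
    then have "b ** P ** (mat 1 + X) = (b ** a) ** P"
      by (simp add: matrix_mul_assoc[symmetric])
    then show "flag_chart (b ** perm_mat w) x \<in> schubert_cell w"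
      unfolding chart schubert_cell_iff[OF w] P_def
      using upper_mult[OF b(1) \<open>upper a\<close>] invertible_mult[OF b(2) \<open>invertible a\<close>] by auto
  qed
qed

section \<open>Dimensions of Schubert varieties and of the flag manifold\<close>

lemma biholomorphic_id: "biholomorphic (\<lambda>x. x) W W"
proof -
  have id: "vec_holomorphic_on (\<lambda>x. x) W"
    unfolding vec_holomorphic_on_def
    by (intro ballI exI[of _ "\<lambda>x. x"] conjI has_derivative_ident vec.linear_ident)
  have "vec_holomorphic_on (inv_into W (\<lambda>x. x)) W"
    unfolding vec_holomorphic_on_def
  proof
    fix x assume x: "x \<in> W"
    have "(inv_into W (\<lambda>x. x) has_derivative (\<lambda>x. x)) (at x within W)"
    proof (rule has_derivative_transform[OF x])
      show "inv_into W (\<lambda>x. x) y = y" if "y \<in> W" for y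
        using inv_into_f_f[of "\<lambda>x. x" W y] that by simp
    qed (rule has_derivative_ident)
    then show "\<exists>f'. (inv_into W (\<lambda>x. x) has_derivative f') (at x within W) \<and>
        Vector_Spaces.linear (*s) (*s) f'"
      using vec.linear_ident by blast
  qed
  then show ?thesis
    using id by (simp add: biholomorphic_def bij_betw_def)
qed

lemma complex_submanifold_linear:
  fixes M :: "('n::{finite,wellorder}) flag set"
  assumes "M \<subseteq> flags"
    and "\<And>p. p \<in> M \<Longrightarrow> \<exists>g\<in>SL_complex. \<exists>L. frame_flag g = p \<and> vec.subspace L \<and>
       L \<subseteq> strictly_lower \<and> vec.dim L = d \<and> (\<forall>x\<in>strictly_lower. flag_chart g x \<in> M \<longleftrightarrow> x \<in> L)"
  shows "complex_submanifold d M"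
  unfolding complex_submanifold_def
proof (intro conjI ballI assms(1))
  fix p assume "p \<in> M"
  then obtain g L where g: "g \<in> SL_complex" "frame_flag g = p" and L: "vec.subspace L"
    "L \<subseteq> strictly_lower" "vec.dim L = d" "\<forall>x\<in>strictly_lower. flag_chart g x \<in> M \<longleftrightarrow> x \<in> L"
    using assms(2) by metis
  show "\<exists>g\<in>SL_complex. \<exists>W W' L. \<exists>\<psi> :: complex^('n \<times> 'n) \<Rightarrow> complex^('n \<times> 'n).
        flag_act g (coord_flag id) = p \<and>
        openin (top_of_set strictly_lower) W \<and> 0 \<in> W \<and>
        openin (top_of_set strictly_lower) W' \<and> biholomorphic \<psi> W W' \<and>
        vec.subspace L \<and> L \<subseteq> strictly_lower \<and> vec.dim L = d \<and>
        {x \<in> W. flag_chart g x \<in> M} = {x \<in> W. \<psi> x \<in> L}"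
    using g L vec.subspace_0[OF subspace_strictly_lower] biholomorphic_id
    by (intro bexI[of _ g] exI[of _ strictly_lower] exI[of _ L] exI[of _ "\<lambda>x. x"] conjI)
       (auto simp: frame_flag_def)
qed

text \<open>Like \<open>flag_tangent\<close> this contains all upper triangular matrices; below the
  diagonal the free entries correspond to the inversions of \<open>w\<close>.\<close>

definition cell_tangent :: "('n::{finite,wellorder} \<Rightarrow> 'n) \<Rightarrow> (complex^('n \<times> 'n)) set" where
  "cell_tangent w = {x. \<forall>i j. j < i \<and> w j < w i \<longrightarrow> x $ (i, j) = 0}"

lemma subspace_cell_tangent: "vec.subspace (cell_tangent w)"
  by (simp add: cell_tangent_def vec.subspace_def)

lemma card_swap_pairs:
  "card {(i, j). j < i \<and> Q j i} = card {(i::'a::{finite,ord}, j). i < j \<and> Q i j}"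
proof -
  have "{(i, j). j < i \<and> Q j i} = prod.swap ` {(i, j). i < j \<and> Q i j}"
    by auto
  then show ?thesis
    by (simp add: card_image)
qed

lemma dim_cell_tangent:
  fixes w :: "'n::{finite,wellorder} \<Rightarrow> 'n"
  assumes "inj w"
  shows "vec.dim (strictly_lower \<inter> cell_tangent w) = card (inversions w)"
    "vec.dim (cell_tangent w) = card (inversions w) + card {(i::'n, j). i \<le> j}"
proof -
  have neq: "w i = w j \<longleftrightarrow> i = j" for i j
    using assms by (simp add: inj_eq)
  define I where "I = {(i, j). j < i \<and> w i < w j}"
  have I: "card I = card (inversions w)"
    unfolding I_def inversions_def by (rule card_swap_pairs)
  have mem: "(i, j) \<notin> I \<longleftrightarrow> i \<le> j \<or> j < i \<and> w j < w i" for i j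
    using neq[of i j] by (cases "j < i"; cases "w i < w j") (auto simp: I_def not_less)
  have all: "(\<forall>p. Q p) \<longleftrightarrow> (\<forall>i j. Q (i, j))" for Q :: "'n \<times> 'n \<Rightarrow> bool"
    by (simp add: split_paired_all)
  have "strictly_lower \<inter> cell_tangent w = {x. \<forall>p. p \<notin> I \<longrightarrow> x $ p = 0}"
    unfolding strictly_lower_def cell_tangent_def all mem by blast
  then show "vec.dim (strictly_lower \<inter> cell_tangent w) = card (inversions w)"
    by (simp only: dim_substandard_cart I)
  have mem': "(i, j) \<notin> I \<union> {(i, j). i \<le> j} \<longleftrightarrow> j < i \<and> w j < w i" for i j
    using mem[of i j] by auto
  have "cell_tangent w = {x. \<forall>p. p \<notin> I \<union> {(i, j). i \<le> j} \<longrightarrow> x $ p = 0}"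
    unfolding cell_tangent_def all mem' ..
  then have "vec.dim (cell_tangent w) = card (I \<union> {(i, j). i \<le> j})"
    by (simp only: dim_substandard_cart)
  also have "\<dots> = card I + card {(i::'n, j). i \<le> j}"
    by (intro card_Un_disjoint) (auto simp: I_def)
  finally show "vec.dim (cell_tangent w) = card (inversions w) + card {(i::'n, j). i \<le> j}"
    by (simp add: I)
qed

lemma complex_submanifold_schubert_cell:
  fixes w :: "'n::{finite,wellorder} \<Rightarrow> 'n"
  assumes w: "w permutes UNIV"
  shows "complex_submanifold (card (inversions w)) (schubert_cell w)"
proof (rule complex_submanifold_linear[OF schubert_cell_subset_flags[OF w]])
  fix p assume "p \<in> schubert_cell w"
  then obtain b where b: "upper b" "invertible b" "p = frame_flag (b ** perm_mat w)"
    unfolding schubert_cell_iff[OF w] by blast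
  have inv: "invertible (b ** perm_mat w)"
    by (intro invertible_mult b invertible_perm_mat w)
  obtain c where c: "c \<noteq> 0" "det (mat c ** (b ** perm_mat w)) = 1"
    using scale_to_det_1[OF inv] .
  define g where "g = (mat c ** b) ** perm_mat w"
  have g: "g = mat c ** (b ** perm_mat w)"
    by (simp add: g_def matrix_mul_assoc)
  have "upper (mat c ** b)" "invertible (mat c ** b)"
    using c(1) by (auto intro!: upper_mult upper_mat b invertible_mult invertible_mat)
  then have "\<forall>x\<in>strictly_lower. flag_chart g x \<in> schubert_cell w \<longleftrightarrow> x \<in> strictly_lower \<inter> cell_tangent w"
    unfolding g_def using cell_chart[OF w] by (auto simp: cell_tangent_def)
  moreover have "g \<in> SL_complex" "frame_flag g = p"
    using c frame_flag_scale[OF inv c(1)] b(3) by (simp_all add: g SL_complex_def)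
  ultimately show "\<exists>g\<in>SL_complex. \<exists>L. frame_flag g = p \<and> vec.subspace L \<and>
       L \<subseteq> strictly_lower \<and> vec.dim L = card (inversions w) \<and>
       (\<forall>x\<in>strictly_lower. flag_chart g x \<in> schubert_cell w \<longleftrightarrow> x \<in> L)"
    using dim_cell_tangent(1)[OF permutes_inj[OF w]] subspace_strictly_lower subspace_cell_tangent
    by (intro bexI[of _ g] exI[of _ "strictly_lower \<inter> cell_tangent w"])
       (auto intro: vec.subspace_inter)
qed

lemma flag_tangent_schubert_cell:
  fixes w :: "'n::{finite,wellorder} \<Rightarrow> 'n"
  assumes w: "w permutes UNIV" and b: "upper b" "invertible b"
  shows "flag_tangent (schubert_cell w) (b ** perm_mat w) \<subseteq> cell_tangent w"
proof
  define g where "g = b ** perm_mat w"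
  have g: "invertible g"
    unfolding g_def by (intro invertible_mult b invertible_perm_mat w)
  fix a assume "a \<in> flag_tangent (schubert_cell w) (b ** perm_mat w)"
  then obtain U where U: "U (0::real) = g" "(U has_vector_derivative g ** mat_of_vec a) (at 0)"
    "\<forall>\<^sub>F s in nhds 0. frame_flag (U s) \<in> schubert_cell w"
    unfolding flag_tangent_def g_def by blast
  define v where "v = vec_of_mat (low_part (mat_of_vec a))"
  obtain x where x: "x (0::real) = 0" "(x has_vector_derivative v) (at 0)"
    "\<And>s. x s \<in> strictly_lower" "\<forall>\<^sub>F s in nhds 0. frame_flag (U s) = flag_chart g (x s)"
    using chart_curve[OF g U(1,2)] unfolding v_def by blast
  have "\<forall>\<^sub>F s in nhds 0. x s \<in> cell_tangent w"
    using U(3) x(4)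
  proof eventually_elim
    case (elim s)
    then show ?case
      using cell_chart[OF w b x(3)] by (simp add: g_def cell_tangent_def)
  qed
  then have "v \<in> cell_tangent w"
    by (rule tangent_in_subspace[OF subspace_cell_tangent x(2)])
  then show "a \<in> cell_tangent w"
    by (auto simp: cell_tangent_def v_def vec_of_mat_def low_part_def mat_of_vec_def)
qed

lemma complex_dim_eqI:
  assumes "complex_submanifold d M" "M \<noteq> {}" "M \<subseteq> A"
    and "\<And>M' d'. M' \<noteq> {} \<Longrightarrow> M' \<subseteq> A \<Longrightarrow> complex_submanifold d' M' \<Longrightarrow> d' \<le> d"
  shows "complex_dim A = d"
  unfolding complex_dim_def
proof (rule Max_eqI)
  have "{d. \<exists>M. M \<noteq> {} \<and> M \<subseteq> A \<and> complex_submanifold d M} \<subseteq> {..d}"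
    using assms(4) by blast
  then show "finite {d. \<exists>M. M \<noteq> {} \<and> M \<subseteq> A \<and> complex_submanifold d M}"
    by (rule finite_subset) simp
qed (use assms in blast)+

text \<open>A submanifold \<open>M\<close> of the closure may run through several cells, so it is
  examined at a flag \<open>p\<close> with the least sum of ranks. Near \<open>p\<close> no rank
  exceeds that of \<open>p\<close>, and minimality forces equality, so \<open>M\<close> stays in the
  cell of \<open>p\<close> there. Its dimension is then bounded by the inversions belonging to that
  cell, hence by those of \<open>w\<close>.\<close>

lemma complex_dim_schubert_variety:
  fixes w :: "'n::{finite,wellorder} \<Rightarrow> 'n"
  assumes w: "w permutes UNIV"
  shows "complex_dim (schubert_variety w) = card (inversions w)"
proof (rule complex_dim_eqI[OF complex_submanifold_schubert_cell[OF w]])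
  show "schubert_cell w \<noteq> {}"
    using coord_flag_in_schubert_cell[OF w] by blast
  show "schubert_cell w \<subseteq> schubert_variety w"
    by (rule schubert_cell_subset_variety[OF w])
  fix M d assume M: "M \<noteq> {}" "M \<subseteq> schubert_variety w" "complex_submanifold d M"
  define R where "R = (\<lambda>F::'n flag. \<Sum>k\<in>UNIV. \<Sum>l\<in>UNIV. flag_rank F k l)"
  obtain p where p: "p \<in> M" "\<And>q. q \<in> M \<Longrightarrow> R p \<le> R q"
    using M(1) ex_has_least_nat[of "\<lambda>q. q \<in> M" _ R] by blast
  have "p \<in> flags"
    using schubert_variety_rank(1)[OF w] M(2) p(1) by blast
  then obtain v where v: "v permutes UNIV" "p \<in> schubert_cell v"
    using schubert_cell_cover by blast
  then obtain b where b: "upper b" "invertible b" "p = frame_flag (b ** perm_mat v)"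
    unfolding schubert_cell_iff[OF v(1)] by blast
  define g where "g = b ** perm_mat v"
  have g: "invertible g"
    unfolding g_def by (intro invertible_mult b invertible_perm_mat v)
  have gp: "frame_flag g = p"
    by (simp add: b(3) g_def)
  have "\<forall>\<^sub>F h in nhds g. invertible h"
  proof -
    have "isCont (\<lambda>h :: complex^('n::_)^('n::_). det h) g"
      unfolding det_def by (intro continuous_intros)
    then have "((\<lambda>h. det h) \<longlongrightarrow> det g) (nhds g)"
      unfolding isCont_def by (rule tendsto_at_iff_tendsto_nhds[THEN iffD1])
    then have "\<forall>\<^sub>F h in nhds g. det h \<noteq> 0"
      using tendsto_imp_eventually_ne g invertible_det_nz by blast
    then show ?thesis
      by (simp add: invertible_det_nz)
  qed
  then have "\<forall>\<^sub>F h in nhds g. frame_flag h \<in> M \<longrightarrow> frame_flag h \<in> schubert_cell v"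
    using flag_rank_semicontinuous[OF g]
  proof eventually_elim
    case (elim h)
    show ?case
    proof
      assume hM: "frame_flag h \<in> M"
      have le: "flag_rank (frame_flag h) k l \<le> flag_rank p k l" for k l
        using elim gp by auto
      have "flag_rank (frame_flag h) k l = flag_rank p k l" for k l
      proof (rule ccontr)
        assume "flag_rank (frame_flag h) k l \<noteq> flag_rank p k l"
        then have lt: "flag_rank (frame_flag h) k l < flag_rank p k l"
          using le[of k l] by simp
        have "R (frame_flag h) < R p"
          unfolding R_def
        proof (rule sum_strict_mono_ex1)
          show "\<forall>k\<in>UNIV. (\<Sum>l\<in>UNIV. flag_rank (frame_flag h) k l) \<le> (\<Sum>l\<in>UNIV. flag_rank p k l)"
            using le by (auto intro: sum_mono)
          have "(\<Sum>l\<in>UNIV. flag_rank (frame_flag h) k l) < (\<Sum>l\<in>UNIV. flag_rank p k l)"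
            using le lt by (intro sum_strict_mono_ex1) auto
          then show "\<exists>k\<in>UNIV. (\<Sum>l\<in>UNIV. flag_rank (frame_flag h) k l) < (\<Sum>l\<in>UNIV. flag_rank p k l)"
            by blast
        qed simp
        then show False
          using p(2)[OF hM] by simp
      qed
      then show "frame_flag h \<in> schubert_cell v"
        using flag_rank_schubert_cell[OF v] hM M(2) schubert_variety_rank(1)[OF w]
        by (intro schubert_cellI[OF v(1)]) auto
    qed
  qed
  then have "flag_tangent M g \<subseteq> flag_tangent (schubert_cell v) g"
    by (rule flag_tangent_mono)
  also have "\<dots> \<subseteq> cell_tangent v"
    unfolding g_def by (rule flag_tangent_schubert_cell[OF v(1) b(1,2)])
  finally have "vec.dim (flag_tangent M g) \<le> vec.dim (cell_tangent v)"
    by (rule vec.dim_subset)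
  then have "d \<le> card (inversions v)"
    using submanifold_tangent_frame(2)[OF M(3) g] gp p(1)
      dim_cell_tangent(2)[OF permutes_inj[OF v(1)]] by simp
  also have "\<dots> \<le> card (inversions w)"
    using schubert_variety_cell[OF w v(1) subsetD[OF M(2) p(1)] v(2)]
    by (elim disjE) simp_all
  finally show "d \<le> card (inversions w)" .
qed

text \<open>The upper triangular pairs are kept as a summand instead of evaluating n(n-1)/2, because
  they also appear in every dimension of a \<open>flag_tangent\<close> and cancel in the
  end.\<close>

lemma complex_dim_flags:
  "complex_dim (flags :: ('n::{finite,wellorder}) flag set) + card {(i::'n, j). i \<le> j} =
     CARD('n \<times> 'n)"
proof -
  define N where "N = card {(i::'n, j). j < i}"
  have eq: "strictly_lower = {x::complex^('n \<times> 'n). \<forall>p. p \<notin> {(i, j). j < i} \<longrightarrow> x $ p = 0}"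
    by (auto simp: strictly_lower_def not_less)
  have dim: "vec.dim (strictly_lower :: (complex^('n \<times> 'n)) set) = N"
    unfolding eq N_def by (rule dim_substandard_cart)
  have un: "{(i::'n, j). j < i} \<union> {(i, j). i \<le> j} = UNIV"
    by (auto simp: not_less)
  have card: "N + card {(i::'n, j). i \<le> j} = CARD('n \<times> 'n)"
    unfolding N_def un[symmetric] by (rule card_Un_disjoint[symmetric]) auto
  have sub: "complex_submanifold N (flags :: 'n flag set)"
  proof (rule complex_submanifold_linear)
    fix p :: "'n flag" assume "p \<in> flags"
    then obtain g where g: "g \<in> SL_complex" "p = frame_flag g"
      using flag_has_SL_frame by blast
    have "flag_chart g x \<in> flags" if "x \<in> strictly_lower" for x
    proof -
      have "low_part (mat_of_vec x) = mat_of_vec x"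
        using that by (auto simp: low_part_def mat_of_vec_def strictly_lower_def vec_eq_iff)
      then have "invertible (mat 1 + mat_of_vec x)"
        using invertible_unit_low[of "mat_of_vec x"] by simp
      then show ?thesis
        unfolding flag_chart_eq using SL_complex_iff[OF g(1)]
        by (intro frame_flag_in_flags invertible_mult)
    qed
    then show "\<exists>g\<in>SL_complex. \<exists>L. frame_flag g = p \<and> vec.subspace L \<and>
       L \<subseteq> strictly_lower \<and> vec.dim L = N \<and> (\<forall>x\<in>strictly_lower. flag_chart g x \<in> flags \<longleftrightarrow> x \<in> L)"
      using g subspace_strictly_lower dim by (intro bexI[of _ g] exI[of _ strictly_lower]) auto
  qed simp
  have "coord_flag id \<in> (flags :: 'n flag set)"
    using schubert_cell_subset_flags[OF permutes_id] coord_flag_in_schubert_cell[OF permutes_id] by blast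
  then have "complex_dim (flags :: 'n flag set) = N"
  proof (intro complex_dim_eqI[OF sub])
    fix M :: "'n flag set" and d assume M: "M \<noteq> {}" "M \<subseteq> flags" "complex_submanifold d M"
    then obtain p where "p \<in> M" by blast
    then obtain g where "vec.dim (flag_tangent M g) = d + card {(i::'n, j). i \<le> j}"
      using submanifold_tangent[OF M(3)] by metis
    moreover have "vec.dim (flag_tangent M g) \<le> CARD('n \<times> 'n)"
      using vec.dim_subset[of "flag_tangent M g" UNIV] unfolding vec_dim_card by blast
    ultimately show "d \<le> N"
      using card by simp
  qed auto
  then show ?thesis
    using card by simp
qed

section \<open>Complex orbits of the rotation group\<close>

definition adjoint_mat :: "complex^'n^'m \<Rightarrow> complex^'m^'n" where
  "adjoint_mat A = (\<chi> i j. cnj (A $ j $ i))"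

lemma adjoint_mat_mult: "adjoint_mat (A ** B) = adjoint_mat B ** adjoint_mat A"
  by (simp add: adjoint_mat_def vec_eq_iff matrix_mult_component mult.commute)

lemma transpose_component: "transpose A $ i $ j = A $ j $ i"
  by (simp add: transpose_def)

lemma bounded_linear_adjoint_mat: "bounded_linear adjoint_mat"
  and bounded_linear_transpose: "bounded_linear (transpose :: complex^'n^'m \<Rightarrow> complex^'m^'n)"
  unfolding linear_conv_bounded_linear[symmetric]
  by (auto intro!: linearI simp: vec_eq_iff adjoint_mat_def transpose_def)

lemma matrix_mult_minus: "(A :: complex^'n^'m) ** (- B) = - (A ** (B :: complex^'p^'n))"
  and matrix_minus_mult: "(- A) ** B = - (A ** B)"
  by (simp_all add: vec_eq_iff matrix_mult_component sum_negf)

lemma map_of_real_mult: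
  "map_matrix complex_of_real (A ** B) = map_matrix complex_of_real A ** map_matrix complex_of_real B"
  by (simp add: vec_eq_iff matrix_matrix_mult_def)

lemma map_of_real_mat_1: "map_matrix complex_of_real (mat 1) = mat 1"
  by (simp add: vec_eq_iff mat_def)

lemma SO_realD:
  assumes "k \<in> SO_real"
  shows "transpose k ** k = mat 1" "adjoint_mat k ** k = mat 1" "invertible k"
proof -
  obtain A where A: "transpose A ** A = mat 1" "k = map_matrix complex_of_real A"
    using assms by (auto simp: SO_real_def rotation_matrix_def orthogonal_matrix)
  have "transpose k = map_matrix complex_of_real (transpose A)"
    "adjoint_mat k = map_matrix complex_of_real (transpose A)"
    by (simp_all add: A(2) vec_eq_iff transpose_def adjoint_mat_def)
  then show "transpose k ** k = mat 1" "adjoint_mat k ** k = mat 1"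
    using A by (simp_all add: map_of_real_mult[symmetric] map_of_real_mat_1)
  then show "invertible k"
    using invertible_left_inverse by blast
qed

lemma orbit_SO_frame: "orbit SO_real (frame_flag U) = {frame_flag (k ** U) |k. k \<in> SO_real}"
  by (auto simp: orbit_def frame_flag_mult)

lemma mat_1_in_SO_real: "mat 1 \<in> SO_real"
  unfolding SO_real_def
  by (rule image_eqI[of _ _ "mat 1"])
     (simp_all add: map_of_real_mat_1 rotation_matrix_def orthogonal_matrix)

lemma frame_flag_in_orbit: "frame_flag U \<in> orbit SO_real (frame_flag U)"
  unfolding orbit_SO_frame using mat_1_in_SO_real by (intro CollectI exI[of _ "mat 1"]) simp

text \<open>Gram-Schmidt along the flag: take a unit vector in each member orthogonal to the
  preceding one.\<close>

lemma unitary_frame: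
  fixes F :: "('n::{finite,wellorder}) flag"
  assumes F: "F \<in> flags"
  obtains U where "adjoint_mat U ** U = mat 1" "frame_flag U = F"
proof -
  define herm :: "complex^('n::_) \<Rightarrow> complex^('n::_) \<Rightarrow> complex"
    where "herm = (\<lambda>x y. \<Sum>k\<in>UNIV. cnj (x $ k) * y $ k)"
  have Re_herm: "Re (herm x y) = inner x y" for x y
    by (simp add: herm_def inner_vec_def inner_complex_def)
  have herm_scale: "herm (c *s x) (d *s y) = cnj c * d * herm x y" for c d x y
    by (simp add: herm_def sum_distrib_left algebra_simps)
  have herm_cnj: "cnj (herm x y) = herm y x" for x y
    by (simp add: herm_def mult.commute)
  have herm_self: "herm x x = complex_of_real ((norm x)\<^sup>2)" for x
  proof (rule complex_eqI)
    show "Re (herm x x) = Re (complex_of_real ((norm x)\<^sup>2))"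
      by (simp add: Re_herm power2_norm_eq_inner)
    have "Im (herm x x) = 0"
      using herm_cnj[of x x] by (metis complex_cnj_cancel_iff Im_complex_of_real Reals_cnj_iff complex_is_Real_iff)
    then show "Im (herm x x) = Im (complex_of_real ((norm x)\<^sup>2))"
      by simp
  qed
  have subsp: "vec.subspace (F i)" for i
    using F by (auto simp: flags_def)
  have "\<exists>u. u \<in> F i \<and> herm u u = 1 \<and> (\<forall>y\<in>flag_below F i. herm y u = 0)" for i
  proof -
    have real: "subspace V" if "vec.subspace V" for V :: "(complex^('n::_)) set"
      unfolding subspace_def scaleR_eq_smult
      using that by (auto intro: vec.subspace_0 vec.subspace_add vec.subspace_scale)
    have "flag_below F i \<noteq> F i"
      using flag_below(3)[OF F, of i] by auto
    then have "span (flag_below F i) \<subset> span (F i)"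
      using flag_below(2)[OF F, of i] real[OF subsp] real[OF flag_below(1)[OF F]]
      by (simp add: span_eq_iff[THEN iffD2] psubset_eq)
    then obtain x where x: "x \<noteq> 0" "x \<in> span (F i)" "\<And>y. y \<in> span (flag_below F i) \<Longrightarrow> orthogonal x y"
      using orthogonal_to_subspace_exists_gen by blast
    have xF: "x \<in> F i"
      using x(2) real[OF subsp] by (simp add: span_eq_iff[THEN iffD2])
    have "herm y x = 0" if y: "y \<in> flag_below F i" for y
    proof (rule complex_eqI)
      have 0: "Re (herm z x) = 0" if "z \<in> flag_below F i" for z
        using x(3)[OF span_base[OF that]] by (simp add: Re_herm orthogonal_def inner_commute)
      show "Re (herm y x) = Re 0"
        using 0[OF y] by simp
      \<comment> \<open>Real orthogonality controls only the real part of the Hermitian product; the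
        imaginary part is the real part taken with \<i>y, which lies in the same complex
        subspace.\<close>
      have "\<i> *s y \<in> flag_below F i"
        by (intro vec.subspace_scale flag_below(1)[OF F] y)
      then have "Re (herm (\<i> *s y) (1 *s x)) = 0"
        using 0 by simp
      then show "Im (herm y x) = Im 0"
        unfolding herm_scale by simp
    qed
    then have y0: "herm y (c *s x) = 0" if "y \<in> flag_below F i" for y c
      using herm_scale[of 1 y c x] that by simp
    define c where "c = complex_of_real (1 / norm x)"
    have "herm (c *s x) (c *s x) = cnj c * c * complex_of_real ((norm x)\<^sup>2)"
      by (simp only: herm_scale herm_self[of x])
    also have "\<dots> = 1"
      unfolding c_def using x(1) by (simp add: power2_eq_square)
    finally have "herm (c *s x) (c *s x) = 1" .
    then show ?thesis
      using y0 xF vec.subspace_scale[OF subsp] by (intro exI[of _ "c *s x"]) auto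
  qed
  then obtain u where u: "\<And>i. u i \<in> F i" "\<And>i. herm (u i) (u i) = 1"
    "\<And>i y. y \<in> flag_below F i \<Longrightarrow> herm y (u i) = 0"
    by metis
  have "u i \<notin> flag_below F i" for i
    using u(2)[of i] u(3)[of "u i" i] by auto
  define U :: "complex^('n::_)^('n::_)" where "U = (\<chi> a i. u i $ a)"
  have "frame_flag U = F"
    unfolding U_def by (rule frame_of_flag(2)[OF F u(1)]) fact
  moreover have "adjoint_mat U ** U = mat 1"
  proof -
    have lt: "herm (u i) (u j) = 0" if "i < j" for i j
      using u(3)[of "u i" j] u(1)[of i] that by (auto simp: flag_below_def)
    have "herm (u i) (u j) = (if i = j then 1 else 0)" for i j
      using lt[of i j] lt[of j i] u(2) herm_cnj[of "u j" "u i"] by (cases i j rule: linorder_cases) auto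
    moreover have "(adjoint_mat U ** U) $ i $ j = herm (u i) (u j)" for i j
      by (simp add: matrix_mult_component adjoint_mat_def U_def herm_def)
    ultimately show ?thesis
      by (simp add: vec_eq_iff mat_def)
  qed
  ultimately show ?thesis using that by blast
qed

text \<open>Scaling the rows of \<open>b\<close> by the conjugates of its diagonal entries, and the
  columns of its adjoint by their inverses, turns the Cholesky form
  \<open>adjoint_mat b ** b\<close> into an LU factorization, which is unique. Multiplying the rows
  of \<open>b\<close> by phases leaves this upper factor unchanged.\<close>

lemma gram_LU:
  fixes b Z :: "complex^('n::{finite,wellorder})^('n::_)"
  assumes b: "upper b" "invertible b"
    and eq: "adjoint_mat b ** b = (mat 1 + low_part Z) ** (mat 1 + up_part Z)"
  shows "(mat 1 + up_part Z) $ k $ l = cnj (b $ k $ k) * b $ k $ l"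
proof -
  define C :: "complex^('n::_)^('n::_)" where "C = (\<chi> i j. cnj (b $ i $ i) * b $ i $ j)"
  define X :: "complex^('n::_)^('n::_)" where "X = (\<chi> i j. cnj (b $ j $ i) / cnj (b $ j $ j))"
  have diag: "b $ i $ i \<noteq> 0" for i
    using b invertible_upper_iff by blast
  have X: "(mat 1 + low_part X) $ i $ j = cnj (b $ j $ i) / cnj (b $ j $ j)" for i j
    using b(1) diag[of j] by (cases i j rule: linorder_cases) (auto simp: mat_def low_part_def X_def upper_def)
  have "((mat 1 + low_part X) ** C) $ i $ j = (adjoint_mat b ** b) $ i $ j" for i j
    unfolding matrix_mult_component X using diag by (simp add: C_def adjoint_mat_def)
  then have "(mat 1 + low_part X) ** C = (mat 1 + low_part Z) ** (mat 1 + up_part Z)"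
    by (simp add: vec_eq_iff eq)
  moreover have "upper C"
    using b(1) by (simp add: upper_def C_def)
  moreover have "upper (mat 1 + up_part Z)"
    by (intro upper_add upper_mat upper_up_part)
  moreover have "C $ i $ i \<noteq> 0" for i
    using diag by (simp add: C_def)
  ultimately have "C = mat 1 + up_part Z"
    using LU_unique(1) by blast
  then have "(mat 1 + up_part Z) $ k $ l = C $ k $ l"
    by simp
  then show ?thesis
    by (simp add: C_def)
qed

section \<open>Plane rotations and their generators\<close>

definition skew_unit :: "'n \<Rightarrow> 'n \<Rightarrow> complex^'n^'n" where
  "skew_unit p q = (\<chi> i j. (if i = p \<and> j = q then 1 else 0) - (if i = q \<and> j = p then 1 else 0))"

lemma skew_unit_swap: "skew_unit p q $ j $ i = - skew_unit p q $ i $ j"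
  unfolding skew_unit_def vec_lambda_beta minus_diff_eq by (simp only: conj_commute)

lemma skew_unit_real: "cnj (skew_unit p q $ i $ j) = skew_unit p q $ i $ j"
  unfolding skew_unit_def vec_lambda_beta
  by (simp only: complex_cnj_diff if_distrib[of cnj] complex_cnj_one complex_cnj_zero)

definition plane_rotation :: "'n::finite \<Rightarrow> 'n \<Rightarrow> real \<Rightarrow> real^'n^'n" where
  "plane_rotation p q t = (\<chi> i j. (if j = i then 1 else 0)
     + (if i = p then (if j = p then cos t - 1 else 0) + (if j = q then sin t else 0) else 0)
     + (if i = q then (if j = q then cos t - 1 else 0) - (if j = p then sin t else 0) else 0))"

lemma plane_rotation_mult_component:
  fixes B :: "real^'m^'n"
  assumes "p \<noteq> q"
  shows "(plane_rotation p q t ** B) $ i $ j = B $ i $ j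
     + (if i = p then (cos t - 1) * B $ p $ j + sin t * B $ q $ j else 0)
     + (if i = q then (cos t - 1) * B $ q $ j - sin t * B $ p $ j else 0)"
proof -
  have delta: "(\<Sum>k\<in>UNIV. (if k = a then c else 0) * B $ k $ j) = c * B $ a $ j" for a c
    by (simp add: if_distrib[where f = "\<lambda>x. x * _"] cong: if_cong)
  show ?thesis
    unfolding matrix_matrix_mult_def plane_rotation_def vec_lambda_beta using assms
    by (cases "i = p"; cases "i = q")
       (simp_all add: distrib_right left_diff_distrib sum.distrib sum_subtractf delta)
qed

lemma plane_rotation_mult:
  assumes "p \<noteq> q"
  shows "plane_rotation p q s ** plane_rotation p q t = plane_rotation p q (s + t)"
proof -
  have "(plane_rotation p q s ** plane_rotation p q t) $ i $ j = plane_rotation p q (s + t) $ i $ j" for i j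
    unfolding plane_rotation_mult_component[OF assms] using assms
    by (auto simp: plane_rotation_def cos_add sin_add algebra_simps)
  then show ?thesis by (simp add: vec_eq_iff)
qed

lemma rotation_matrix_plane_rotation:
  assumes "p \<noteq> q"
  shows "rotation_matrix (plane_rotation p q t)"
proof -
  have orth: "orthogonal_matrix (plane_rotation p q t)" for t
  proof -
    have "transpose (plane_rotation p q t) = plane_rotation p q (- t)"
      using assms by (auto simp: vec_eq_iff transpose_def plane_rotation_def)
    then have "transpose (plane_rotation p q t) ** plane_rotation p q t = plane_rotation p q 0"
      by (simp add: plane_rotation_mult[OF assms])
    also have "\<dots> = mat 1"
      by (auto simp: vec_eq_iff plane_rotation_def mat_def)
    finally show ?thesis
      by (simp add: orthogonal_matrix)
  qed
  \<comment> \<open>A rotation is the square of the rotation by half the angle, so its determinant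
    is the square of 1 or -1.\<close>
  have "det (plane_rotation p q t) = det (plane_rotation p q (t / 2)) * det (plane_rotation p q (t / 2))"
    using plane_rotation_mult[OF assms, of "t / 2" "t / 2"] by (simp add: det_mul[symmetric])
  also have "\<dots> = 1"
    using det_orthogonal_matrix[OF orth[of "t / 2"]] by auto
  finally show ?thesis
    using orth by (simp add: rotation_matrix_def)
qed

lemma plane_rotation_derivative:
  assumes "p \<noteq> q"
  shows "((\<lambda>t. map_matrix complex_of_real (plane_rotation p q t)) has_vector_derivative skew_unit p q) (at 0)"
proof -
  define D :: "complex^'a^'a" where
    "D = (\<chi> i j. (if i = p \<and> j = p then 1 else 0) + (if i = q \<and> j = q then 1 else 0))"
  have eq: "map_matrix complex_of_real (plane_rotation p q t) =
      mat 1 + (sin t *\<^sub>R skew_unit p q + (cos t - 1) *\<^sub>R D)" for t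
    unfolding vec_eq_iff vector_add_component vector_scaleR_component using assms
    by (auto simp: plane_rotation_def mat_def skew_unit_def D_def scaleR_conv_of_real)
  have sin: "(sin has_field_derivative 1) (at (0::real))"
    by (auto intro!: derivative_eq_intros)
  have cos: "((\<lambda>t. cos t - 1) has_field_derivative 0) (at (0::real))"
    by (auto intro!: derivative_eq_intros)
  have "((\<lambda>t. mat 1 + (sin t *\<^sub>R skew_unit p q + (cos t - 1) *\<^sub>R D)) has_vector_derivative
      (0 + ((sin 0 *\<^sub>R 0 + 1 *\<^sub>R skew_unit p q) + ((cos 0 - 1) *\<^sub>R 0 + 0 *\<^sub>R D)))) (at 0)"
    by (intro has_vector_derivative_add has_vector_derivative_const
        has_vector_derivative_scaleR sin cos)
  then show ?thesis
    by (simp add: eq)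
qed

text \<open>The rotated frames have velocity \<open>skew_unit p q ** U\<close>; since
  \<open>flag_tangent\<close> splits off the frame on the left, a conjugate of the generator
  appears.\<close>

lemma rotation_tangent:
  fixes U V :: "complex^('n::{finite,wellorder})^('n::_)"
  assumes V: "U ** V = mat 1" and pq: "p \<noteq> q"
  shows "vec_of_mat (V ** skew_unit p q ** U) \<in> flag_tangent (orbit SO_real (frame_flag U)) U"
proof -
  define R where "R = (\<lambda>t. map_matrix complex_of_real (plane_rotation p q t))"
  have R: "R t \<in> SO_real" for t
    using rotation_matrix_plane_rotation[OF pq] by (simp add: SO_real_def R_def)
  have "((\<lambda>t. R t ** U) has_vector_derivative skew_unit p q ** U) (at 0)"
    unfolding R_def by (intro mult_const_has_vector_derivative plane_rotation_derivative pq)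
  moreover have "skew_unit p q ** U = U ** mat_of_vec (vec_of_mat (V ** skew_unit p q ** U))"
    by (simp add: matrix_mul_assoc V)
  moreover have "R 0 ** U = U"
  proof -
    have "R 0 = mat 1"
      by (auto simp: R_def vec_eq_iff plane_rotation_def mat_def)
    then show ?thesis by simp
  qed
  moreover have "frame_flag (R t ** U) \<in> orbit SO_real (frame_flag U)" for t
    using R unfolding orbit_SO_frame by blast
  ultimately show ?thesis
    unfolding flag_tangent_def by (intro CollectI exI[of _ "\<lambda>t. R t ** U"]) simp
qed

section \<open>Gram matrices along curves in a complex orbit\<close>

lemma entry_has_vector_derivative:
  fixes A :: "real \<Rightarrow> complex^'n^'m"
  assumes "(A has_vector_derivative A') (at x)"
  shows "((\<lambda>s. A s $ i $ j) has_vector_derivative A' $ i $ j) (at x)"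
  by (intro bounded_linear.has_vector_derivative[OF bounded_linear_vec_nth] assms)

lemma sum_sum_delta:
  fixes c :: "'c::comm_monoid_add"
  shows "(\<Sum>q\<in>UNIV. \<Sum>p\<in>UNIV. if q = (a::'a::finite) then if p = (b::'b::finite) then c else 0 else 0) = c"
proof -
  have "(\<Sum>p\<in>UNIV. if q = a then if p = b then c else 0 else 0) = (if q = a then c else 0)" for q
    by (cases "q = a") simp_all
  then show ?thesis by simp
qed

text \<open>An upper triangular \<open>b\<close> mixes into the entry \<open>(r, l)\<close> only
  entries \<open>(p, q)\<close> of \<open>S\<close> with \<open>p \<le> r\<close> and
  \<open>q \<le> l\<close>, and of these only \<open>(r, k)\<close> may be nonzero.\<close>

lemma transpose_quadratic_entry:
  fixes b S :: "complex^('n::{finite,wellorder})^('n::_)"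
  assumes "upper b" "\<And>p q. p \<le> r \<Longrightarrow> q \<le> l \<Longrightarrow> (p, q) \<noteq> (r, k) \<Longrightarrow> S $ p $ q = 0"
  shows "(transpose b ** S ** b) $ r $ l = b $ r $ r * S $ r $ k * b $ k $ l"
proof -
  define e where "e = b $ r $ r * S $ r $ k * b $ k $ l"
  have t: "b $ p $ r * S $ p $ q * b $ q $ l = (if q = k then if p = r then e else 0 else 0)" for p q
  proof (cases "p \<le> r \<and> q \<le> l")
    case True
    then show ?thesis using assms(2)[of p q] by (auto simp: e_def)
  next
    case False
    then have "b $ p $ r = 0 \<or> b $ q $ l = 0"
      using assms(1) by (auto simp: upper_def not_le)
    then show ?thesis
      by (auto simp: e_def)
  qed
  have "(transpose b ** S ** b) $ r $ l = (\<Sum>q\<in>UNIV. \<Sum>p\<in>UNIV. b $ p $ r * S $ p $ q * b $ q $ l)"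
    by (simp add: matrix_mult_component transpose_def sum_distrib_right)
  also have "\<dots> = e"
    unfolding t by (rule sum_sum_delta)
  finally show ?thesis
    by (simp add: e_def)
qed

text \<open>
  Along a curve in a complex \<open>SO(n)\<close>-orbit with velocity \<open>\<i>X\<close>, where \<open>X\<close> is a real skew matrix,
  write the frame as \<open>k U b\<close>. The Hermitian Gram matrix \<open>b\<^sup>* b\<close> determines \<open>b\<close> up to phases,
  and its LU factor is differentiable.
\<close>

lemma complex_orbit_curve:
  fixes U :: "complex^('n::{finite,wellorder})^('n::_)" and p q :: 'n
  assumes U: "adjoint_mat U ** U = mat 1" and pq: "p \<noteq> q"
    and sub: "complex_submanifold d (orbit SO_real (frame_flag U))"
  obtains c S where "c (0::real) = mat 1" "S 0 = transpose U ** U"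
    "(c has_vector_derivative up_part (mat (2 * \<i>) ** (adjoint_mat U ** skew_unit p q ** U))) (at 0)"
    "(S has_vector_derivative 0) (at 0)"
    "\<forall>\<^sub>F s in nhds 0. \<exists>b. upper b \<and> (\<forall>k l. c s $ k $ l = cnj (b $ k $ k) * b $ k $ l) \<and>
        S s = transpose b ** (transpose U ** U) ** b"
proof -
  define M where "M = orbit SO_real (frame_flag U)"
  define X :: "complex^('n::_)^('n::_)" where "X = skew_unit p q"
  define G where "G = adjoint_mat U ** X ** U"
  have inv: "invertible U"
    using U invertible_left_inverse by blast
  have U': "U ** adjoint_mat U = mat 1"
    using U matrix_left_right_inverse by blast
  have UM: "frame_flag U \<in> M"
    unfolding M_def by (rule frame_flag_in_orbit)
  have "vec.subspace (flag_tangent M U)"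
    using submanifold_tangent_frame(1)[OF sub[folded M_def] inv UM] .
  then have "\<i> *s vec_of_mat G \<in> flag_tangent M U"
    using rotation_tangent[OF U' pq] unfolding G_def X_def M_def by (rule vec.subspace_scale)
  then obtain V where V: "V (0::real) = U"
    "(V has_vector_derivative U ** mat_of_vec (\<i> *s vec_of_mat G)) (at 0)"
    "\<forall>\<^sub>F s in nhds 0. frame_flag (V s) \<in> M"
    unfolding flag_tangent_def by blast
  have "mat_of_vec (\<i> *s vec_of_mat G) = mat \<i> ** G"
    by (simp add: vec_eq_iff mat_of_vec_def vec_of_mat_def mat_mult_component)
  also have "U ** \<dots> = (U ** adjoint_mat U) ** (mat \<i> ** X) ** U"
    unfolding G_def
    by (simp only: matrix_mul_assoc mat_mult_commute[of "\<i>" U] mat_mult_commute[of "\<i>" "adjoint_mat U"])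
  finally have V': "(V has_vector_derivative (mat \<i> ** X) ** U) (at 0)"
    using V(2) by (simp add: U')
  \<comment> \<open>The matrix \<i>X is Hermitian and still skew-symmetric. Hence the two terms of
    the product rule add up for the Hermitian Gram matrix \<open>H\<close> and cancel for the
    symmetric one \<open>S\<close>.\<close>
  have X_skew: "transpose (mat \<i> ** X) = - (mat \<i> ** X)" "adjoint_mat (mat \<i> ** X) = mat \<i> ** X"
  proof -
    have skew: "X $ j $ i = - X $ i $ j" and real: "cnj (X $ i $ j) = X $ i $ j" for i j
      unfolding X_def by (rule skew_unit_swap skew_unit_real)+
    have "transpose (mat \<i> ** X) $ i $ j = (- (mat \<i> ** X)) $ i $ j"
      "adjoint_mat (mat \<i> ** X) $ i $ j = (mat \<i> ** X) $ i $ j" for i j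
      using skew[of j i] real[of j i]
      unfolding adjoint_mat_def transpose_def vec_lambda_beta vector_uminus_component mat_mult_component
        complex_cnj_mult complex_cnj_i
      by simp_all
    then show "transpose (mat \<i> ** X) = - (mat \<i> ** X)" "adjoint_mat (mat \<i> ** X) = mat \<i> ** X"
      by (simp_all only: vec_eq_iff) blast+
  qed
  define H where "H = (\<lambda>s. adjoint_mat (V s) ** V s)"
  define S where "S = (\<lambda>s. transpose (V s) ** V s)"
  have "(H has_vector_derivative (adjoint_mat (V 0) ** (mat \<i> ** X ** U)
      + adjoint_mat (mat \<i> ** X ** U) ** V 0)) (at 0)"
    unfolding H_def
    by (intro matrix_mult_has_vector_derivative V'
        bounded_linear.has_vector_derivative[OF bounded_linear_adjoint_mat])
  also have "adjoint_mat (V 0) ** (mat \<i> ** X ** U) + adjoint_mat (mat \<i> ** X ** U) ** V 0 =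
      mat (2 * \<i>) ** G"
  proof -
    have "adjoint_mat U ** (mat \<i> ** X ** U) = mat \<i> ** G"
      by (simp add: G_def matrix_mul_assoc mat_mult_commute[of "\<i>" "adjoint_mat U"])
    moreover have "adjoint_mat (mat \<i> ** X ** U) ** U = mat \<i> ** G"
      unfolding adjoint_mat_mult[of "mat \<i> ** X"] X_skew
      by (simp add: G_def matrix_mul_assoc mat_mult_commute[of "\<i>" "adjoint_mat U"])
    ultimately show ?thesis
      by (simp add: V(1) vec_eq_iff mat_mult_component)
  qed
  finally have H': "(H has_vector_derivative mat (2 * \<i>) ** G) (at 0)" .
  have "(S has_vector_derivative (transpose (V 0) ** (mat \<i> ** X ** U)
      + transpose (mat \<i> ** X ** U) ** V 0)) (at 0)"
    unfolding S_def
    by (intro matrix_mult_has_vector_derivative V'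
        bounded_linear.has_vector_derivative[OF bounded_linear_transpose])
  also have "transpose (V 0) ** (mat \<i> ** X ** U) + transpose (mat \<i> ** X ** U) ** V 0 = 0"
    unfolding matrix_transpose_mul[of "mat \<i> ** X"] X_skew
    by (simp add: V(1) matrix_mult_minus matrix_minus_mult matrix_mul_assoc)
  finally have S': "(S has_vector_derivative 0) (at 0)" .
  have H0: "H 0 = mat 1"
    by (simp add: H_def V(1) U)
  obtain Z where Z: "Z 0 = 0" "(Z has_vector_derivative mat (2 * \<i>) ** G) (at 0)"
    "\<forall>\<^sub>F s in nhds 0. H s = (mat 1 + low_part (Z s)) ** (mat 1 + up_part (Z s)) \<and>
        invertible (mat 1 + up_part (Z s))"
    using LU_curve[OF H0 H'] by blast
  define c where "c = (\<lambda>s. mat 1 + up_part (Z s))"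
  have "(c has_vector_derivative (0 + up_part (mat (2 * \<i>) ** G))) (at 0)"
    unfolding c_def
    by (intro has_vector_derivative_add has_vector_derivative_const
        bounded_linear.has_vector_derivative[OF bounded_linear_up_part] Z(2))
  then have c': "(c has_vector_derivative up_part (mat (2 * \<i>) ** G)) (at 0)"
    by simp
  have "\<forall>\<^sub>F s in nhds 0. invertible (V s)"
    using has_vector_derivative_continuous[OF V(2)] V(1) inv by (intro eventually_invertible) auto
  then have "\<forall>\<^sub>F s in nhds 0. \<exists>b. upper b \<and> (\<forall>k l. c s $ k $ l = cnj (b $ k $ k) * b $ k $ l) \<and>
        S s = transpose b ** (transpose U ** U) ** b"
    using V(3) Z(3)
  proof eventually_elim
    case (elim s)
    obtain k where k: "k \<in> SO_real" "frame_flag (V s) = frame_flag (k ** U)"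
      using elim(2) unfolding M_def orbit_SO_frame by blast
    have "invertible (k ** U)"
      by (intro invertible_mult SO_realD k inv)
    then obtain b where b: "upper b" "invertible b" "V s = k ** U ** b"
      using frame_flag_eq_iff[of "k ** U" "V s"] k(2) elim(1) by metis
    have "H s = adjoint_mat b ** (adjoint_mat U ** (adjoint_mat k ** k) ** U) ** b"
      unfolding H_def b(3) by (simp add: adjoint_mat_mult matrix_mul_assoc)
    then have Hb: "H s = adjoint_mat b ** b"
      by (simp add: SO_realD[OF k(1)] U)
    have "S s = transpose b ** (transpose U ** (transpose k ** k) ** U) ** b"
      unfolding S_def b(3) by (simp add: matrix_transpose_mul matrix_mul_assoc)
    then have "S s = transpose b ** (transpose U ** U) ** b"
      by (simp add: SO_realD[OF k(1)])
    moreover have "c s $ k $ l = cnj (b $ k $ k) * b $ k $ l" for k l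
      unfolding c_def by (rule gram_LU[OF b(1,2)]) (use Hb elim(3) in simp)
    ultimately show ?case
      using b(1) by blast
  qed
  then show ?thesis
    using that[of c S] c' S' by (simp add: G_def X_def c_def Z(1) S_def V(1))
qed

lemma skew_gram_component:
  "(adjoint_mat U ** skew_unit p q ** U) $ a $ b =
     cnj (U $ p $ a) * U $ q $ b - cnj (U $ q $ a) * U $ p $ b"
proof -
  have delta: "(\<Sum>k\<in>UNIV. f k * (if k = x \<and> P then 1 else 0)) = (if P then f x else 0)" for f :: "'b \<Rightarrow> complex" and x P
    by (cases P) (simp_all add: if_distrib[where f = "\<lambda>y. _ * y"] cong: if_cong)
  have "(adjoint_mat U ** skew_unit p q) $ a $ j =
      (if j = q then cnj (U $ p $ a) else 0) - (if j = p then cnj (U $ q $ a) else 0)" for j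
    unfolding matrix_mult_component skew_unit_def adjoint_mat_def vec_lambda_beta
    by (simp only: right_diff_distrib sum_subtractf delta)
  moreover have "(\<Sum>k\<in>UNIV. (if k = x then y else 0) * f k) = y * f x" for f :: "'b \<Rightarrow> complex" and x y
    by (simp add: if_distrib[where f = "\<lambda>y. y * _"] cong: if_cong)
  ultimately show ?thesis
    by (simp add: matrix_mult_component[of "adjoint_mat U ** skew_unit p q"] left_diff_distrib sum_subtractf)
qed

text \<open>The leading entry of the symmetric Gram matrix is multiplied by
  \<open>b $ r $ r * b $ k $ k\<close>. Only the moduli of these factors are known, so its squared
  modulus is compared with \<open>c $ r $ r * c $ k $ k\<close>: the former has derivative zero, the
  latter is governed by the diagonal entries \<open>r\<close> and \<open>k\<close> of
  \<open>G\<close>.\<close>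

lemma complex_orbit_diag:
  fixes U :: "complex^('n::{finite,wellorder})^('n::_)"
  defines "S \<equiv> transpose U ** U"
  assumes U: "adjoint_mat U ** U = mat 1"
    and sub: "complex_submanifold d (orbit SO_real (frame_flag U))"
    and S0: "\<And>p q. p \<le> r \<Longrightarrow> q \<le> k \<Longrightarrow> (p, q) \<noteq> (r, k) \<Longrightarrow> S $ p $ q = 0"
    and nz: "S $ r $ k \<noteq> 0"
  shows "cnj (U $ p $ r) * U $ q $ r - cnj (U $ q $ r) * U $ p $ r
    + (cnj (U $ p $ k) * U $ q $ k - cnj (U $ q $ k) * U $ p $ k) = 0"
proof (cases "p = q")
  case False
  define G where "G = adjoint_mat U ** skew_unit p q ** U"
  obtain c \<Sigma> where c0: "c (0::real) = mat 1" and \<Sigma>0: "\<Sigma> 0 = S"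
    and c': "(c has_vector_derivative up_part (mat (2 * \<i>) ** G)) (at 0)"
    and \<Sigma>': "(\<Sigma> has_vector_derivative 0) (at 0)"
    and ev: "\<forall>\<^sub>F s in nhds 0. \<exists>b. upper b \<and> (\<forall>k l. c s $ k $ l = cnj (b $ k $ k) * b $ k $ l) \<and>
        \<Sigma> s = transpose b ** S ** b"
    by (rule complex_orbit_curve[OF U False sub, folded G_def S_def]) (rule that)
  define K where "K = S $ r $ k * cnj (S $ r $ k)"
  have "((\<lambda>s. \<Sigma> s $ r $ k * cnj (\<Sigma> s $ r $ k)) has_vector_derivative
      (\<Sigma> 0 $ r $ k * cnj ((0 :: complex^('n::_)^('n::_)) $ r $ k) + (0 :: complex^('n::_)^('n::_)) $ r $ k * cnj (\<Sigma> 0 $ r $ k))) (at 0)"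
    by (intro has_vector_derivative_mult entry_has_vector_derivative \<Sigma>'
        bounded_linear.has_vector_derivative[OF bounded_linear_cnj])
  then have d0: "((\<lambda>s. \<Sigma> s $ r $ k * cnj (\<Sigma> s $ r $ k)) has_vector_derivative 0) (at 0)"
    by simp
  have "((\<lambda>s. c s $ r $ r * c s $ k $ k * K) has_vector_derivative
      (c 0 $ r $ r * c 0 $ k $ k * 0 + (c 0 $ r $ r * up_part (mat (2 * \<i>) ** G) $ k $ k
         + up_part (mat (2 * \<i>) ** G) $ r $ r * c 0 $ k $ k) * K)) (at 0)"
    by (intro has_vector_derivative_mult entry_has_vector_derivative c' has_vector_derivative_const)
  then have d1: "((\<lambda>s. c s $ r $ r * c s $ k $ k * K) has_vector_derivative
      (2 * \<i> * (G $ k $ k + G $ r $ r)) * K) (at 0)"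
    by (simp add: c0 mat_def[of 1] up_part_def mat_mult_component algebra_simps)
  have "\<forall>\<^sub>F s in nhds 0. c s $ r $ r * c s $ k $ k * K = \<Sigma> s $ r $ k * cnj (\<Sigma> s $ r $ k)"
    using ev
  proof eventually_elim
    case (elim s)
    then obtain b where b: "upper b" "\<And>k l. c s $ k $ l = cnj (b $ k $ k) * b $ k $ l"
      "\<Sigma> s = transpose b ** S ** b" by blast
    have "\<Sigma> s $ r $ k = b $ r $ r * S $ r $ k * b $ k $ k"
      unfolding b(3) using S0 by (rule transpose_quadratic_entry[OF b(1)])
    then show ?case
      by (simp add: b(2) K_def)
  qed
  from has_vector_derivative_eventually[OF d1 this] d0
  have "(2 * \<i> * (G $ k $ k + G $ r $ r)) * K = 0"
    by (rule vector_derivative_unique_at)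
  then have "G $ k $ k + G $ r $ r = 0"
    using nz by (simp add: K_def)
  then show ?thesis
    by (simp add: G_def skew_gram_component add.commute)
qed simp

text \<open>Both \<open>\<Sigma> $ r $ k * c $ k $ l\<close> and
  \<open>\<Sigma> $ r $ l * c $ k $ k\<close> equal \<open>b $ r $ r * S $ r $ k * b $ k $ l\<close>
  times the squared modulus of \<open>b $ k $ k\<close>. The second product vanishes to first order,
  so the first gives \<open>G $ k $ l = 0\<close>.\<close>

lemma complex_orbit_offdiag:
  fixes U :: "complex^('n::{finite,wellorder})^('n::_)"
  defines "S \<equiv> transpose U ** U"
  assumes U: "adjoint_mat U ** U = mat 1"
    and sub: "complex_submanifold d (orbit SO_real (frame_flag U))"
    and S0: "\<And>p q. p \<le> r \<Longrightarrow> q \<le> l \<Longrightarrow> (p, q) \<noteq> (r, k) \<Longrightarrow> S $ p $ q = 0"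
    and nz: "S $ r $ k \<noteq> 0" and kl: "k < l"
  shows "cnj (U $ p $ k) * U $ q $ l = cnj (U $ q $ k) * U $ p $ l"
proof (cases "p = q")
  case False
  define G where "G = adjoint_mat U ** skew_unit p q ** U"
  obtain c \<Sigma> where c0: "c (0::real) = mat 1" and \<Sigma>0: "\<Sigma> 0 = S"
    and c': "(c has_vector_derivative up_part (mat (2 * \<i>) ** G)) (at 0)"
    and \<Sigma>': "(\<Sigma> has_vector_derivative 0) (at 0)"
    and ev: "\<forall>\<^sub>F s in nhds 0. \<exists>b. upper b \<and> (\<forall>k l. c s $ k $ l = cnj (b $ k $ k) * b $ k $ l) \<and>
        \<Sigma> s = transpose b ** S ** b"
    by (rule complex_orbit_curve[OF U False sub, folded G_def S_def]) (rule that)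
  have "((\<lambda>s. \<Sigma> s $ r $ l * c s $ k $ k) has_vector_derivative
      (\<Sigma> 0 $ r $ l * up_part (mat (2 * \<i>) ** G) $ k $ k
        + (0 :: complex^('n::_)^('n::_)) $ r $ l * c 0 $ k $ k)) (at 0)"
    by (intro has_vector_derivative_mult entry_has_vector_derivative c' \<Sigma>')
  moreover have "S $ r $ l = 0"
    using S0[of r l] kl by simp
  ultimately have d0: "((\<lambda>s. \<Sigma> s $ r $ l * c s $ k $ k) has_vector_derivative 0) (at 0)"
    by (simp add: \<Sigma>0)
  have "((\<lambda>s. \<Sigma> s $ r $ k * c s $ k $ l) has_vector_derivative
      (\<Sigma> 0 $ r $ k * up_part (mat (2 * \<i>) ** G) $ k $ l
        + (0 :: complex^('n::_)^('n::_)) $ r $ k * c 0 $ k $ l)) (at 0)"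
    by (intro has_vector_derivative_mult entry_has_vector_derivative c' \<Sigma>')
  then have d1: "((\<lambda>s. \<Sigma> s $ r $ k * c s $ k $ l) has_vector_derivative
      (S $ r $ k * (2 * \<i> * G $ k $ l))) (at 0)"
    using less_imp_le[OF kl] by (simp add: \<Sigma>0 up_part_def mat_mult_component)
  have "\<forall>\<^sub>F s in nhds 0. \<Sigma> s $ r $ k * c s $ k $ l = \<Sigma> s $ r $ l * c s $ k $ k"
    using ev
  proof eventually_elim
    case (elim s)
    then obtain b where b: "upper b" "\<And>k l. c s $ k $ l = cnj (b $ k $ k) * b $ k $ l"
      "\<Sigma> s = transpose b ** S ** b" by blast
    have "\<Sigma> s $ r $ k = b $ r $ r * S $ r $ k * b $ k $ k"
      unfolding b(3) using S0 kl by (intro transpose_quadratic_entry[OF b(1)]) auto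
    moreover have "\<Sigma> s $ r $ l = b $ r $ r * S $ r $ k * b $ k $ l"
      unfolding b(3) using S0 by (rule transpose_quadratic_entry[OF b(1)])
    ultimately show ?case
      by (simp add: b(2))
  qed
  from has_vector_derivative_eventually[OF d1 this] d0
  have "S $ r $ k * (2 * \<i> * G $ k $ l) = 0"
    by (rule vector_derivative_unique_at)
  then have "G $ k $ l = 0"
    using nz by simp
  then show ?thesis
    by (simp add: G_def skew_gram_component)
qed simp

definition isotropic_frame :: "complex^('n::{finite,wellorder})^('n::_) \<Rightarrow> bool" where
  "isotropic_frame U \<longleftrightarrow> adjoint_mat U ** U = mat 1 \<and>
     (\<forall>i j. j \<noteq> opp i \<longrightarrow> (transpose U ** U) $ i $ j = 0)"

text \<open>
  Let \<open>k\<close> be the first index with \<open>S $ r $ k \<noteq> 0\<close>. Evaluating the previous two conditions for all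
  rotations shows that column \<open>r\<close> and, if \<open>k < opp r\<close>, also column \<open>opp r\<close> of \<open>U\<close> is a multiple of
  the conjugate of column \<open>k\<close>, which contradicts their orthogonality.
\<close>

theorem complex_orbit_isotropic:
  fixes U :: "complex^('n::{finite,wellorder})^('n::_)"
  assumes U: "adjoint_mat U ** U = mat 1"
    and sub: "complex_submanifold d (orbit SO_real (frame_flag U))"
  shows "isotropic_frame U"
proof -
  define S where "S = transpose U ** U"
  have U': "U ** adjoint_mat U = mat 1"
    using U matrix_left_right_inverse by blast
  have S: "S $ i $ j = (\<Sum>x\<in>UNIV. U $ x $ i * U $ x $ j)" for i j
    by (simp add: S_def matrix_mult_component transpose_def)
  have S_sym: "S $ i $ j = S $ j $ i" for i j
    by (simp add: S mult.commute)
  have orth: "(\<Sum>x\<in>UNIV. cnj (U $ x $ i) * U $ x $ j) = (if i = j then 1 else 0)" for i j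
    using arg_cong[OF U, of "\<lambda>A. A $ i $ j"] by (simp add: matrix_mult_component adjoint_mat_def mat_def)
  \<comment> \<open>The columns of \<open>U\<close> form an orthonormal basis, and the conjugated
    row \<open>i\<close> of \<open>S\<close> expands the conjugate of column \<open>i\<close> in
    it.\<close>
  have cnj_U: "cnj (U $ x $ i) = (\<Sum>q\<in>UNIV. U $ x $ q * cnj (S $ i $ q))" for x i
  proof -
    have "adjoint_mat (transpose U) = (U ** adjoint_mat U) ** adjoint_mat (transpose U)"
      by (simp add: U')
    also have "\<dots> = U ** adjoint_mat S"
      by (simp add: S_def adjoint_mat_mult matrix_mul_assoc)
    finally show ?thesis
      by (simp add: vec_eq_iff adjoint_mat_def transpose_def matrix_mult_component)
  qed
  have U_nz: "\<exists>x. U $ x $ i \<noteq> 0" for i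
    using orth[of i i] by (rule_tac ccontr) simp
  have single: "cnj (U $ x $ i) = U $ x $ k * cnj (S $ i $ k)" if "\<And>q. q \<noteq> k \<Longrightarrow> S $ i $ q = 0" for i k x
  proof -
    have "(\<Sum>q\<in>UNIV. U $ x $ q * cnj (S $ i $ q)) = (\<Sum>q\<in>{k}. U $ x $ q * cnj (S $ i $ q))"
      using that by (intro sum.mono_neutral_right) auto
    then show ?thesis
      unfolding cnj_U by simp
  qed
  \<comment> \<open>If row \<open>i\<close> of \<open>S\<close> is supported at \<open>k\<close>,
    then column \<open>k\<close> is a multiple of the conjugate of column \<open>i\<close>, so its
    symmetric product with any other column \<open>j\<close> is a Hermitian product of distinct
    columns.\<close>
  have row_zero: "S $ k $ j = 0" if k: "\<And>q. q \<noteq> k \<Longrightarrow> S $ i $ q = 0" and "i \<noteq> j" for i k j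
  proof -
    have "cnj (S $ i $ k) \<noteq> 0"
      using single[OF k] U_nz[of i] by (metis complex_cnj_zero_iff mult_eq_0_iff)
    moreover have "cnj (S $ i $ k) * S $ k $ j = (\<Sum>x\<in>UNIV. U $ x $ k * cnj (S $ i $ k) * U $ x $ j)"
      unfolding S[of k j] sum_distrib_left by (simp add: mult_ac)
    then have "cnj (S $ i $ k) * S $ k $ j = (\<Sum>x\<in>UNIV. cnj (U $ x $ i) * U $ x $ j)"
      by (simp only: single[OF k])
    ultimately show ?thesis
      using orth[of i j] \<open>i \<noteq> j\<close> by simp
  qed
  have rows: "S $ r $ q = 0" if "r < opp r" "q \<noteq> opp r" for r q
    using that
  proof (induction r arbitrary: q rule: less_induct)
    case (less r)
    have earlier: "S $ p $ q = 0" if "p < r" "q \<noteq> opp p" for p q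
    proof -
      have "r < opp p"
        using less.prems(1) that(1) by (metis less_trans opp_less_iff)
      then have "p < opp p" using that(1) by (rule less_trans[rotated])
      then show ?thesis
        using less.IH that by blast
    qed
    have "\<exists>k. S $ r $ k \<noteq> 0"
    proof (rule ccontr)
      assume "\<nexists>k. S $ r $ k \<noteq> 0"
      then have "cnj (U $ x $ r) = 0" for x
        unfolding cnj_U by simp
      then show False
        using U_nz[of r] by simp
    qed
    define k where "k = (LEAST k. S $ r $ k \<noteq> 0)"
    have k: "S $ r $ k \<noteq> 0"
      unfolding k_def using \<open>\<exists>k. S $ r $ k \<noteq> 0\<close> by (rule LeastI_ex)
    have least: "S $ r $ q = 0" if "q < k" for q
      using not_less_Least[of q "\<lambda>k. S $ r $ k \<noteq> 0"] that unfolding k_def by blast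
    \<comment> \<open>A later \<open>k\<close> would be the partner of an earlier row
      \<open>opp k\<close>, which is already known to be supported at \<open>k\<close>; then
      \<open>row_zero\<close> kills the entry \<open>(k, r)\<close>.\<close>
    have "k \<le> opp r"
    proof (rule ccontr)
      assume "\<not> k \<le> opp r"
      then have lt: "opp k < r"
        by (simp add: not_le opp_less_commute)
      have "S $ k $ r = 0"
      proof (rule row_zero)
        show "S $ opp k $ q = 0" if "q \<noteq> k" for q
          using earlier[OF lt] that by simp
        show "opp k \<noteq> r"
          using lt by simp
      qed
      then show False
        using k S_sym by simp
    qed
    have "k = opp r"
    proof (rule ccontr)
      assume "k \<noteq> opp r"
      with \<open>k \<le> opp r\<close> have lt: "k < opp r" by simp
      have S0: "S $ p $ q = 0" if "p < r" "q \<le> opp r" for p q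
      proof -
        have "q < opp p"
          using that by (metis le_less_trans opp_less_iff)
        then show ?thesis
          using earlier[OF that(1), of q] by auto
      qed
      have diag: "cnj (U $ p $ r) * U $ q $ r - cnj (U $ q $ r) * U $ p $ r
          + (cnj (U $ p $ k) * U $ q $ k - cnj (U $ q $ k) * U $ p $ k) = 0" for p q
      proof (rule complex_orbit_diag[OF U sub])
        show "(transpose U ** U) $ p $ q = 0" if "p \<le> r" "q \<le> k" "(p, q) \<noteq> (r, k)" for p q
        proof (cases "p = r")
          case True
          then show ?thesis using that least[of q] by (simp add: S_def)
        next
          case False
          then show ?thesis using that lt S0[of p q] by (simp add: S_def)
        qed
        show "(transpose U ** U) $ r $ k \<noteq> 0"
          using k by (simp add: S_def)
      qed
      \<comment> \<open>Multiply the relation \<open>diag\<close> by \<open>U $ p $ r\<close> and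
        sum over \<open>p\<close>: orthonormality and the definition of \<open>S\<close> evaluate
        all four sums.\<close>
      have Ur: "U $ q $ r = S $ r $ k * cnj (U $ q $ k)" for q
      proof -
        have "0 = (\<Sum>p\<in>UNIV. U $ p $ r * (cnj (U $ p $ r) * U $ q $ r - cnj (U $ q $ r) * U $ p $ r
          + (cnj (U $ p $ k) * U $ q $ k - cnj (U $ q $ k) * U $ p $ k)))"
          by (simp only: diag mult_zero_right sum.neutral_const)
        also have "\<dots> = (\<Sum>p\<in>UNIV. cnj (U $ p $ r) * U $ p $ r) * U $ q $ r
            - (\<Sum>p\<in>UNIV. U $ p $ r * U $ p $ r) * cnj (U $ q $ r)
            + ((\<Sum>p\<in>UNIV. cnj (U $ p $ k) * U $ p $ r) * U $ q $ k
            - (\<Sum>p\<in>UNIV. U $ p $ r * U $ p $ k) * cnj (U $ q $ k))"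
          by (simp only: sum_distrib_right sum_subtractf[symmetric] sum.distrib[symmetric])
             (rule sum.cong[OF refl], simp add: algebra_simps)
        also have "\<dots> = U $ q $ r - S $ r $ r * cnj (U $ q $ r)
            + ((if k = r then U $ q $ k else 0) - S $ r $ k * cnj (U $ q $ k))"
          by (simp add: orth S)
        finally have eq: "U $ q $ r - S $ r $ r * cnj (U $ q $ r)
            + ((if k = r then U $ q $ k else 0) - S $ r $ k * cnj (U $ q $ k)) = 0"
          by simp
        show ?thesis
        proof (cases "k = r")
          case True
          then show ?thesis using eq by simp
        next
          case False
          have "r < k \<or> k < r" using False by auto
          then have "S $ r $ r = 0"
          proof
            assume "k < r"
            moreover have "r \<noteq> opp k"
              using \<open>k < r\<close> less.prems(1) by (metis less_asym opp_opp)
            ultimately have "S $ k $ r = 0"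
              by (rule earlier)
            then show ?thesis
              using k S_sym by simp
          qed (rule least)
          then show ?thesis using eq False by simp
        qed
      qed
      have row_r: "S $ r $ q = 0" if "q \<noteq> k" for q
      proof -
        have "S $ r $ q = S $ r $ k * (\<Sum>x\<in>UNIV. cnj (U $ x $ k) * U $ x $ q)"
          unfolding S[of r q] by (subst Ur) (simp add: sum_distrib_left mult_ac)
        then show ?thesis
          using orth[of k q] that by simp
      qed
      define l where "l = opp r"
      have off: "cnj (U $ p $ k) * U $ q $ l = cnj (U $ q $ k) * U $ p $ l" for p q
      proof (rule complex_orbit_offdiag[OF U sub])
        show "(transpose U ** U) $ p $ q = 0" if "p \<le> r" "q \<le> l" "(p, q) \<noteq> (r, k)" for p q
        proof (cases "p = r")
          case True
          then show ?thesis using that row_r[of q] by (simp add: S_def)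
        next
          case False
          then show ?thesis using that S0[of p q] by (simp add: S_def l_def)
        qed
        show "(transpose U ** U) $ r $ k \<noteq> 0"
          using k by (simp add: S_def)
        show "k < l" using lt by (simp add: l_def)
      qed
      have Ul: "U $ q $ l = S $ k $ l * cnj (U $ q $ k)" for q
      proof -
        have "U $ q $ l = (\<Sum>p\<in>UNIV. cnj (U $ p $ k) * U $ p $ k) * U $ q $ l"
          by (simp add: orth)
        also have "\<dots> = (\<Sum>p\<in>UNIV. U $ p $ k * (cnj (U $ p $ k) * U $ q $ l))"
          unfolding sum_distrib_right by (simp only: mult_ac)
        also have "\<dots> = (\<Sum>p\<in>UNIV. U $ p $ k * (cnj (U $ q $ k) * U $ p $ l))"
          by (simp only: off)
        also have "\<dots> = S $ k $ l * cnj (U $ q $ k)"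
          unfolding S sum_distrib_right by (simp only: mult_ac)
        finally show ?thesis .
      qed
      have "S $ k $ l \<noteq> 0"
        using U_nz[of l] Ul by auto
      moreover have "S $ k $ l = 0"
      proof (rule row_zero[of k r])
        show "r \<noteq> l" using less.prems(1) by (auto simp: l_def)
      qed (rule row_r)
      ultimately show False by contradiction
    qed
    show ?case
    proof (rule ccontr)
      assume nz: "S $ r $ q \<noteq> 0"
      then have "opp r < q"
        using least[of q] less.prems(2) \<open>k = opp r\<close> by (metis linorder_neqE)
      then have lt: "opp q < r"
        by (simp add: opp_less_commute)
      have "S $ q $ r = 0"
      proof (rule row_zero)
        show "S $ opp q $ x = 0" if "x \<noteq> q" for x
          using earlier[OF lt] that by simp
        show "opp q \<noteq> r"
          using lt by simp
      qed
      then show False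
        using nz S_sym by simp
    qed
  qed
  have "S $ i $ j = 0" if "j \<noteq> opp i" for i j
  proof -
    \<comment> \<open>Rows of the upper half follow from their partners by \<open>row_zero\<close>.
      If both indices are fixed by \<open>opp\<close>, they coincide.\<close>
    consider "i < opp i" | "j < opp j" | "opp i < i" | "opp j < j" | "opp i = i" "opp j = j"
      by (metis linorder_neqE)
    then show ?thesis
    proof cases
      case 1
      then show ?thesis using that by (rule rows)
    next
      case 2
      then have "S $ j $ i = 0" using that by (intro rows) auto
      then show ?thesis using S_sym by simp
    next
      case 3
      have "S $ i $ j = 0"
      proof (rule row_zero)
        show "S $ opp i $ q = 0" if "q \<noteq> i" for q
          using 3 that by (intro rows) auto
        show "opp i \<noteq> j" using that by simp
      qed
      then show ?thesis .
    next
      case 4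
      have "S $ j $ i = 0"
      proof (rule row_zero)
        show "S $ opp j $ q = 0" if "q \<noteq> j" for q
          using 4 that by (intro rows) auto
        show "opp j \<noteq> i" using that by auto
      qed
      then show ?thesis using S_sym by simp
    next
      case 5
      have "pos i = pos j"
        using pos_opp[of i] pos_opp[of j] pos_le_card[of i] pos_le_card[of j]
      unfolding 5 by linarith
      then show ?thesis
        using that 5 by simp
    qed
  qed
  then show ?thesis
    using U by (simp add: isotropic_frame_def S_def)
qed

section \<open>The base cycle and the cells that meet it\<close>

text \<open>The Gram matrix \<open>S\<close> is unitary because \<open>U\<close> and its transpose
  are, so the single nonzero entry in each of its rows has modulus one.\<close>

lemma isotropic_frame_gram:
  fixes U :: "complex^('n::{finite,wellorder})^('n::_)"
  assumes "isotropic_frame U"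
  defines "S \<equiv> transpose U ** U"
  shows "j \<noteq> opp i \<Longrightarrow> S $ i $ j = 0" "S $ i $ opp i = S $ opp i $ i"
    "cnj (S $ i $ opp i) * S $ i $ opp i = 1"
    "U ** adjoint_mat U = mat 1" "adjoint_mat U ** U = mat 1" "invertible U"
proof -
  show UU: "adjoint_mat U ** U = mat 1" and S0: "j \<noteq> opp i \<Longrightarrow> S $ i $ j = 0" for i j
    using assms(1) by (auto simp: isotropic_frame_def S_def)
  then show UU': "U ** adjoint_mat U = mat 1"
    using matrix_left_right_inverse by blast
  show "invertible U"
    using UU invertible_left_inverse by blast
  have sym: "S $ i $ j = S $ j $ i" for i j
    by (simp add: S_def matrix_mult_component transpose_def mult.commute)
  then show "S $ i $ opp i = S $ opp i $ i" .
  have "adjoint_mat S ** S = adjoint_mat U ** (transpose (adjoint_mat U) ** transpose U) ** U"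
  proof -
    have "adjoint_mat (transpose U) = transpose (adjoint_mat U)"
      by (simp add: vec_eq_iff adjoint_mat_def transpose_def)
    then show ?thesis
      by (simp add: S_def adjoint_mat_mult matrix_mul_assoc)
  qed
  also have "\<dots> = mat 1"
    by (simp add: matrix_transpose_mul[symmetric] UU' UU)
  finally have "adjoint_mat S ** S = mat 1" .
  then have "(adjoint_mat S ** S) $ i $ i = 1"
    by (simp add: mat_def)
  then have "(\<Sum>x\<in>UNIV. cnj (S $ x $ i) * S $ x $ i) = 1"
    by (simp add: matrix_mult_component adjoint_mat_def)
  also have "(\<Sum>x\<in>UNIV. cnj (S $ x $ i) * S $ x $ i) = (\<Sum>x\<in>{opp i}. cnj (S $ x $ i) * S $ x $ i)"
    using S0 sym by (intro sum.mono_neutral_right) auto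
  finally show "cnj (S $ i $ opp i) * S $ i $ opp i = 1"
    by (simp add: sym)
qed

text \<open>The linearization of the isotropy equations at a frame with Gram matrix
  \<open>S\<close>: a frame velocity \<open>V ** A\<close> changes \<open>transpose V ** V\<close>
  by \<open>transpose A ** S + S ** A\<close>.\<close>

definition isotropic_tangent :: "complex^('n::{finite,wellorder})^('n::_) \<Rightarrow> (complex^('n \<times> 'n)) set" where
  "isotropic_tangent S = {a. \<forall>i j. j < opp i \<longrightarrow>
     (transpose (mat_of_vec a) ** S + S ** mat_of_vec a) $ i $ j = 0}"

text \<open>Frames over the orbit are \<open>k ** U ** b\<close> with \<open>k\<close> preserving
  the form and \<open>b\<close> upper triangular, and \<open>b\<close> mixes only entries of the
  original Gram matrix that lie strictly on the same side of the antidiagonal.\<close>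

lemma orbit_gram_zero:
  fixes U V :: "complex^('n::{finite,wellorder})^('n::_)"
  assumes U: "isotropic_frame U" and V: "invertible V" "frame_flag V \<in> orbit SO_real (frame_flag U)"
    and ij: "j < opp i"
  shows "(transpose V ** V) $ i $ j = 0"
proof -
  obtain k where k: "k \<in> SO_real" "frame_flag V = frame_flag (k ** U)"
    using V(2) unfolding orbit_SO_frame by blast
  have "invertible (k ** U)"
    by (intro invertible_mult SO_realD k isotropic_frame_gram(6) U)
  then obtain b where b: "upper b" "V = k ** U ** b"
    using frame_flag_eq_iff[of "k ** U" V] k(2) V(1) by metis
  have "transpose V ** V = transpose b ** (transpose U ** (transpose k ** k) ** U) ** b"
    unfolding b(2) by (simp add: matrix_transpose_mul matrix_mul_assoc)
  also have "\<dots> = transpose b ** (transpose U ** U) ** b"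
    by (simp add: SO_realD[OF k(1)])
  finally have eq: "transpose V ** V = transpose b ** (transpose U ** U) ** b" .
  have "(transpose U ** U) $ p $ q = 0" if "p \<le> i" "q \<le> j" for p q
  proof (rule isotropic_frame_gram(1)[OF U])
    have "j < opp p"
      using that(1) ij by (metis less_le_trans opp_le_iff)
    then show "q \<noteq> opp p" using that(2) by auto
  qed
  then show ?thesis
    unfolding eq by (subst transpose_quadratic_entry[OF b(1), where k = j]) auto
qed

text \<open>The bound is proved at every frame \<open>k ** U\<close>, since a submanifold contained
  in the orbit may have to be examined at any point.\<close>

lemma flag_tangent_orbit_subset:
  fixes U :: "complex^('n::{finite,wellorder})^('n::_)"
  assumes U: "isotropic_frame U" and k: "k \<in> SO_real"
  shows "flag_tangent (orbit SO_real (frame_flag U)) (k ** U) \<subseteq> isotropic_tangent (transpose U ** U)"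
proof
  fix a assume "a \<in> flag_tangent (orbit SO_real (frame_flag U)) (k ** U)"
  then obtain W where W: "W (0::real) = k ** U" "(W has_vector_derivative k ** U ** mat_of_vec a) (at 0)"
    "\<forall>\<^sub>F s in nhds 0. frame_flag (W s) \<in> orbit SO_real (frame_flag U)"
    unfolding flag_tangent_def by blast
  define S where "S = transpose U ** U"
  have kk: "transpose k ** k = mat 1"
    by (rule SO_realD[OF k])
  have "((\<lambda>s. transpose (W s) ** W s) has_vector_derivative
      (transpose (W 0) ** (k ** U ** mat_of_vec a) + transpose (k ** U ** mat_of_vec a) ** W 0)) (at 0)"
    by (intro matrix_mult_has_vector_derivative W(2)
        bounded_linear.has_vector_derivative[OF bounded_linear_transpose])
  also have "transpose (W 0) ** (k ** U ** mat_of_vec a) + transpose (k ** U ** mat_of_vec a) ** W 0 =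
      transpose U ** (transpose k ** k) ** U ** mat_of_vec a
        + transpose (mat_of_vec a) ** transpose U ** (transpose k ** k) ** U"
    by (simp add: W(1) matrix_transpose_mul matrix_mul_assoc)
  also have "\<dots> = transpose (mat_of_vec a) ** S + S ** mat_of_vec a"
    by (simp add: kk S_def matrix_mul_assoc add.commute)
  finally have d: "((\<lambda>s. transpose (W s) ** W s) has_vector_derivative
      (transpose (mat_of_vec a) ** S + S ** mat_of_vec a)) (at 0)" .
  define P where "P = {x :: complex^('n \<times> 'n). \<forall>i j. j < opp i \<longrightarrow> x $ (i, j) = 0}"
  have P: "vec.subspace P"
    by (simp add: P_def vec.subspace_def)
  have "invertible (W 0)"
    unfolding W(1) by (intro invertible_mult SO_realD k isotropic_frame_gram(6) U)
  then have "\<forall>\<^sub>F s in nhds 0. invertible (W s)"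
    using has_vector_derivative_continuous[OF W(2)] by (intro eventually_invertible)
  then have "\<forall>\<^sub>F s in nhds 0. vec_of_mat (transpose (W s) ** W s) \<in> P"
    using W(3)
  proof eventually_elim
    case (elim s)
    then show ?case
      using orbit_gram_zero[OF U] by (simp add: P_def vec_of_mat_def)
  qed
  then have "vec_of_mat (transpose (mat_of_vec a) ** S + S ** mat_of_vec a) \<in> P"
    by (rule tangent_in_subspace[OF P bounded_linear.has_vector_derivative[OF bounded_linear_vec_of_mat d]])
  then show "a \<in> isotropic_tangent (transpose U ** U)"
    by (simp add: isotropic_tangent_def P_def vec_of_mat_def S_def)
qed

lemma upper_in_flag_tangent:
  fixes U :: "complex^('n::{finite,wellorder})^('n::_)"
  assumes U: "invertible U" "frame_flag U \<in> M" and y: "upper (mat_of_vec y)"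
  shows "y \<in> flag_tangent M U"
proof -
  have "((\<lambda>s::real. U) has_vector_derivative 0) (at 0)"
    by (rule has_vector_derivative_const)
  moreover have "\<forall>\<^sub>F s::real in nhds 0. invertible U"
    using U(1) by simp
  ultimately obtain V where V: "V 0 = U" "(V has_vector_derivative 0 + U ** mat_of_vec y) (at 0)"
    "\<forall>\<^sub>F s in nhds 0. frame_flag (V s) = frame_flag U"
    using y by (rule curve_times_upper)
  then show ?thesis
    unfolding flag_tangent_def using U(2) by (intro CollectI exI[of _ V]) (auto elim: eventually_mono)
qed

lemma isotropic_gram_components:
  fixes U :: "complex^('n::{finite,wellorder})^('n::_)"
  assumes "isotropic_frame U"
  defines "S \<equiv> transpose U ** U"
  shows "(transpose A ** S + S ** A) $ i $ j =
     A $ opp j $ i * S $ j $ opp j + S $ i $ opp i * A $ opp i $ j"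
proof -
  note gram = isotropic_frame_gram[OF assms(1), folded S_def]
  have zero: "S $ x $ j = 0" if "x \<noteq> opp j" for x
    using gram(1)[of j x] that by (metis opp_opp)
  have "(transpose A ** S) $ i $ j = (\<Sum>x\<in>{opp j}. A $ x $ i * S $ x $ j)"
    unfolding matrix_mult_component transpose_component
    by (intro sum.mono_neutral_right) (auto simp: zero)
  moreover have "(S ** A) $ i $ j = (\<Sum>x\<in>{opp i}. S $ i $ x * A $ x $ j)"
    unfolding matrix_mult_component by (intro sum.mono_neutral_right) (auto simp: gram(1))
  ultimately show ?thesis
    by (simp add: gram(2)[of j])
qed

text \<open>Upper triangular matrices are always tangent, so only the strictly lower part
  \<open>L\<close> of \<open>a\<close> matters. It solves the linearized equations for all index
  pairs, and therefore \<open>U ** L ** adjoint_mat U\<close> is a complex skew-symmetric matrix.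
  Such a matrix is a complex combination of the generators of rotations, whose velocities are
  tangent, and the tangent space is complex.\<close>

lemma isotropic_tangent_subset:
  fixes U :: "complex^('n::{finite,wellorder})^('n::_)"
  assumes U: "isotropic_frame U" and sub: "complex_submanifold d (orbit SO_real (frame_flag U))"
  shows "isotropic_tangent (transpose U ** U) \<subseteq> flag_tangent (orbit SO_real (frame_flag U)) U"
proof
  fix a assume a: "a \<in> isotropic_tangent (transpose U ** U)"
  define M where "M = orbit SO_real (frame_flag U)"
  define T where "T = flag_tangent M U"
  define S where "S = transpose U ** U"
  note gram = isotropic_frame_gram[OF U]
  have UM: "frame_flag U \<in> M"
    unfolding M_def by (rule frame_flag_in_orbit)
  have T: "vec.subspace T"
    unfolding T_def using submanifold_tangent_frame(1)[OF sub[folded M_def] gram(6) UM] .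
  define A where "A = mat_of_vec a"
  define L where "L = low_part A"
  have skew_L: "transpose L ** S + S ** L = 0"
  proof -
    have "L $ opp j $ i * S $ j $ opp j + S $ i $ opp i * L $ opp i $ j = 0" for i j
    proof (cases "j < opp i")
      case True
      then have "i < opp j" by (simp add: less_opp_commute)
      with True show ?thesis
        using a isotropic_gram_components[OF U, of A i j]
        by (simp add: isotropic_tangent_def A_def L_def low_part_def S_def)
    next
      case False
      then have "\<not> i < opp j" by (simp add: less_opp_commute)
      with False show ?thesis
        by (simp add: L_def low_part_def)
    qed
    then show ?thesis
      using isotropic_gram_components[OF U, of L] by (simp add: vec_eq_iff S_def)
  qed
  define X where "X = U ** L ** adjoint_mat U"
  have XU: "X ** U = U ** L"
    unfolding X_def by (simp add: matrix_mul_assoc[symmetric] gram(5))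
  have "transpose U ** (transpose X + X) ** U = transpose (X ** U) ** U + transpose U ** (X ** U)"
    by (simp add: matrix_transpose_mul matrix_mult_add matrix_add_mult matrix_mul_assoc)
  also have "\<dots> = transpose L ** S + S ** L"
    unfolding XU S_def by (simp add: matrix_transpose_mul matrix_mul_assoc)
  finally have 0: "transpose U ** (transpose X + X) ** U = 0"
    using skew_L by simp
  have skew_X: "transpose X + X = 0"
  proof -
    have "transpose X + X = transpose (U ** adjoint_mat U) ** (transpose X + X) ** (U ** adjoint_mat U)"
      by (simp add: gram(4))
    also have "\<dots> = transpose (adjoint_mat U) ** (transpose U ** (transpose X + X) ** U) ** adjoint_mat U"
      by (simp add: matrix_transpose_mul matrix_mul_assoc)
    also have "\<dots> = 0"
      unfolding 0 by (simp add: vec_eq_iff matrix_mult_component)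
    finally show ?thesis .
  qed
  define f where "f = (\<lambda>x. vec_of_mat (adjoint_mat U ** mat_of_vec x ** U))"
  have sub_f: "vec.subspace {x. f x \<in> T}"
    unfolding f_def by (intro vec.linear_subspace_linear_preimage linear_conjugation T)
  have unit: "vec_of_mat (skew_unit p q) \<in> {x. f x \<in> T}" for p q
  proof (cases "p = q")
    case True
    then have "vec_of_mat (skew_unit p q) = 0"
      by (simp add: vec_eq_iff vec_of_mat_def skew_unit_def)
    then show ?thesis
      using vec.subspace_0[OF sub_f] by simp
  next
    case False
    then show ?thesis
      using rotation_tangent[OF gram(4)] by (simp add: f_def T_def M_def)
  qed
  \<comment> \<open>The sum runs over ordered pairs and so counts each plane twice, whence the
    factor 1/2.\<close>
  have "vec_of_mat X = (\<Sum>p\<in>UNIV. \<Sum>q\<in>UNIV. (X $ p $ q / 2) *s vec_of_mat (skew_unit p q))"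
  proof -
    have ij: "X $ i $ j = (\<Sum>p\<in>UNIV. \<Sum>q\<in>UNIV. X $ p $ q / 2 * skew_unit p q $ i $ j)" for i j
    proof -
      have entry: "X $ p $ q / 2 * skew_unit p q $ i $ j =
          (if p = i then if q = j then X $ i $ j / 2 else 0 else 0)
          - (if q = i then if p = j then X $ j $ i / 2 else 0 else 0)" for p q
        by (auto simp: skew_unit_def)
      have "(\<Sum>p\<in>UNIV. \<Sum>q\<in>UNIV. X $ p $ q / 2 * skew_unit p q $ i $ j) = X $ i $ j / 2 - X $ j $ i / 2"
        unfolding entry sum_subtractf sum_sum_delta
        by (subst sum.swap) (simp only: sum_sum_delta)
      also have "X $ j $ i = - X $ i $ j"
        using arg_cong[OF skew_X, of "\<lambda>A. A $ i $ j"] by (simp add: transpose_def eq_neg_iff_add_eq_0)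
      finally show ?thesis by simp
    qed
    show ?thesis
    proof (unfold vec_eq_iff, intro allI)
      fix p :: "'n \<times> 'n"
      obtain i j where p: "p = (i, j)"
        by (cases p)
      show "vec_of_mat X $ p =
          (\<Sum>p\<in>UNIV. \<Sum>q\<in>UNIV. (X $ p $ q / 2) *s vec_of_mat (skew_unit p q)) $ p"
        unfolding p sum_component vector_smult_component vec_of_mat_component by (rule ij)
    qed
  qed
  also have "\<dots> \<in> {x. f x \<in> T}"
    by (intro vec.subspace_sum[OF sub_f] vec.subspace_scale[OF sub_f] unit)
  finally have "f (vec_of_mat X) \<in> T" by simp
  moreover have "adjoint_mat U ** X ** U = L"
    unfolding matrix_mul_assoc[symmetric] XU by (simp add: matrix_mul_assoc gram(5))
  ultimately have "vec_of_mat L \<in> T"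
    by (simp add: f_def)
  moreover have "vec_of_mat (up_part A) \<in> T"
    unfolding T_def by (rule upper_in_flag_tangent[OF gram(6) UM]) (simp add: upper_up_part)
  ultimately have "vec_of_mat L + vec_of_mat (up_part A) \<in> T"
    by (rule vec.subspace_add[OF T])
  moreover have "vec_of_mat L + vec_of_mat (up_part A) = a"
    unfolding L_def using low_part_add_up_part[of A]
    by (simp add: A_def bounded_linear.linear[OF bounded_linear_vec_of_mat] linear_add[symmetric])
  ultimately show "a \<in> flag_tangent (orbit SO_real (frame_flag U)) U"
    by (simp add: T_def M_def)
qed

text \<open>
  An element of the tangent space is determined by its entries off \<open>{(i, j). j < i \<le> opp j}\<close>:
  the condition relates entry \<open>(i, j)\<close> to its mirror image \<open>(opp j, opp i)\<close> in the antidiagonal.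
\<close>

lemma dim_isotropic_tangent:
  fixes U :: "complex^('n::{finite,wellorder})^('n::_)"
  assumes U: "isotropic_frame U"
  shows "vec.dim (isotropic_tangent (transpose U ** U)) + card (half_pairs :: ('n \<times> 'n) set) = CARD('n \<times> 'n)"
proof -
  define S where "S = transpose U ** U"
  define \<sigma> where "\<sigma> = (\<lambda>i. S $ i $ opp i)"
  have nz: "\<sigma> i \<noteq> 0" for i
    using isotropic_frame_gram(3)[OF U, of i] by (auto simp: \<sigma>_def S_def)
  have iso: "a \<in> isotropic_tangent S \<longleftrightarrow>
      (\<forall>i j. j < i \<longrightarrow> a $ (opp j, opp i) * \<sigma> j + \<sigma> (opp i) * a $ (i, j) = 0)" for a
  proof -
    have "a \<in> isotropic_tangent S \<longleftrightarrow>
        (\<forall>i j. j < opp i \<longrightarrow> a $ (opp j, i) * \<sigma> j + \<sigma> i * a $ (opp i, j) = 0)"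
      unfolding isotropic_tangent_def S_def isotropic_gram_components[OF U]
      by (simp add: \<sigma>_def S_def mat_of_vec_def)
    also have "\<dots> \<longleftrightarrow> (\<forall>i j. j < i \<longrightarrow> a $ (opp j, opp i) * \<sigma> j + \<sigma> (opp i) * a $ (i, j) = 0)"
      by (metis opp_opp)
    finally show ?thesis .
  qed
  define I where "I = {(i::'n, j). j < i \<and> i \<le> opp j}"
  define Q where "Q = {x :: complex^('n \<times> 'n). \<forall>p. p \<notin> - I \<longrightarrow> x $ p = 0}"
  have Q: "vec.subspace Q" "vec.dim Q = card (- I)"
    unfolding Q_def dim_substandard_cart by (simp_all add: vec.subspace_def)
  \<comment> \<open>\<open>f\<close> solves the equations for the entries indexed by
    \<open>I\<close>. An entry with \<open>i = opp j\<close> is its own mirror image; its equation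
    reads \<open>2 * \<sigma> j * x = 0\<close>, so it vanishes.\<close>
  define f :: "complex^('n \<times> 'n) \<Rightarrow> complex^('n \<times> 'n)" where
    "f = (\<lambda>x. \<chi> p. case p of (i, j) \<Rightarrow> if j < i \<and> i \<le> opp j
        then if i = opp j then 0 else - (\<sigma> j / \<sigma> (opp i)) * x $ (opp j, opp i) else x $ (i, j))"
  have f: "f x $ (i, j) = (if j < i \<and> i \<le> opp j
      then if i = opp j then 0 else - (\<sigma> j / \<sigma> (opp i)) * x $ (opp j, opp i) else x $ (i, j))" for x i j
    by (simp add: f_def)
  have lin: "Vector_Spaces.linear (*s) (*s) f"
    by unfold_locales (auto simp: vec_eq_iff f algebra_simps)
  have "f x \<in> isotropic_tangent S" for x
    unfolding iso
  proof (intro allI impI)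
    fix i j :: 'n assume ji: "j < i"
    then have ij': "opp i < opp j" by simp
    show "f x $ (opp j, opp i) * \<sigma> j + \<sigma> (opp i) * f x $ (i, j) = 0"
    proof (cases i "opp j" rule: linorder_cases)
      case less
      then have "\<not> opp j \<le> i" "i \<le> opp j" "i \<noteq> opp j" by auto
      then show ?thesis
        using ji nz[of "opp i"] by (simp add: f)
    next
      case equal
      then show ?thesis using ji by (simp add: f)
    next
      case greater
      then have "\<not> i \<le> opp j" "opp j \<le> i" "opp j \<noteq> i" by auto
      then show ?thesis
        using ji ij' nz[of j] by (simp add: f)
    qed
  qed
  moreover have "\<exists>x\<in>Q. a = f x" if a: "a \<in> isotropic_tangent S" for a
  proof -
    define x :: "complex^('n \<times> 'n)" where "x = (\<chi> p. if p \<in> I then 0 else a $ p)"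
    have "a $ (i, j) = f x $ (i, j)" for i j
    proof (cases "j < i \<and> i \<le> opp j")
      case True
      then have eq: "a $ (opp j, opp i) * \<sigma> j + \<sigma> (opp i) * a $ (i, j) = 0"
        using a iso by blast
      show ?thesis
      proof (cases "i = opp j")
        case True
        then have "a $ (i, j) * \<sigma> j = 0"
          using eq by (simp add: mult.commute)
        then show ?thesis
          using True nz[of j] by (simp add: f x_def I_def)
      next
        case False
        then have "i < opp j" using True by auto
        then have "\<not> opp i \<le> j" by (simp add: not_le less_opp_commute)
        then have "x $ (opp j, opp i) = a $ (opp j, opp i)"
          by (simp add: x_def I_def)
        moreover have "a $ (i, j) = - (\<sigma> j / \<sigma> (opp i)) * a $ (opp j, opp i)"
          using eq nz[of "opp i"] by (simp add: field_simps add_eq_0_iff)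
        ultimately show ?thesis
          using True False by (simp add: f)
      qed
    next
      case False
      then show ?thesis by (auto simp: f x_def I_def)
    qed
    moreover have "x \<in> Q"
      by (simp add: Q_def x_def)
    ultimately show ?thesis
      by (intro bexI[of _ x]) (simp_all add: vec_eq_iff)
  qed
  ultimately have "f ` Q = isotropic_tangent S"
    by blast
  moreover have "inj_on f Q"
  proof (rule inj_onI)
    fix x y assume xy: "x \<in> Q" "y \<in> Q" "f x = f y"
    have "x $ (i, j) = y $ (i, j)" for i j
    proof (cases "(i, j) \<in> I")
      case True
      then show ?thesis using xy(1,2) by (simp add: Q_def)
    next
      case False
      then show ?thesis
        using arg_cong[OF xy(3), of "\<lambda>z. z $ (i, j)"] by (auto simp: f I_def)
    qed
    then show "x = y" by (simp add: vec_eq_iff)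
  qed
  then have "vec.dim (f ` Q) = vec.dim Q"
    using lin Q(1) by (intro vec.dim_image_eq) (simp_all add: vec.span_eq_iff[THEN iffD2])
  ultimately have "vec.dim (isotropic_tangent S) = card (- I)"
    using Q(2) by simp
  moreover have "card I = card (half_pairs :: ('n \<times> 'n) set)"
    unfolding I_def half_pairs_def by (rule card_swap_pairs)
  moreover have "card (- I) + card I = CARD('n \<times> 'n)"
    using card_Un_disjoint[of "- I" I] by (simp add: Compl_partition2)
  ultimately show ?thesis
    by (simp add: S_def)
qed

lemma complex_dim_base_cycle:
  fixes U :: "complex^('n::{finite,wellorder})^('n::_)"
  assumes U: "isotropic_frame U" and sub: "complex_submanifold d (orbit SO_real (frame_flag U))"
  shows "complex_dim (orbit SO_real (frame_flag U)) + card {(i::'n, j). i \<le> j}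
     + card (half_pairs :: ('n \<times> 'n) set) = CARD('n \<times> 'n)"
proof -
  define M where "M = orbit SO_real (frame_flag U)"
  have inv: "invertible (k ** U)" if "k \<in> SO_real" for k
    using that by (intro invertible_mult SO_realD isotropic_frame_gram(6) U)
  have UM: "frame_flag U \<in> M"
    unfolding M_def by (rule frame_flag_in_orbit)
  have "flag_tangent M U = isotropic_tangent (transpose U ** U)"
    using flag_tangent_orbit_subset[OF U mat_1_in_SO_real] isotropic_tangent_subset[OF U sub] by (simp add: M_def)
  then have d: "d + card {(i::'n, j). i \<le> j} = vec.dim (isotropic_tangent (transpose U ** U))"
    using submanifold_tangent_frame(2)[OF sub[folded M_def] isotropic_frame_gram(6)[OF U] UM] by simp
  have "complex_dim M = d"
  proof (rule complex_dim_eqI[OF sub[folded M_def]])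
    show "M \<noteq> {}" using UM by blast
    fix M' d' assume M': "M' \<noteq> {}" "M' \<subseteq> M" "complex_submanifold d' M'"
    then obtain k where k: "k \<in> SO_real" "frame_flag (k ** U) \<in> M'"
      unfolding M_def orbit_SO_frame by blast
    have "flag_tangent M' (k ** U) \<subseteq> flag_tangent M (k ** U)"
      using M'(2) by (intro flag_tangent_mono always_eventually) blast
    also have "\<dots> \<subseteq> isotropic_tangent (transpose U ** U)"
      unfolding M_def by (rule flag_tangent_orbit_subset[OF U k(1)])
    finally have "vec.dim (flag_tangent M' (k ** U)) \<le> vec.dim (isotropic_tangent (transpose U ** U))"
      by (rule vec.dim_subset)
    then show "d' \<le> d"
      using submanifold_tangent_frame(2)[OF M'(3) inv[OF k(1)] k(2)] d by simp
  qed simp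
  then show ?thesis
    using dim_isotropic_tangent[OF U] d by (simp add: M_def)
qed

text \<open>
  The symmetric form is nondegenerate on \<open>coord_space l\<close>, since this space is closed under complex
  conjugation. The part of the flag member \<open>t\<close> inside it is orthogonal to all frame vectors of
  index less than \<open>opp t\<close>, so it is paired faithfully with the remaining ones.
\<close>

lemma generous_of_meet:
  fixes U :: "complex^('n::{finite,wellorder})^('n::_)"
  assumes U: "isotropic_frame U" and v: "v permutes UNIV"
    and F: "F \<in> orbit SO_real (frame_flag U)" "F \<in> schubert_cell v"
  shows "generous v"
  unfolding generous_def
proof (intro allI impI)
  fix l t :: 'n assume t: "t < opp t"
  obtain b where b: "upper b" "invertible b" "F = frame_flag (b ** perm_mat v)"
    using F(2) unfolding schubert_cell_iff[OF v] by blast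
  define V where "V = b ** perm_mat v"
  have V: "invertible V"
    unfolding V_def by (intro invertible_mult b invertible_perm_mat v)
  define S where "S = transpose V ** V"
  have S0: "S $ i $ j = 0" if "j < opp i" for i j
    unfolding S_def using orbit_gram_zero[OF U V _ that] F(1) by (simp add: b(3) V_def)
  define J where "J = {j. v j \<le> l}"
  have into: "V *v y \<in> coord_space l" if y: "\<And>j. j \<notin> J \<Longrightarrow> y $ j = 0" for y
  proof -
    have "perm_mat v *v y \<in> coord_space l"
      using y by (auto simp: coord_space_def perm_mat_mult_vec_component[OF v] J_def permutes_inverses[OF v])
    then have "b *v (perm_mat v *v y) \<in> coord_space l"
      using upper_image_subset[OF b(1)] by blast
    then show ?thesis
      by (simp add: V_def matrix_vector_mul_assoc)
  qed
  have onto: "\<exists>y. x = V *v y \<and> (\<forall>j. j \<notin> J \<longrightarrow> y $ j = 0)" if x: "x \<in> coord_space l" for x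
  proof -
    obtain x' where x': "x' \<in> coord_space l" "x = b *v x'"
      using x upper_image[OF b(1,2), of l] by blast
    define y where "y = perm_mat (inv v) *v x'"
    have "y $ j = x' $ v j" for j
      by (simp add: y_def perm_mat_mult_vec_component[OF permutes_inv[OF v]] permutes_inv_inv[OF v])
    moreover have "perm_mat v *v y = x'"
      by (simp add: y_def matrix_vector_mul_assoc perm_mat_inverse[OF v])
    ultimately show ?thesis
      using x' by (intro exI[of _ y])
        (auto simp: V_def matrix_vector_mul_assoc[symmetric] J_def coord_space_def)
  qed
  have pair: "(\<Sum>i\<in>UNIV. y' $ i * (S *v y) $ i) = (\<Sum>x\<in>UNIV. (V *v y') $ x * (V *v y) $ x)" for y y'
  proof -
    have "(S *v y) $ i = (\<Sum>x\<in>UNIV. V $ x $ i * (V *v y) $ x)" for i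
    proof -
      have "S *v y = transpose V *v (V *v y)"
        by (simp add: S_def matrix_vector_mul_assoc)
      then show ?thesis
        by (simp only: matrix_vector_mult_def[of "transpose V"] vec_lambda_beta transpose_component)
    qed
    then have "(\<Sum>i\<in>UNIV. y' $ i * (S *v y) $ i) = (\<Sum>i\<in>UNIV. \<Sum>x\<in>UNIV. V $ x $ i * y' $ i * (V *v y) $ x)"
      by (simp add: sum_distrib_left mult_ac)
    also have "\<dots> = (\<Sum>x\<in>UNIV. \<Sum>i\<in>UNIV. V $ x $ i * y' $ i * (V *v y) $ x)"
      by (rule sum.swap)
    also have "\<dots> = (\<Sum>x\<in>UNIV. (V *v y') $ x * (V *v y) $ x)"
      by (simp add: matrix_vector_mult_def[of V y'] sum_distrib_right)
    finally show ?thesis .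
  qed
  define I1 where "I1 = {j. j \<le> t \<and> v j \<le> l}"
  define I2 where "I2 = {j. opp t \<le> j \<and> v j \<le> l}"
  define Y where "Y = {y :: complex^('n::_). \<forall>j. j \<notin> I1 \<longrightarrow> y $ j = 0}"
  have Y: "vec.subspace Y" "vec.dim Y = card I1"
    unfolding Y_def dim_substandard_cart by (simp_all add: vec.subspace_def)
  have faithful: "y = 0" if y: "y \<in> Y" "\<And>i. i \<in> I2 \<Longrightarrow> (S *v y) $ i = 0" for y
  proof -
    have zero: "(S *v y) $ i = 0" if i: "i \<in> J" for i
    proof (cases "opp t \<le> i")
      case True
      then show ?thesis using y(2) i by (simp add: I2_def J_def)
    next
      case False
      then have "t < opp i" by (simp add: not_le less_opp_commute)
      have "S $ i $ j * y $ j = 0" for j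
      proof (cases "j \<le> t")
        case True
        then have "j < opp i" using \<open>t < opp i\<close> by simp
        then show ?thesis by (simp add: S0)
      next
        case False
        then show ?thesis using y(1) by (simp add: Y_def I1_def)
      qed
      then have "(\<Sum>j\<in>UNIV. S $ i $ j * y $ j) = 0"
        by (intro sum.neutral ballI)
      then show ?thesis
        by (simp add: matrix_vector_mult_def)
    qed
    \<comment> \<open>The vanishing so far makes \<open>w\<close> orthogonal to all of
      \<open>coord_space l\<close>, in particular to its own conjugate, and that pairing is the
      squared norm of \<open>w\<close>.\<close>
    define w where "w = V *v y"
    have "w \<in> coord_space l"
      unfolding w_def using y(1) by (intro into) (auto simp: Y_def I1_def J_def)
    then have "(\<chi> x. cnj (w $ x)) \<in> coord_space l"
      by (simp add: coord_space_def)
    then obtain y' where y': "(\<chi> x. cnj (w $ x)) = V *v y'" "\<And>j. j \<notin> J \<Longrightarrow> y' $ j = 0"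
      using onto by blast
    have "(\<Sum>i\<in>UNIV. y' $ i * (S *v y) $ i) = 0"
      using zero y'(2) by (intro sum.neutral) (metis mult_eq_0_iff)
    then have "(\<Sum>x\<in>UNIV. cnj (w $ x) * w $ x) = 0"
      unfolding pair y'(1)[symmetric] by (simp add: w_def)
    moreover have "complex_of_real (\<Sum>x\<in>UNIV. (norm (w $ x))\<^sup>2) = (\<Sum>x\<in>UNIV. cnj (w $ x) * w $ x)"
      by (simp only: of_real_sum complex_norm_square mult.commute)
    ultimately have "complex_of_real (\<Sum>x\<in>UNIV. (norm (w $ x))\<^sup>2) = 0"
      by simp
    then have "(\<Sum>x\<in>UNIV. (norm (w $ x))\<^sup>2) = 0"
      using of_real_eq_0_iff by blast
    then have "w $ x = 0" for x
      by (subst (asm) sum_nonneg_eq_0_iff) auto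
    then have "w = 0"
      by (simp add: vec_eq_iff)
    then show ?thesis
      using V matrix_left_invertible_ker[of V] invertible_left_inverse[of V] by (simp add: w_def)
  qed
  define f :: "complex^('n::_) \<Rightarrow> complex^('n::_)" where "f = (\<lambda>y. \<chi> i. if i \<in> I2 then (S *v y) $ i else 0)"
  have lin: "Vector_Spaces.linear (*s) (*s) f"
    by unfold_locales
       (auto simp: vec_eq_iff f_def matrix_vector_right_distrib vec.linear_scale[OF matrix_vector_mul_linear_gen])
  have "inj_on f Y"
  proof (rule inj_onI)
    fix x y assume xy: "x \<in> Y" "y \<in> Y" "f x = f y"
    then have f0: "f (x - y) = 0"
      using vec.linear_diff[OF lin] by simp
    have "(S *v (x - y)) $ i = 0" if "i \<in> I2" for i
      using arg_cong[OF f0, of "\<lambda>z. z $ i"] that by (simp add: f_def)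
    then have "x - y = 0"
      using vec.subspace_diff[OF Y(1) xy(1,2)] by (intro faithful)
    then show "x = y" by simp
  qed
  then have "card I1 = vec.dim (f ` Y)"
    using lin Y by (subst vec.dim_image_eq) (simp_all add: vec.span_eq_iff[THEN iffD2])
  also have "\<dots> \<le> vec.dim {z :: complex^('n::_). \<forall>i. i \<notin> I2 \<longrightarrow> z $ i = 0}"
    by (rule vec.dim_subset) (auto simp: f_def)
  also have "\<dots> = card I2"
    by (rule dim_substandard_cart)
  finally show "card {j. j \<le> t \<and> v j \<le> l} \<le> card {j. opp t \<le> j \<and> v j \<le> l}"
    by (simp add: I1_def I2_def)
qed

section \<open>Isotropic flags in the cells of special words\<close>

lemma adjoint_perm_mat:
  fixes w :: "'n::{finite,wellorder} \<Rightarrow> 'n"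
  assumes w: "w permutes UNIV"
  shows "adjoint_mat (perm_mat w) = perm_mat (inv w)" "transpose (perm_mat w) = perm_mat (inv w)"
proof -
  have "j = w i \<longleftrightarrow> i = inv w j" for i j
    using permutes_inv_eq[OF w] by metis
  then show "adjoint_mat (perm_mat w) = perm_mat (inv w)" "transpose (perm_mat w) = perm_mat (inv w)"
    by (simp_all add: vec_eq_iff adjoint_mat_def transpose_def perm_mat_def)
qed

text \<open>
  For \<open>c < opp c\<close> the isotropic frame has the columns \<open>(e\<^sub>p \<plusminus> \<i> e\<^sub>q) / \<surd>2\<close> with \<open>p = v c\<close> and
  \<open>q = v (opp c)\<close>. Since \<open>q < p\<close>, both \<open>e\<^sub>p + \<i> e\<^sub>q\<close> and \<open>e\<^sub>q\<close>, which span the same flag, arise from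
  \<open>e\<^sub>p\<close> and \<open>e\<^sub>q\<close> by an upper triangular matrix.
\<close>

lemma isotropic_frame_in_cell:
  fixes v :: "'n::{finite,wellorder} \<Rightarrow> 'n"
  assumes v: "v permutes UNIV" and less: "\<And>c. c < opp c \<Longrightarrow> v (opp c) < v c"
  obtains b c where "upper b" "invertible b" "upper c" "invertible c"
    "adjoint_mat (b ** perm_mat v ** c) ** (b ** perm_mat v ** c) = mat 1"
    "\<And>i j. (transpose (b ** perm_mat v ** c) ** (b ** perm_mat v ** c)) $ i $ j = (if j = opp i then 1 else 0)"
proof -
  define r where "r = complex_of_real (1 / sqrt 2)"
  have r: "r * r = 1 / 2" "cnj r = r"
    by (simp_all add: r_def flip: of_real_mult)
  define K :: "complex^('n::_)^('n::_)" where "K = (\<chi> x y.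
     if y < opp y then (if x = y then r else if x = opp y then \<i> * r else 0)
     else if opp y < y then (if x = y then - \<i> * r else if x = opp y then r else 0)
     else if x = y then 1 else 0)"
  define B :: "complex^('n::_)^('n::_)" where
    "B = (\<chi> x z. (if x = z then 1 else 0) + (if x = opp z \<and> z < opp z then \<i> else 0))"
  \<comment> \<open>The change of columns with \<open>B ** c = K\<close>. For
    \<open>opp y < y\<close> column \<open>y\<close> of \<open>K\<close> is \<open>r\<close> times
    (e - \<i>f), where e + \<i>f is column \<open>opp y\<close> of \<open>B\<close> and f is column
    \<open>y\<close>; subtracting \<open>2 * \<i> * r\<close> times f from \<open>r\<close> times
    the former produces it.\<close>
  define c :: "complex^('n::_)^('n::_)" where "c = (\<chi> x y.
     (if x = y then (if y < opp y then r else if opp y < y then - 2 * \<i> * r else 1) else 0)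
     + (if x = opp y \<and> opp y < y then r else 0))"
  have pair: "(\<Sum>z\<in>UNIV. f z) = (if y = opp y then f y else f y + f (opp y))"
    if "\<And>z. z \<noteq> y \<Longrightarrow> z \<noteq> opp y \<Longrightarrow> f z = 0" for f :: "'n \<Rightarrow> complex" and y
  proof -
    have "(\<Sum>z\<in>UNIV. f z) = (\<Sum>z\<in>{y, opp y}. f z)"
      using that by (intro sum.mono_neutral_right) auto
    then show ?thesis by auto
  qed
  have opp_cases: "y < opp y \<or> y = opp y \<or> opp y < y" for y :: 'n
    by auto
  have opp_neq: "y < opp y \<Longrightarrow> y \<noteq> opp y \<and> opp y \<noteq> y \<and> \<not> opp y < y"
    "opp y < y \<Longrightarrow> y \<noteq> opp y \<and> opp y \<noteq> y \<and> \<not> y < opp y" for y :: 'n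
    by auto
  have K_eq: "B ** c = K"
  proof -
    have "(B ** c) $ x $ y = K $ x $ y" for x y
    proof -
      have "(B ** c) $ x $ y = (if y = opp y then B $ x $ y * c $ y $ y
          else B $ x $ y * c $ y $ y + B $ x $ opp y * c $ opp y $ y)"
        unfolding matrix_mult_component by (rule pair) (auto simp: c_def)
      then show ?thesis
        using opp_cases[of y] opp_neq[of y] by (auto simp: B_def c_def K_def)
    qed
    then show ?thesis by (simp add: vec_eq_iff)
  qed
  have K_zero: "K $ x $ y = 0" if "x \<noteq> y" "x \<noteq> opp y" for x y
    using that by (auto simp: K_def)
  have K_adj: "adjoint_mat K ** K = mat 1"
  proof -
    have "(adjoint_mat K ** K) $ i $ j = mat 1 $ i $ j" for i j
    proof -
      have "(adjoint_mat K ** K) $ i $ j = (if i = opp i then cnj (K $ i $ i) * K $ i $ j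
          else cnj (K $ i $ i) * K $ i $ j + cnj (K $ opp i $ i) * K $ opp i $ j)"
        unfolding matrix_mult_component by (rule pair[of i, THEN trans]) (auto simp: adjoint_mat_def K_zero)
      also have "\<dots> = mat 1 $ i $ j"
      proof -
        consider "j = i" | "j = opp i" "j \<noteq> i" | "j \<noteq> i" "j \<noteq> opp i" by blast
        then show ?thesis
        proof cases
          case 1
          then show ?thesis
            using opp_cases[of i] opp_neq[of i] r by (auto simp: K_def mat_def algebra_simps)
        next
          case 2
          then show ?thesis
            using opp_cases[of i] opp_neq[of i] r by (auto simp: K_def mat_def algebra_simps)
        next
          case 3
          then have "K $ i $ j = 0" "K $ opp i $ j = 0"
            by (auto intro!: K_zero)
          then show ?thesis using 3 by (simp add: mat_def)
        qed
      qed
      finally show ?thesis .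
    qed
    then show ?thesis by (simp add: vec_eq_iff)
  qed
  have K_sym: "(transpose K ** K) $ i $ j = (if j = opp i then 1 else 0)" for i j
  proof -
    have "(transpose K ** K) $ i $ j = (if i = opp i then K $ i $ i * K $ i $ j
        else K $ i $ i * K $ i $ j + K $ opp i $ i * K $ opp i $ j)"
      unfolding matrix_mult_component by (rule pair[of i, THEN trans]) (auto simp: transpose_def K_zero)
    also have "\<dots> = (if j = opp i then 1 else 0)"
    proof -
      consider "j = i" | "j = opp i" "j \<noteq> i" | "j \<noteq> i" "j \<noteq> opp i" by blast
      then show ?thesis
      proof cases
        case 1
        then show ?thesis
          using opp_cases[of i] opp_neq[of i] r by (auto simp: K_def algebra_simps)
      next
        case 2
        then show ?thesis
          using opp_cases[of i] opp_neq[of i] r by (auto simp: K_def algebra_simps)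
      next
        case 3
        then have "K $ i $ j = 0" "K $ opp i $ j = 0"
          by (auto intro!: K_zero)
        then show ?thesis using 3 by simp
      qed
    qed
    finally show ?thesis .
  qed
  have "K ** adjoint_mat K = mat 1"
    using K_adj matrix_left_right_inverse by blast
  then have "B ** (c ** adjoint_mat K) = mat 1"
    unfolding K_eq[symmetric] by (simp add: matrix_mul_assoc)
  then have B: "invertible B"
    using invertible_right_inverse by blast
  have "(adjoint_mat K ** B) ** c = mat 1"
    using K_adj unfolding K_eq[symmetric] by (simp add: matrix_mul_assoc)
  then have c: "invertible c"
    using invertible_left_inverse by blast
  have "upper c"
    by (auto simp: upper_def c_def)
  define b where "b = perm_mat v ** B ** perm_mat (inv v)"
  have bP: "b ** perm_mat v = perm_mat v ** B"
    by (simp add: b_def matrix_mul_assoc[symmetric] perm_mat_inverse[OF v])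
  have b_inv: "invertible b"
    unfolding b_def by (intro invertible_mult invertible_perm_mat permutes_inv v B)
  have "upper b"
    unfolding upper_def
  proof (intro allI impI)
    fix i j :: 'n assume ji: "j < i"
    have eq: "b $ i $ j = B $ inv v i $ inv v j"
      using perm_mat_conjugate[OF permutes_inv[OF v], of B i j]
      by (simp add: b_def permutes_inv_inv[OF v])
    have "inv v i \<noteq> inv v j"
      using ji permutes_inverses(1)[OF v] by (metis less_irrefl)
    moreover have "\<not> (inv v i = opp (inv v j) \<and> inv v j < opp (inv v j))"
    proof
      assume *: "inv v i = opp (inv v j) \<and> inv v j < opp (inv v j)"
      then have "v (inv v i) < v (inv v j)"
        using less[of "inv v j"] by simp
      then show False
        using ji by (simp add: permutes_inverses[OF v])
    qed
    ultimately show "b $ i $ j = 0"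
      unfolding eq by (simp add: B_def)
  qed
  have W: "b ** perm_mat v ** c = perm_mat v ** K"
    unfolding bP K_eq[symmetric] by (simp add: matrix_mul_assoc)
  have "adjoint_mat (perm_mat v ** K) ** (perm_mat v ** K) =
      adjoint_mat K ** (perm_mat (inv v) ** perm_mat v) ** K"
    by (simp add: adjoint_mat_mult adjoint_perm_mat[OF v] matrix_mul_assoc)
  moreover have "transpose (perm_mat v ** K) ** (perm_mat v ** K) =
      transpose K ** (perm_mat (inv v) ** perm_mat v) ** K"
    by (simp add: matrix_transpose_mul adjoint_perm_mat[OF v] matrix_mul_assoc)
  ultimately show ?thesis
    using that[OF \<open>upper b\<close> b_inv \<open>upper c\<close> c] K_adj K_sym
    unfolding W by (simp add: perm_mat_inverse[OF v])
qed

text \<open>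
  Two isotropic frames differ, after adjusting phases, by a real orthogonal matrix. If its
  determinant is negative, composing with a diagonal reflection corrects it without leaving the
  Schubert cell.
\<close>

lemma orbit_meets_cell:
  fixes U :: "complex^('n::{finite,wellorder})^('n::_)" and v :: "'n \<Rightarrow> 'n"
  assumes U: "isotropic_frame U" and v: "v permutes UNIV"
    and less: "\<And>c. c < opp c \<Longrightarrow> v (opp c) < v c"
  shows "orbit SO_real (frame_flag U) \<inter> schubert_cell v \<noteq> {}"
proof -
  obtain b c where b: "upper b" "invertible b" and c: "upper c" "invertible c"
    and W_adj: "adjoint_mat (b ** perm_mat v ** c) ** (b ** perm_mat v ** c) = mat 1"
    and W_sym: "\<And>i j. (transpose (b ** perm_mat v ** c) ** (b ** perm_mat v ** c)) $ i $ j = (if j = opp i then 1 else 0)"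
    using isotropic_frame_in_cell[OF v less] by blast
  define W where "W = b ** perm_mat v ** c"
  define S where "S = transpose U ** U"
  define \<sigma> where "\<sigma> = (\<lambda>i. S $ i $ opp i)"
  note gram = isotropic_frame_gram[OF U, folded S_def]
  have norm_\<sigma>: "norm (\<sigma> i) = 1" for i
  proof -
    have "complex_of_real ((norm (\<sigma> i))\<^sup>2) = 1"
      using gram(3)[of i] by (simp add: \<sigma>_def complex_norm_square mult.commute del: of_real_power)
    then have "(norm (\<sigma> i))\<^sup>2 = 1"
      using of_real_eq_1_iff by blast
    then show ?thesis
      by (simp add: power2_eq_1_iff) (metis norm_ge_zero not_one_le_zero neg_0_le_iff_le)
  qed
  \<comment> \<open>Phases with product \<open>\<sigma> a\<close> on each pair
    \<open>a, opp a\<close>. On a pair one of them may be 1; a middle index is its own partner and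
    needs a square root. Scaling by them carries the Gram matrix of \<open>W\<close> to that of
    \<open>U\<close>.\<close>
  define t where "t = (\<lambda>a::'n. if a < opp a then \<sigma> a else if opp a < a then 1 else csqrt (\<sigma> a))"
  have norm_t: "norm (t a) = 1" for a
    by (simp add: t_def norm_\<sigma> norm_csqrt)
  have tt: "t a * t (opp a) = \<sigma> a" for a
  proof -
    consider "a < opp a" | "opp a < a" | "opp a = a" by fastforce
    then show ?thesis
    proof cases
      case 3
      then show ?thesis
        by (simp add: t_def power2_eq_square[symmetric])
    qed (auto simp: t_def \<sigma>_def gram(2))
  qed
  define T :: "complex^('n::_)^('n::_)" where "T = (\<chi> i j. if i = j then t i else 0)"
  have T_upper: "upper T"
    by (auto simp: upper_def T_def)
  have T_mult: "(T ** A) $ i $ j = t i * A $ i $ j" "(A ** T) $ i $ j = A $ i $ j * t j" for A i j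
    by (simp_all add: matrix_mult_component T_def if_distrib if_distribR cong: if_cong)
  have T_adj: "adjoint_mat T ** T = mat 1"
  proof -
    have "adjoint_mat T $ i $ j = (if i = j then cnj (t i) else 0)" for i j
      by (auto simp: adjoint_mat_def T_def)
    then have "(adjoint_mat T ** T) $ i $ j = (if i = j then cnj (t i) * t i else 0)" for i j
      unfolding T_mult by simp
    moreover have "cnj (t i) * t i = 1" for i
      using norm_t[of i] complex_norm_square[of "t i"] by (simp add: mult.commute)
    ultimately show ?thesis
      by (simp add: vec_eq_iff mat_def)
  qed
  have T_inv: "invertible T"
    using T_adj invertible_left_inverse by blast
  have TWT: "T ** (transpose W ** W) ** T = S"
  proof -
    have "(T ** (transpose W ** W) ** T) $ i $ j = S $ i $ j" for i j
      using tt[of i] gram(1)[of j i] by (auto simp: T_mult W_sym W_def \<sigma>_def)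
    then show ?thesis by (simp add: vec_eq_iff)
  qed
  have T_trans: "transpose T = T"
    by (auto simp: vec_eq_iff transpose_def T_def)
  \<comment> \<open>Both \<open>U\<close> and \<open>W ** T\<close> are unitary frames with Gram
    matrix \<open>S\<close>, so the transition matrix between them preserves the Hermitian and the
    symmetric form.\<close>
  define k where "k = W ** T ** adjoint_mat U"
  have adj_adj: "adjoint_mat (adjoint_mat U) = U"
    by (simp add: vec_eq_iff adjoint_mat_def)
  have kU: "k ** U = W ** T"
    by (simp add: k_def matrix_mul_assoc[symmetric] gram(5))
  have k1: "adjoint_mat k ** k = mat 1"
  proof -
    have "adjoint_mat k ** k = U ** (adjoint_mat T ** (adjoint_mat W ** W) ** T) ** adjoint_mat U"
      by (simp add: k_def adjoint_mat_mult adj_adj matrix_mul_assoc)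
    then show ?thesis
      using W_adj by (simp add: W_def[symmetric] T_adj gram(4))
  qed
  have k2: "transpose k ** k = mat 1"
  proof -
    have "transpose k ** k = transpose (adjoint_mat U) ** (T ** (transpose W ** W) ** T) ** adjoint_mat U"
      by (simp add: k_def matrix_transpose_mul T_trans matrix_mul_assoc)
    also have "\<dots> = transpose (U ** adjoint_mat U) ** (U ** adjoint_mat U)"
      unfolding TWT S_def by (simp add: matrix_transpose_mul matrix_mul_assoc)
    finally show ?thesis
      by (simp add: gram(4))
  qed
  have k_inv: "k ** transpose k = mat 1"
    using k2 matrix_left_right_inverse by blast
  \<comment> \<open>Adjoint and transpose are both inverse to \<open>k\<close>, hence equal, and so
    the entries of \<open>k\<close> are real.\<close>
  have "adjoint_mat k = adjoint_mat k ** (k ** transpose k)"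
    by (simp add: k_inv)
  also have "\<dots> = transpose k"
    by (simp add: matrix_mul_assoc k1)
  finally have "cnj (k $ i $ j) = k $ i $ j" for i j
    by (simp add: vec_eq_iff adjoint_mat_def transpose_def)
  then have k_real: "complex_of_real (Re (k $ i $ j)) = k $ i $ j" for i j
    by (metis Reals_cnj_iff of_real_Re)
  define A where "A = (\<chi> i j. Re (k $ i $ j))"
  have kA: "k = map_matrix complex_of_real A"
    by (simp add: vec_eq_iff A_def k_real)
  have orth_A: "orthogonal_matrix A"
  proof -
    have "map_matrix complex_of_real (transpose A ** A) = transpose k ** k"
      unfolding map_of_real_mult kA by (simp add: vec_eq_iff transpose_def matrix_mult_component)
    also have "\<dots> = map_matrix complex_of_real (mat 1)"
      by (simp add: k2 map_of_real_mat_1)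
    finally have "complex_of_real ((transpose A ** A) $ i $ j) = complex_of_real (mat 1 $ i $ j)" for i j
      by (metis nth_map_matrix)
    then have "transpose A ** A = mat 1"
      unfolding of_real_eq_iff by (simp add: vec_eq_iff)
    then show ?thesis
      by (simp add: orthogonal_matrix)
  qed
  \<comment> \<open>An arbitrary index: the diagonal matrix \<open>E z\<close> with
    \<open>z = det A\<close> at this place corrects the determinant. Being upper triangular, it can
    be absorbed into \<open>b\<close>.\<close>
  define a0 :: 'n where "a0 = undefined"
  define E :: "real \<Rightarrow> real^('n::_)^('n::_)" where
    "E = (\<lambda>z. \<chi> i j. if i = j then if i = a0 then z else 1 else 0)"
  have E: "orthogonal_matrix (E z)" "det (E z) = z" if "z = 1 \<or> z = - 1" for z
  proof -
    have "transpose (E z) = E z"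
      by (auto simp: vec_eq_iff transpose_def E_def)
    moreover have "(E z ** E z) $ i $ j = mat 1 $ i $ j" for i j
    proof -
      have "(E z ** E z) $ i $ j = (\<Sum>k\<in>UNIV. if k = i then (if i = a0 then z else 1) * E z $ i $ j else 0)"
        unfolding matrix_matrix_mult_def vec_lambda_beta
      proof (intro sum.cong refl)
        fix k
        show "E z $ i $ k * E z $ k $ j = (if k = i then (if i = a0 then z else 1) * E z $ i $ j else 0)"
          by (cases "k = i") (simp_all add: E_def)
      qed
      then show ?thesis
        using that by (auto simp: E_def mat_def)
    qed
    then have "E z ** E z = mat 1"
      by (simp add: vec_eq_iff)
    ultimately show "orthogonal_matrix (E z)"
      by (simp add: orthogonal_matrix)
    have "det (E z) = (\<Prod>i\<in>UNIV. E z $ i $ i)"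
      by (rule det_diagonal) (simp add: E_def)
    also have "\<dots> = (\<Prod>i\<in>UNIV. if i = a0 then z else 1)"
      by (simp add: E_def)
    finally show "det (E z) = z"
      by simp
  qed
  define z where "z = det A"
  have z: "z = 1 \<or> z = - 1"
    unfolding z_def by (rule det_orthogonal_matrix[OF orth_A])
  have "rotation_matrix (E z ** A)"
    unfolding rotation_matrix_def using E[OF z] orth_A z
    by (auto simp: orthogonal_matrix_mul det_mul z_def[symmetric])
  define Ec where "Ec = map_matrix complex_of_real (E z)"
  have SO: "Ec ** k \<in> SO_real"
    unfolding Ec_def kA map_of_real_mult[symmetric] SO_real_def
    using \<open>rotation_matrix (E z ** A)\<close> by blast
  have "upper Ec"
    by (auto simp: upper_def Ec_def E_def)
  have Ec_inv: "invertible Ec"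
  proof -
    have "transpose (E z) ** E z = mat 1"
      using E(1)[OF z] by (simp add: orthogonal_matrix)
    then have "map_matrix complex_of_real (transpose (E z)) ** Ec = mat 1"
      by (simp add: Ec_def map_of_real_mult[symmetric] map_of_real_mat_1)
    then show ?thesis
      using invertible_left_inverse by blast
  qed
  have inv: "invertible (Ec ** b ** perm_mat v)"
    by (intro invertible_mult Ec_inv b invertible_perm_mat v)
  have eq: "Ec ** k ** U = (Ec ** b ** perm_mat v) ** (c ** T)"
    by (simp add: matrix_mul_assoc[symmetric] kU) (simp add: W_def matrix_mul_assoc)
  have cT: "upper (c ** T)" "invertible (c ** T)"
    by (intro upper_mult invertible_mult c T_upper T_inv)+
  then have "frame_flag (Ec ** b ** perm_mat v) = frame_flag (Ec ** k ** U)"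
    using frame_flag_eq_iff[OF inv, of "Ec ** k ** U"] inv eq invertible_mult by metis
  moreover have "frame_flag (Ec ** b ** perm_mat v) \<in> schubert_cell v"
    unfolding schubert_cell_iff[OF v]
    using upper_mult[OF \<open>upper Ec\<close> b(1)] invertible_mult[OF Ec_inv b(2)] by blast
  moreover have "frame_flag (Ec ** k ** U) \<in> orbit SO_real (frame_flag U)"
    unfolding orbit_SO_frame using SO by blast
  ultimately show ?thesis by auto
qed

theorem corollary9:
  fixes D C0 :: "('n::{finite,wellorder}) flag set" and n m :: nat
  assumes "n = CARD('n)" and "n \<ge> 2" and "m = n div 2"
    and "open_real_orbit D" and "is_base_cycle D C0"
  shows "card {S. \<exists>w. w permutes (UNIV :: 'n set) \<and> S = schubert_variety w \<and>
                complex_dim S + complex_dim C0 = complex_dim (flags :: 'n flag set) \<and>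
                S \<inter> C0 \<noteq> {}}
         = (\<Prod>k = 1..m. n - 2 * k + 1)"
proof -
  obtain F1 F where F1: "F1 \<in> flags" "D = orbit SL_real F1" and F: "F \<in> D" "C0 = orbit SO_real F"
    using assms(4,5) unfolding open_real_orbit_def is_base_cycle_def by blast
  obtain d where sub: "complex_submanifold d C0"
    using assms(5) unfolding is_base_cycle_def by blast
  \<comment> \<open>The membership of \<open>F\<close> in \<open>flags\<close> is read off from the
    submanifold \<open>C0\<close>, which contains \<open>F\<close>.\<close>
  have "flag_act (mat 1) F = F"
    by (simp add: flag_act_def)
  then have "F \<in> C0"
    unfolding F(2) orbit_def using mat_1_in_SO_real by (metis image_eqI)
  then have "F \<in> flags"
    using sub unfolding complex_submanifold_def by blast
  then obtain U where U1: "adjoint_mat U ** U = mat 1" "frame_flag U = F"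
    using unitary_frame by blast
  have C0: "C0 = orbit SO_real (frame_flag U)"
    by (simp add: F(2) U1(2))
  have U: "isotropic_frame U"
    using complex_orbit_isotropic[OF U1(1)] sub C0 by blast
  define \<kappa> where "\<kappa> = card (half_pairs :: ('n \<times> 'n) set)"
  \<comment> \<open>The dimension of the flag manifold exceeds that of \<open>C0\<close> by
    \<kappa>, since the upper triangular pairs cancel between the two formulas.\<close>
  have dim: "complex_dim (schubert_variety w) + complex_dim C0 = complex_dim (flags :: 'n flag set)
      \<longleftrightarrow> card (inversions w) = \<kappa>" if "w permutes UNIV" for w :: "'n \<Rightarrow> 'n"
    using complex_dim_schubert_variety[OF that] complex_dim_flags[where 'n = 'n]
      complex_dim_base_cycle[OF U] sub unfolding C0 \<kappa>_def by fastforce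
  have "{S. \<exists>w. w permutes (UNIV :: 'n set) \<and> S = schubert_variety w \<and>
      complex_dim S + complex_dim C0 = complex_dim (flags :: 'n flag set) \<and> S \<inter> C0 \<noteq> {}} =
    schubert_variety ` {w. w permutes (UNIV :: 'n set) \<and> special w}"
  proof (intro equalityI subsetI)
    fix S assume "S \<in> {S. \<exists>w. w permutes (UNIV :: 'n set) \<and> S = schubert_variety w \<and>
      complex_dim S + complex_dim C0 = complex_dim (flags :: 'n flag set) \<and> S \<inter> C0 \<noteq> {}}"
    then obtain w F' where w: "w permutes (UNIV :: 'n set)" "S = schubert_variety w"
      "card (inversions w) = \<kappa>" and F': "F' \<in> schubert_variety w" "F' \<in> C0"
      using dim by blast
    obtain v where v: "v permutes UNIV" "F' \<in> schubert_cell v"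
      using schubert_cell_cover[OF schubert_variety_rank(1)[OF w(1) F'(1)]] .
    have "generous v"
      using generous_of_meet[OF U v(1) _ v(2)] F'(2) C0 by blast
    then have "special v \<or> \<kappa> < card (inversions v)"
      unfolding \<kappa>_def by (rule generous_inversions[OF permutes_inj[OF v(1)]])
    moreover have "v = w \<or> card (inversions v) < \<kappa>"
      using schubert_variety_cell[OF w(1) v(1) F'(1) v(2)] w(3) by simp
    ultimately have "special w"
      using card_inversions_special[OF permutes_inj[OF v(1)]] w(3) by (auto simp: \<kappa>_def)
    then show "S \<in> schubert_variety ` {w. w permutes (UNIV :: 'n set) \<and> special w}"
      using w by blast
  next
    fix S assume "S \<in> schubert_variety ` {w. w permutes (UNIV :: 'n set) \<and> special w}"
    then obtain w where w: "w permutes (UNIV :: 'n set)" "S = schubert_variety w" "special w"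
      by blast
    have "card (inversions w) = \<kappa>"
      unfolding \<kappa>_def by (rule card_inversions_special[OF permutes_inj[OF w(1)] w(3)])
    moreover have "w (opp c) < w c" if "c < opp c" for c
      using w(3) that by (simp add: special_def special_at_def)
    then have "schubert_variety w \<inter> C0 \<noteq> {}"
      using orbit_meets_cell[OF U w(1)] schubert_cell_subset_variety[OF w(1)] C0 by blast
    ultimately show "S \<in> {S. \<exists>w. w permutes (UNIV :: 'n set) \<and> S = schubert_variety w \<and>
      complex_dim S + complex_dim C0 = complex_dim (flags :: 'n flag set) \<and> S \<inter> C0 \<noteq> {}}"
      using w dim by blast
  qed
  moreover have "inj_on schubert_variety {w. w permutes (UNIV :: 'n set) \<and> special w}"
    by (rule inj_onI) (auto dest: schubert_variety_inject)
  ultimately show ?thesis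
    by (simp add: card_image card_special assms(1,3))
qed

end
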